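(* Let $f:\mathbb{R}^m\to\mathbb{R}$ be a non-constant continuously differentiable function, and let $L>0$ be such that $\|\nabla f(x)\|_2\le L$ for all $x\in\mathbb{R}^m$. Let $\rho$ be a positive and bounded probability density function on $\mathbb{R}^m$ such that $f$ is square integrable with respect to $\rho$ and all products of partial derivatives $\frac{\partial f}{\partial x_i}\frac{\partial f}{\partial x_j}$ are integrable with respect to $\rho$. Define $$E=\int_{\mathbb{R}^m}\nabla f(x)\,(\nabla f(x))^T\rho(x)\,dx\in\mathbb{R}^{m\times m},$$ with eigenvalues $\lambda_1\ge\cdots\ge\lambda_m\ge 0$ and corresponding orthonormal eigenvectors $v_1,\dots,v_m$, and suppose that for some $1\le k<m$ we have $\lambda_k>\lambda_{k+1}$. Let $\mathcal{S}=\mathrm{range}\,(v_1\ \cdots\ v_k)$ be the active subspace of dimension $k$ of $f$. Let $x_1,\dots,x_n\in\mathbb{R}^m$ be sampled independently according to $\rho$, let $$\widehat{E}=\frac1n\sum_{j=1}^n\nabla f(x_j)\,(\nabla f(x_j))^T$$ with eigenvalues $\widehat\lambda_1\ge\cdots\ge\widehat\lambda_m\ge 0$ and corresponding orthonormal eigenvectors $\widehat v_1,\dots,\widehat v_m$, and let $\widehat{\mathcal{S}}=\mathrm{range}\,(\widehat v_1\ \cdots\ \widehat v_k)$ be the approximate active subspace. Let $0<\epsilon<\frac{\lambda_k-\lambda_{k+1}}{4\|E\|_2}$ and $0<\delta<1$. If the number of Monte Carlo samples satisfies $$n\ge\frac{8}{3\epsilon^2}\,\frac{L^2}{\|E\|_2}\,\ln\left(\frac{4}{\delta}\,\mathrm{intdim}(E)\right),$$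 then with probability at least $1-\delta$, the approximate active subspace $\widehat{\mathcal{S}}$ is well-defined (that is, $\widehat\lambda_k>\widehat\lambda_{k+1}$), and the largest principal angle $\angle(\widehat{\mathcal{S}},\mathcal{S})$ satisfies $$\sin\angle(\widehat{\mathcal{S}},\mathcal{S})\le\frac{4\|E\|_2}{\lambda_k-\lambda_{k+1}}\,\epsilon.$$
   Context: $\|\cdot\|_2$ is the Euclidean norm for vectors and the spectral (operator two-) norm for matrices. $\nabla f(x)\in\mathbb{R}^m$ is the gradient as a column vector. For a non-zero symmetric positive semi-definite matrix $P$, the intrinsic dimension is $\mathrm{intdim}(P)=\mathrm{trace}(P)/\|P\|_2$. The dominant $k$-dimensional subspace (the span of eigenvectors for the $k$ largest eigenvalues) is called well-defined when there is a strict gap between the $k$-th and $(k+1)$-st largest eigenvalues. For subspaces $\mathcal{S},\widehat{\mathcal{S}}$ of the same dimension, the largest principal angle $\angle(\widehat{\mathcal{S}},\mathcal{S})\in[0,\pi/2]$ satisfies $\sin\angle(\widehat{\mathcal{S}},\mathcal{S})=\|\Pi_{\mathcal{S}}-\Pi_{\widehat{\mathcal{S}}}\|_2$, where $\Pi_{\mathcal{S}},\Pi_{\widehat{\mathcal{S}}}$ are the orthogonal projectors onto $\mathcal{S},\widehat{\mathcal{S}}$. *)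

theory Defs
  imports "HOL-Probability.Probability"
begin

text \<open>
  \<open>x x\<^sup>T\<close>.  The type constraints make the common dimension of the two factors equal to 1.
\<close>
definition outer_square :: "real ^ 'm \<Rightarrow> real ^ 'm ^ 'm" where
  "outer_square x = (columnvector x :: real ^ 1 ^ 'm) ** (rowvector x :: real ^ 'm ^ 1)"

definition spectral_norm :: "real ^ 'n ^ 'm \<Rightarrow> real" where
  "spectral_norm A = onorm ((*v) A)"

definition intdim :: "real ^ 'm ^ 'm \<Rightarrow> real" where
  "intdim P = trace P / spectral_norm P"

text \<open>
  All \<open>m\<close> eigenvalues, counted with multiplicity, in non-increasing order and numbered from 1
  to \<open>m\<close>, with corresponding orthonormal eigenvectors.  The values of \<open>l\<close> and \<open>v\<close> at other
  indices are irrelevant.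
\<close>
definition sorted_eigensystem ::
    "real ^ 'm ^ 'm \<Rightarrow> (nat \<Rightarrow> real) \<Rightarrow> (nat \<Rightarrow> real ^ 'm) \<Rightarrow> bool" where
  "sorted_eigensystem A l v \<longleftrightarrow>
     (\<forall>i\<in>{1..CARD('m)}. A *v v i = l i *\<^sub>R v i) \<and>
     (\<forall>i\<in>{1..CARD('m)}. \<forall>j\<in>{1..CARD('m)}. v i \<bullet> v j = (if i = j then 1 else 0)) \<and>
     (\<forall>i\<in>{1..CARD('m)}. \<forall>j\<in>{1..CARD('m)}. i \<le> j \<longrightarrow> l j \<le> l i)"

definition orth_projector :: "'a::euclidean_space set \<Rightarrow> 'a \<Rightarrow> 'a" where
  "orth_projector S x = (THE y. y \<in> S \<and> (\<forall>z\<in>S. orthogonal (x - y) z))"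

text \<open>
  The largest principal angle between two subspaces of the same dimension, given by
  \<open>sin \<theta> = \<parallel>\<Pi>\<^sub>S - \<Pi>\<^sub>T\<parallel>\<^sub>2\<close>; the operator norm is that of the linear map \<open>\<Pi>\<^sub>S - \<Pi>\<^sub>T\<close>.
\<close>
definition largest_principal_angle ::
    "'a::euclidean_space set \<Rightarrow> 'a set \<Rightarrow> real" where
  "largest_principal_angle T S =
     (THE \<theta>. 0 \<le> \<theta> \<and> \<theta> \<le> pi / 2 \<and>
        sin \<theta> = onorm (\<lambda>x. orth_projector S x - orth_projector T x))"

end

theory Submission
  imports Defs
begin

text \<open>
  Write \<open>S\<close> for the difference between the sample matrix and its mean \<open>E\<close>, and let
  \<open>c \<theta>\<close> be the expectation of \<open>tr (cosh (\<theta> S) - I)\<close>, whose derivative is the expectation of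
  \<open>tr (S sinh (\<theta> S))\<close>. Exchanging one sample with an independent copy and applying the trace
  inequality \<open>tr ((A - B) (sinh A - sinh B)) \<le> 1/2 tr ((A - B)\<^sup>2 (cosh A + cosh B))\<close> bounds this
  derivative by a conditional variance. Since the samples are rank-one squares of vectors of length
  at most \<open>L\<close>, the conditional variance is controlled by \<open>E\<close> and \<open>S\<close> themselves, and the result is
  the differential inequality
  \<open>(1 - \<theta> L\<^sup>2 / (2 n)) c' \<le> (\<theta> L\<^sup>2 / n) (tr E + \<parallel>E\<parallel> c)\<close>. Gronwall's lemma and Markov's inequality give
  a tail bound for \<open>\<parallel>S\<parallel>\<close> whose dimensional factor is the intrinsic dimension of \<open>E\<close>; no concavity
  theorem of Lieb type is needed. On the event \<open>\<parallel>S\<parallel> \<le> \<epsilon> \<parallel>E\<parallel>\<close> the claim follows from Weyl's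
  inequality and the Davis--Kahan theorem.
\<close>

section \<open>Eigenbases and functional calculus of symmetric matrices\<close>

text \<open>Subtracting I from cosh is what keeps the ambient dimension out: c vanishes at 0, so its
  growth is fed by tr E only, whereas tr cosh would start from m. The obstacle is that S and the
  exchanged S' do not commute; traces of two functional calculi are therefore expanded in both
  eigenbases at once, where the squared overlaps are nonnegative weights and a scalar inequality
  suffices. The conditional variance contains a term linear in S cosh(\<theta> S) with coefficient D
  = L^2 I - 2 E. It is split as S + S (cosh(\<theta> S) - I): the first part has mean zero, and the
  second is dominated by S sinh(\<theta> S) because 0 \<le> E \<le> L^2 I keeps the quadratic form
  of D within L^2. This is how c' reappears on the right and produces the factor 1 - \<theta>
  L^2/(2n). The value \<theta> = \<epsilon> n / L^2 optimises the resulting exponent up to that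
  factor.\<close>

lemma symmetric_inner:
  fixes A :: "real ^ 'm ^ 'm"
  assumes "transpose A = A"
  shows "(A *v x) \<bullet> y = x \<bullet> (A *v y)"
  by (metis assms dot_lmul_matrix inner_commute vector_transpose_matrix)

text \<open>Eigenvalues are not carried along: for a unit eigenvector the eigenvalue is its Rayleigh
  quotient. An unordered set suits spectral sums, where multiplicities are counted by distinct basis
  vectors.\<close>

definition eigenbasis :: "real ^ 'm ^ 'm \<Rightarrow> (real ^ 'm) set \<Rightarrow> bool" where
  "eigenbasis A B \<longleftrightarrow> finite B \<and> (\<forall>b\<in>B. norm b = 1) \<and> pairwise orthogonal B \<and> span B = UNIV \<and>
     (\<forall>b\<in>B. A *v b = (b \<bullet> (A *v b)) *\<^sub>R b)"

text \<open>First-order optimality in algebraic form: a quadratic in t that is nonnegative and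
  vanishes at t = 0 cannot have a linear term. It replaces differentiation of the Rayleigh quotient
  along a line.\<close>

lemma linear_term_zero:
  fixes p q :: real
  assumes "\<And>t. 0 \<le> t * p + t\<^sup>2 * q"
  shows "p = 0"
proof (rule ccontr)
  assume p: "p \<noteq> 0"
  have q: "q \<ge> 0" using assms[of 1] assms[of "-1"] by simp
  show False
  proof (cases "q = 0")
    case True
    then show False using assms[of "-p"] p not_real_square_gt_zero[of p] by simp
  next
    case False
    then have "q > 0" using q by simp
    \<comment> \<open>The point t = -p/(2q) is the minimiser of the quadratic.\<close>
    have "- p / (2*q) * p + (- p / (2*q))\<^sup>2 * q = - (p\<^sup>2 / (4 * q))"
      using \<open>q > 0\<close> by (simp add: field_simps power2_eq_square)
    moreover have "p\<^sup>2 / (4 * q) > 0" using p \<open>q > 0\<close> by simp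
    ultimately show False using assms[of "-p/(2*q)"] by linarith
  qed
qed

text \<open>A maximiser u of the Rayleigh quotient on the unit sphere of V is an eigenvector: the
  residual A u - l u lies in V by invariance, so it is an admissible direction of variation, and
  stationarity in that direction says that the residual is orthogonal to itself.\<close>

lemma symmetric_invariant_eigenvector:
  fixes A :: "real ^ 'm ^ 'm"
  assumes A: "transpose A = A" and V: "subspace V" and inv: "\<And>x. x \<in> V \<Longrightarrow> A *v x \<in> V"
    and nz: "V \<noteq> {0}"
  obtains u where "u \<in> V" "norm u = 1" "A *v u = (u \<bullet> (A *v u)) *\<^sub>R u"
proof -
  let ?K = "V \<inter> sphere 0 1"
  have "compact ?K"
    using V closed_subspace compact_Int_closed compact_sphere by (metis inf_commute)
  moreover have "?K \<noteq> {}"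
  proof -
    from nz V obtain x where "x \<in> V" "x \<noteq> 0" using subspace_0 by blast
    then have "(1 / norm x) *\<^sub>R x \<in> ?K" using V by (simp add: subspace_scale)
    then show ?thesis by blast
  qed
  moreover have "continuous_on ?K (\<lambda>x. x \<bullet> (A *v x))"
    by (intro continuous_intros matrix_vector_mult_linear_continuous_on)
  ultimately obtain u where u: "u \<in> ?K" and max: "\<And>y. y \<in> ?K \<Longrightarrow> y \<bullet> (A *v y) \<le> u \<bullet> (A *v u)"
    using continuous_attains_sup[of ?K "\<lambda>x. x \<bullet> (A *v x)"] by blast
  define l where "l = u \<bullet> (A *v u)"
  have uV: "u \<in> V" and un: "norm u = 1" and uu: "u \<bullet> u = 1" using u by (auto simp: norm_eq_1)
  have q: "y \<bullet> (A *v y) \<le> l * (y \<bullet> y)" if "y \<in> V" for y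
  proof (cases "y = 0")
    case False
    have "(1 / norm y) *\<^sub>R y \<in> ?K" using that False V by (simp add: subspace_scale)
    from max[OF this] have "(y \<bullet> (A *v y)) / (norm y)\<^sup>2 \<le> l"
      by (simp add: l_def matrix_vector_mult_scaleR power2_eq_square)
    then show ?thesis using False by (simp add: divide_le_eq power2_norm_eq_inner)
  qed simp
  define w where "w = A *v u - l *\<^sub>R u"
  have wV: "w \<in> V" using uV V inv by (simp add: w_def subspace_diff subspace_scale)
  \<comment> \<open>Expansion of \<open>q\<close> at u + t w; the terms of order 0 cancel because u
    attains the bound.\<close>
  have "0 \<le> t * (2 * (l * (u \<bullet> w) - w \<bullet> (A *v u))) + t\<^sup>2 * (l * (w \<bullet> w) - w \<bullet> (A *v w))" for t
  proof -
    have "u + t *\<^sub>R w \<in> V" using uV wV V by (simp add: subspace_add subspace_scale)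
    from q[OF this]
    show ?thesis
      using symmetric_inner[OF A, of u w] uu
      by (simp add: matrix_vector_mult_scaleR matrix_vector_right_distrib inner_simps l_def[symmetric]
          inner_commute power2_eq_square algebra_simps)
  qed
  then have "2 * (l * (u \<bullet> w) - w \<bullet> (A *v u)) = 0" by (rule linear_term_zero)
  moreover have "w \<bullet> w = w \<bullet> (A *v u) - l * (u \<bullet> w)"
    by (subst (2) w_def) (simp add: inner_simps inner_commute)
  ultimately have "w \<bullet> w = 0" by simp
  then have "A *v u = l *\<^sub>R u" by (simp add: w_def)
  then show ?thesis using that[of u] uV un by (simp add: l_def)
qed

text \<open>Invariant subspaces rather than the whole space make the induction on dimension go
  through: symmetry of A keeps the part of V orthogonal to an eigenvector invariant.\<close>

lemma symmetric_invariant_eigenbasis: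
  fixes A :: "real ^ 'm ^ 'm"
  assumes A: "transpose A = A" and V: "subspace V" and inv: "\<And>x. x \<in> V \<Longrightarrow> A *v x \<in> V"
  shows "\<exists>B. finite B \<and> (\<forall>b\<in>B. norm b = 1) \<and> pairwise orthogonal B \<and> span B = V \<and>
     (\<forall>b\<in>B. A *v b = (b \<bullet> (A *v b)) *\<^sub>R b)"
  using V inv
proof (induction "dim V" arbitrary: V rule: less_induct)
  case less
  show ?case
  proof (cases "V = {0}")
    case True
    then show ?thesis by (intro exI[of _ "{}"]) simp
  next
    case False
    obtain u where u: "u \<in> V" "norm u = 1" "A *v u = (u \<bullet> (A *v u)) *\<^sub>R u"
      using symmetric_invariant_eigenvector[OF A less.prems(1) less.prems(2) False] by blast
    define W where "W = {x\<in>V. orthogonal u x}"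
    have W: "subspace W" unfolding W_def
      using less.prems(1) by (auto simp: subspace_def orthogonal_def inner_simps)
    have Winv: "A *v x \<in> W" if "x \<in> W" for x
    proof -
      have "u \<bullet> (A *v x) = (A *v u) \<bullet> x" by (simp add: symmetric_inner[OF A])
      also have "\<dots> = 0" using that by (subst u(3)) (simp add: W_def orthogonal_def)
      finally show ?thesis using that less.prems(2) by (simp add: W_def orthogonal_def)
    qed
    have "u \<notin> W" using u(2) by (simp add: W_def orthogonal_def norm_eq_1)
    then have "W \<subset> V" using u(1) by (auto simp: W_def)
    then have "dim W < dim V" using W less.prems(1)
      by (metis dim_psubset span_eq_iff)
    then obtain B where B: "finite B" "\<forall>b\<in>B. norm b = 1" "pairwise orthogonal B" "span B = W"
        "\<forall>b\<in>B. A *v b = (b \<bullet> (A *v b)) *\<^sub>R b"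
      using less.hyps[OF _ W Winv] by blast
    have BW: "B \<subseteq> W" using B(4) span_superset by blast
    have "span (insert u B) = V"
    proof
      show "span (insert u B) \<subseteq> V"
        using BW u(1) less.prems(1) by (intro span_minimal) (auto simp: W_def)
      show "V \<subseteq> span (insert u B)"
      proof
        fix x assume x: "x \<in> V"
        have "x - (u \<bullet> x) *\<^sub>R u \<in> W"
          using x u less.prems(1) unfolding W_def orthogonal_def
          by (simp add: subspace_diff subspace_scale inner_simps norm_eq_1)
        then show "x \<in> span (insert u B)"
          unfolding span_insert B(4) by blast
      qed
    qed
    moreover have "pairwise orthogonal (insert u B)"
      using B(3) BW by (auto simp: pairwise_insert W_def orthogonal_commute)
    ultimately show ?thesis using B u by (intro exI[of _ "insert u B"]) simp
  qed
qed

theorem symmetric_eigenbasis_exists: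
  fixes A :: "real ^ 'm ^ 'm"
  assumes "transpose A = A"
  shows "\<exists>B. eigenbasis A B"
  using symmetric_invariant_eigenbasis[OF assms subspace_UNIV] by (auto simp: eigenbasis_def)

section \<open>Rank-one squares and matrix algebra\<close>

lemma outer_square_apply: "outer_square x *v y = (x \<bullet> y) *\<^sub>R x"
  by (simp add: outer_square_def vec_eq_iff columnvector_def rowvector_def matrix_matrix_mult_def
      matrix_vector_mult_def inner_vec_def sum_distrib_left sum_distrib_right mult_ac)

lemma transpose_outer_square: "transpose (outer_square x) = outer_square x"
  by (simp add: outer_square_def matrix_transpose_mul transpose_columnvector transpose_rowvector)

lemma outer_square_component: "outer_square x $ i $ j = x $ i * x $ j"
  by (simp add: outer_square_def columnvector_def rowvector_def matrix_matrix_mult_def)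

lemma trace_mult_outer_square: "trace (C ** outer_square x) = x \<bullet> (C *v x)"
  by (simp add: trace_def matrix_matrix_mult_def outer_square_component inner_vec_def
      matrix_vector_mult_def sum_distrib_left mult_ac)

lemma trace_scaleR: "trace (c *\<^sub>R A) = c * trace (A :: real ^ 'm ^ 'm)"
  by (simp add: trace_def sum_distrib_left)

lemma trace_sum: "trace (\<Sum>i\<in>I. A i) = (\<Sum>i\<in>I. trace (A i :: real ^ 'm ^ 'm))"
  by (induction I rule: infinite_finite_induct) (simp_all add: trace_0 trace_add flip: mat_0)

lemma transpose_add: "transpose (A + B) = transpose A + transpose (B :: real ^ 'm ^ 'n)"
  by (simp add: transpose_def vec_eq_iff)

lemma transpose_diff: "transpose (A - B) = transpose A - transpose (B :: real ^ 'm ^ 'n)"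
  by (simp add: transpose_def vec_eq_iff)

lemma transpose_sum: "transpose (\<Sum>i\<in>I. A i) = (\<Sum>i\<in>I. transpose (A i :: real ^ 'm ^ 'n))"
  by (simp add: transpose_def vec_eq_iff)

lemma matrix_add_rdistrib: "(A + B) ** C = A ** C + B ** (C :: real ^ 'm ^ 'n)"
  by (simp add: vec_eq_iff matrix_matrix_mult_def sum.distrib distrib_right)

lemma matrix_sub_rdistrib: "(A - B) ** C = A ** C - B ** (C :: real ^ 'm ^ 'n)"
  by (simp add: vec_eq_iff matrix_matrix_mult_def sum_subtractf left_diff_distrib)

lemma matrix_sub_ldistrib: "C ** (A - B) = C ** A - C ** (B :: real ^ 'm ^ 'n)"
  by (simp add: vec_eq_iff matrix_matrix_mult_def sum_subtractf right_diff_distrib)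

lemma matrix_mul_sum_left: "(\<Sum>i\<in>I. A i) ** B = (\<Sum>i\<in>I. A i ** (B :: real ^ 'm ^ 'n))"
  by (induction I rule: infinite_finite_induct) (simp_all add: matrix_add_rdistrib)

lemma matrix_mul_sum_right: "B ** (\<Sum>i\<in>I. A i) = (\<Sum>i\<in>I. B ** (A i :: real ^ 'm ^ 'n))"
  by (induction I rule: infinite_finite_induct) (simp_all add: matrix_add_ldistrib)

lemma matrix_mul_scaleR_left: "(c *\<^sub>R A) ** B = c *\<^sub>R (A ** (B :: real ^ 'm ^ 'n))"
  by (simp add: vec_eq_iff matrix_matrix_mult_def sum_distrib_left mult_ac)

lemma matrix_mul_scaleR_right: "A ** (c *\<^sub>R B) = c *\<^sub>R (A ** (B :: real ^ 'm ^ 'n))"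
  by (simp add: vec_eq_iff matrix_matrix_mult_def sum_distrib_left mult_ac)

lemma bounded_bilinear_matrix_mul: "bounded_bilinear ((**) :: real ^ 'm ^ 'n \<Rightarrow> real ^ 'p ^ 'm \<Rightarrow> real ^ 'p ^ 'n)"
  unfolding bilinear_conv_bounded_bilinear[symmetric] bilinear_def
  by (auto intro!: linearI simp: matrix_add_ldistrib matrix_add_rdistrib matrix_mul_scaleR_left matrix_mul_scaleR_right)

lemma outer_square_continuous: "continuous_on UNIV outer_square"
proof -
  have *: "outer_square = (\<lambda>x. \<chi> i j. x $ i * x $ j)"
    by (simp add: fun_eq_iff vec_eq_iff outer_square_component)
  have "continuous_on UNIV (\<lambda>x::real ^ 'm. x $ i * x $ j)" for i j
    by (intro continuous_on_mult linear_continuous_on bounded_linear_vec_nth)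
  then show ?thesis unfolding * by (rule continuous_on_vec_lambda[OF continuous_on_vec_lambda])
qed

context
  fixes A :: "real ^ 'm ^ 'm" and B :: "(real ^ 'm) set"
  assumes B: "eigenbasis A B"
begin

lemma eigenbasis_finite: "finite B"
  using B by (simp add: eigenbasis_def)

lemma eigenbasis_inner: "a \<in> B \<Longrightarrow> b \<in> B \<Longrightarrow> a \<bullet> b = (if a = b then 1 else 0)"
  using B by (auto simp: eigenbasis_def pairwise_def orthogonal_def norm_eq_1)

lemma eigenbasis_norm: "b \<in> B \<Longrightarrow> norm b = 1"
  using B by (simp add: eigenbasis_def)

lemma eigenbasis_expand: "(\<Sum>b\<in>B. (x \<bullet> b) *\<^sub>R b) = x"
  using B by (intro orthonormal_basis_expand) (auto simp: eigenbasis_def)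

lemma eigenbasis_parseval: "x \<bullet> y = (\<Sum>b\<in>B. (x \<bullet> b) * (y \<bullet> b))"
  by (subst eigenbasis_expand[of y, symmetric]) (simp add: inner_sum_right mult.commute)

lemma eigenbasis_apply: "b \<in> B \<Longrightarrow> A *v b = (b \<bullet> (A *v b)) *\<^sub>R b"
  using B by (simp add: eigenbasis_def)

end

text \<open>Meaningful only for symmetric matrices; otherwise there need not be an eigenbasis to choose.\<close>

definition eigenvectors :: "real ^ 'm ^ 'm \<Rightarrow> (real ^ 'm) set" where
  "eigenvectors A = (SOME B. eigenbasis A B)"

text \<open>The spectral calculus h(A). Every h uses the same choice \<open>eigenvectors A\<close>,
  so calculi of one matrix multiply pointwise.\<close>

definition matrix_fun :: "(real \<Rightarrow> real) \<Rightarrow> real ^ 'm ^ 'm \<Rightarrow> real ^ 'm ^ 'm" where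
  "matrix_fun h A = (\<Sum>b\<in>eigenvectors A. h (b \<bullet> (A *v b)) *\<^sub>R outer_square b)"

lemma eigenbasis_eigenvectors: "transpose A = A \<Longrightarrow> eigenbasis A (eigenvectors A)"
  unfolding eigenvectors_def by (rule someI_ex) (rule symmetric_eigenbasis_exists)

lemma trace_mult_matrix_fun:
  "trace (C ** matrix_fun h A) = (\<Sum>b\<in>eigenvectors A. h (b \<bullet> (A *v b)) * (b \<bullet> (C *v b)))"
  by (simp add: matrix_fun_def matrix_mul_sum_right matrix_mul_scaleR_right trace_sum trace_scaleR
      trace_mult_outer_square)

lemma matrix_fun_apply:
  "matrix_fun h A *v x = (\<Sum>b\<in>eigenvectors A. (h (b \<bullet> (A *v b)) * (b \<bullet> x)) *\<^sub>R b)"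
proof -
  have lin: "linear (\<lambda>M. M *v x)" for x :: "real ^ 'm"
    by (intro linearI) (simp_all add: matrix_vector_mult_add_rdistrib scaleR_matrix_vector_assoc)
  show ?thesis
    by (simp add: matrix_fun_def linear_sum[OF lin] scaleR_matrix_vector_assoc[symmetric] outer_square_apply)
qed

lemma matrix_fun_eigenvector:
  assumes "transpose A = A" "b \<in> eigenvectors A"
  shows "matrix_fun h A *v b = h (b \<bullet> (A *v b)) *\<^sub>R b"
proof -
  note B = eigenbasis_eigenvectors[OF assms(1)]
  have "matrix_fun h A *v b = (\<Sum>a\<in>eigenvectors A. if a = b then h (b \<bullet> (A *v b)) *\<^sub>R b else 0)"
    unfolding matrix_fun_apply
    by (intro sum.cong refl) (use assms(2) in \<open>simp add: eigenbasis_inner[OF B]\<close>)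
  then show ?thesis using assms(2) eigenbasis_finite[OF B] by simp
qed

lemma transpose_matrix_fun: "transpose (matrix_fun h A) = matrix_fun h A"
  by (simp add: matrix_fun_def transpose_sum transpose_scalar transpose_outer_square)

lemma matrix_fun_mult:
  assumes "transpose A = A"
  shows "matrix_fun h A ** matrix_fun g A = matrix_fun (\<lambda>x. h x * g x) A"
proof -
  have "(matrix_fun h A ** matrix_fun g A) *v x = matrix_fun (\<lambda>x. h x * g x) A *v x" for x
  proof -
    have "(matrix_fun h A ** matrix_fun g A) *v x =
      matrix_fun h A *v (\<Sum>b\<in>eigenvectors A. (g (b \<bullet> (A *v b)) * (b \<bullet> x)) *\<^sub>R b)"
      by (simp add: matrix_vector_mul_assoc[symmetric] matrix_fun_apply[of g])
    also have "\<dots> = (\<Sum>b\<in>eigenvectors A. (g (b \<bullet> (A *v b)) * (b \<bullet> x)) *\<^sub>R (matrix_fun h A *v b))"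
      by (simp add: matrix_vector_mult_scaleR linear_sum[OF matrix_vector_mul_linear])
    also have "\<dots> = matrix_fun (\<lambda>x. h x * g x) A *v x"
      by (subst matrix_fun_apply, intro sum.cong refl)
        (simp add: matrix_fun_eigenvector[OF assms] mult_ac)
    finally show ?thesis .
  qed
  then show ?thesis by (simp add: matrix_eq)
qed

lemma matrix_fun_id: "transpose A = A \<Longrightarrow> matrix_fun (\<lambda>x. x) A = A"
proof -
  assume A: "transpose A = A"
  note B = eigenbasis_eigenvectors[OF A]
  have "matrix_fun (\<lambda>x. x) A *v x = A *v x" for x
  proof -
    have "A *v x = (\<Sum>b\<in>eigenvectors A. (x \<bullet> b) *\<^sub>R (A *v b))"
      by (subst eigenbasis_expand[OF B, of x, symmetric])
        (simp add: linear_sum[OF matrix_vector_mul_linear] matrix_vector_mult_scaleR)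
    also have "\<dots> = matrix_fun (\<lambda>x. x) A *v x"
      unfolding matrix_fun_apply
      by (intro sum.cong refl, subst eigenbasis_apply[OF B], assumption) (simp add: inner_commute mult_ac)
    finally show ?thesis ..
  qed
  then show ?thesis by (simp add: matrix_eq)
qed

lemma matrix_fun_one: "transpose A = A \<Longrightarrow> matrix_fun (\<lambda>x. 1) A = mat 1"
  by (simp add: matrix_eq matrix_fun_apply eigenbasis_expand[OF eigenbasis_eigenvectors] inner_commute)

lemma matrix_fun_diff: "matrix_fun (\<lambda>x. h x - g x) A = matrix_fun h A - matrix_fun g A"
  by (simp add: matrix_fun_def sum_subtractf scaleR_left_diff_distrib)

section \<open>Traces of products in a pair of eigenbases\<close>

lemma trace_matrix_fun:
  "transpose A = A \<Longrightarrow> trace (matrix_fun h A) = (\<Sum>b\<in>eigenvectors A. h (b \<bullet> (A *v b)))"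
  using trace_mult_matrix_fun[of "mat 1" h A] eigenbasis_eigenvectors[of A]
  by (simp add: eigenbasis_def norm_eq_1)

text \<open>The squares (a \<bullet> b)^2 form a doubly stochastic array of nonnegative weights.
  They stand in for a common eigenbasis, which noncommuting A and B lack, and reduce trace
  statements to statements on pairs of scalar eigenvalues.\<close>

lemma trace_matrix_fun_mult:
  assumes "transpose A = A" "transpose B = B"
  shows "trace (matrix_fun h A ** matrix_fun g B) =
    (\<Sum>a\<in>eigenvectors A. \<Sum>b\<in>eigenvectors B. h (a \<bullet> (A *v a)) * g (b \<bullet> (B *v b)) * (a \<bullet> b)\<^sup>2)"
  unfolding trace_mult_matrix_fun
  by (subst sum.swap)
    (simp add: matrix_fun_apply inner_sum_right sum_distrib_left inner_commute power2_eq_square mult_ac)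

text \<open>Obtained by inserting the identity as the constant-one function of B, so that single and
  mixed traces are sums over the same pairs.\<close>

lemma trace_matrix_fun_double_sum_left:
  assumes "transpose A = A" "transpose B = B"
  shows "trace (matrix_fun h A) =
    (\<Sum>a\<in>eigenvectors A. \<Sum>b\<in>eigenvectors B. h (a \<bullet> (A *v a)) * (a \<bullet> b)\<^sup>2)"
  using trace_matrix_fun_mult[OF assms, of h "\<lambda>x. 1"] by (simp add: matrix_fun_one[OF assms(2)])

lemma trace_matrix_fun_double_sum_right:
  assumes "transpose A = A" "transpose B = B"
  shows "trace (matrix_fun h B) =
    (\<Sum>a\<in>eigenvectors A. \<Sum>b\<in>eigenvectors B. h (b \<bullet> (B *v b)) * (a \<bullet> b)\<^sup>2)"
  using trace_matrix_fun_mult[OF assms, of "\<lambda>x. 1" h] by (simp add: matrix_fun_one[OF assms(1)])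

text \<open>Under the trace the eigenvalues of A and B behave like commuting variables: cyclicity
  puts the A-factor of each mixed product first.\<close>

lemma trace_diff_mult_matrix_fun_diff:
  assumes A: "transpose A = A" and B: "transpose B = B"
  shows "trace ((matrix_fun g A - matrix_fun g B) ** (matrix_fun f A - matrix_fun f B)) =
    (\<Sum>a\<in>eigenvectors A. \<Sum>b\<in>eigenvectors B.
       (g (a \<bullet> (A *v a)) - g (b \<bullet> (B *v b))) * (f (a \<bullet> (A *v a)) - f (b \<bullet> (B *v b))) * (a \<bullet> b)\<^sup>2)"
proof -
  have "trace ((matrix_fun g A - matrix_fun g B) ** (matrix_fun f A - matrix_fun f B)) =
    trace (matrix_fun (\<lambda>x. g x * f x) A) - trace (matrix_fun g A ** matrix_fun f B)
    - trace (matrix_fun f A ** matrix_fun g B) + trace (matrix_fun (\<lambda>x. g x * f x) B)"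
    by (simp add: matrix_sub_rdistrib matrix_sub_ldistrib trace_sub matrix_fun_mult[OF A] matrix_fun_mult[OF B]
        trace_mul_sym[of "matrix_fun g B" "matrix_fun f A"])
  also have "\<dots> = (\<Sum>a\<in>eigenvectors A. \<Sum>b\<in>eigenvectors B.
       (g (a \<bullet> (A *v a)) - g (b \<bullet> (B *v b))) * (f (a \<bullet> (A *v a)) - f (b \<bullet> (B *v b))) * (a \<bullet> b)\<^sup>2)"
    unfolding trace_matrix_fun_mult[OF A B] trace_matrix_fun_double_sum_left[OF A B] trace_matrix_fun_double_sum_right[OF A B]
    unfolding sum.distrib[symmetric] sum_subtractf[symmetric]
    by (intro sum.cong refl) (simp add: algebra_simps)
  finally show ?thesis .
qed

lemma trace_square_diff_mult_matrix_fun: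
  assumes A: "transpose A = A" and B: "transpose B = B"
  shows "trace ((A - B) ** (A - B) ** matrix_fun p A) =
    (\<Sum>a\<in>eigenvectors A. \<Sum>b\<in>eigenvectors B.
       ((a \<bullet> (A *v a)) - (b \<bullet> (B *v b)))\<^sup>2 * p (a \<bullet> (A *v a)) * (a \<bullet> b)\<^sup>2)"
proof -
  let ?I = "matrix_fun (\<lambda>x. x)"
  have Ap: "?I A ** matrix_fun p A = matrix_fun (\<lambda>x. x * p x) A"
    and pA: "matrix_fun p A ** ?I A = matrix_fun (\<lambda>x. x * p x) A"
    and AAp: "?I A ** ?I A ** matrix_fun p A = matrix_fun (\<lambda>x. x\<^sup>2 * p x) A"
    and BB: "?I B ** ?I B = matrix_fun (\<lambda>x. x\<^sup>2) B"
    using A B by (simp_all add: matrix_fun_mult power2_eq_square mult.commute)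
  have "trace ((?I A - ?I B) ** (?I A - ?I B) ** matrix_fun p A) =
    trace (?I A ** ?I A ** matrix_fun p A) - trace (?I A ** (?I B ** matrix_fun p A))
     - trace (?I B ** (?I A ** matrix_fun p A)) + trace (?I B ** ?I B ** matrix_fun p A)"
    by (simp add: matrix_sub_rdistrib matrix_sub_ldistrib trace_sub matrix_mul_assoc)
  also have "trace (?I A ** (?I B ** matrix_fun p A)) = trace (matrix_fun (\<lambda>x. x * p x) A ** ?I B)"
    by (simp only: trace_mul_sym[of "?I A"] matrix_mul_assoc[symmetric] pA trace_mul_sym[of "?I B"])
  also have "trace (?I B ** (?I A ** matrix_fun p A)) = trace (matrix_fun (\<lambda>x. x * p x) A ** ?I B)"
    by (simp only: Ap trace_mul_sym[of "?I B"])
  also have "trace (?I B ** ?I B ** matrix_fun p A) = trace (matrix_fun p A ** matrix_fun (\<lambda>x. x\<^sup>2) B)"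
    by (simp only: BB trace_mul_sym[of _ "matrix_fun p A"])
  also have "trace (?I A ** ?I A ** matrix_fun p A) - trace (matrix_fun (\<lambda>x. x * p x) A ** ?I B)
     - trace (matrix_fun (\<lambda>x. x * p x) A ** ?I B) + trace (matrix_fun p A ** matrix_fun (\<lambda>x. x\<^sup>2) B) =
    (\<Sum>a\<in>eigenvectors A. \<Sum>b\<in>eigenvectors B.
       ((a \<bullet> (A *v a)) - (b \<bullet> (B *v b)))\<^sup>2 * p (a \<bullet> (A *v a)) * (a \<bullet> b)\<^sup>2)"
    unfolding AAp trace_matrix_fun_mult[OF A B] trace_matrix_fun_double_sum_left[OF A B]
    unfolding sum.distrib[symmetric] sum_subtractf[symmetric]
    by (intro sum.cong refl) (simp add: algebra_simps power2_eq_square)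
  finally show ?thesis by (simp add: matrix_fun_id[OF A] matrix_fun_id[OF B])
qed

text \<open>A scalar inequality of mean-value type passes to the trace because both sides are sums
  over eigenpairs with the same nonnegative weights (a \<bullet> b)^2.\<close>

lemma trace_matrix_fun_mean_value:
  assumes A: "transpose A = A" and B: "transpose B = B"
    and fp: "\<And>x y. (x - y) * (f x - f y) \<le> c * ((x - y)\<^sup>2 * (p x + p y))"
  shows "trace ((A - B) ** (matrix_fun f A - matrix_fun f B)) \<le>
    c * (trace ((A - B) ** (A - B) ** matrix_fun p A) + trace ((A - B) ** (A - B) ** matrix_fun p B))"
proof -
  have "trace ((A - B) ** (matrix_fun f A - matrix_fun f B)) =
    (\<Sum>a\<in>eigenvectors A. \<Sum>b\<in>eigenvectors B.
       ((a \<bullet> (A *v a)) - (b \<bullet> (B *v b))) * (f (a \<bullet> (A *v a)) - f (b \<bullet> (B *v b))) * (a \<bullet> b)\<^sup>2)"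
    using trace_diff_mult_matrix_fun_diff[OF A B, of "\<lambda>x. x" f] by (simp add: matrix_fun_id[OF A] matrix_fun_id[OF B])
  also have "\<dots> \<le> (\<Sum>a\<in>eigenvectors A. \<Sum>b\<in>eigenvectors B.
       c * ((((a \<bullet> (A *v a)) - (b \<bullet> (B *v b)))\<^sup>2 * p (a \<bullet> (A *v a)) * (a \<bullet> b)\<^sup>2) +
        (((a \<bullet> (A *v a)) - (b \<bullet> (B *v b)))\<^sup>2 * p (b \<bullet> (B *v b)) * (a \<bullet> b)\<^sup>2)))"
  proof (intro sum_mono)
    fix a b :: "real ^ 'a"
    let ?x = "a \<bullet> (A *v a)" and ?y = "b \<bullet> (B *v b)"
    have "(?x - ?y) * (f ?x - f ?y) * (a \<bullet> b)\<^sup>2 \<le> c * ((?x - ?y)\<^sup>2 * (p ?x + p ?y)) * (a \<bullet> b)\<^sup>2"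
      using fp by (intro mult_right_mono) auto
    then show "(?x - ?y) * (f ?x - f ?y) * (a \<bullet> b)\<^sup>2 \<le>
       c * ((?x - ?y)\<^sup>2 * p ?x * (a \<bullet> b)\<^sup>2 + (?x - ?y)\<^sup>2 * p ?y * (a \<bullet> b)\<^sup>2)"
      by (simp add: algebra_simps)
  qed
  \<comment> \<open>The p(B) half is rewritten with summation order and signs reversed, so that it
    is the previous trace formula with A and B interchanged.\<close>
  also have "\<dots> = c * ((\<Sum>a\<in>eigenvectors A. \<Sum>b\<in>eigenvectors B.
       ((a \<bullet> (A *v a)) - (b \<bullet> (B *v b)))\<^sup>2 * p (a \<bullet> (A *v a)) * (a \<bullet> b)\<^sup>2) +
     (\<Sum>b\<in>eigenvectors B. \<Sum>a\<in>eigenvectors A.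
       ((b \<bullet> (B *v b)) - (a \<bullet> (A *v a)))\<^sup>2 * p (b \<bullet> (B *v b)) * (b \<bullet> a)\<^sup>2))"
    by (subst (3) sum.swap) (simp add: sum_distrib_left sum.distrib distrib_left power2_commute inner_commute)
  also have "\<dots> = c * (trace ((A - B) ** (A - B) ** matrix_fun p A) + trace ((B - A) ** (B - A) ** matrix_fun p B))"
    unfolding trace_square_diff_mult_matrix_fun[OF A B] trace_square_diff_mult_matrix_fun[OF B A] ..
  also have "(B - A) ** (B - A) = (A - B) ** (A - B)"
    by (simp add: matrix_sub_rdistrib matrix_sub_ldistrib)
  finally show ?thesis .
qed

section \<open>A trapezoidal inequality for sinh\<close>

lemma sinh_le_mult_cosh: "0 \<le> u \<Longrightarrow> sinh u \<le> u * cosh (u::real)"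
proof -
  assume u: "0 \<le> u"
  \<comment> \<open>The function u cosh u - sinh u has derivative u sinh u, which is
    nonnegative.\<close>
  have "0 * cosh 0 - sinh 0 \<le> u * cosh u - sinh u"
    by (rule DERIV_nonneg_imp_nondecreasing[OF u])
      (auto intro!: derivative_eq_intros exI mult_nonneg_nonneg)
  then show ?thesis by simp
qed

text \<open>Convexity of cosh: its integral between y and x is at most the trapezoidal rule. With
  half-difference u and midpoint w both sides carry the factor 4 cosh w, and u sinh u \<le> u^2 cosh
  u remains.\<close>

lemma sinh_trapezoid:
  fixes x y :: real
  shows "(x - y) * (sinh x - sinh y) \<le> 1/2 * ((x - y)\<^sup>2 * (cosh x + cosh y))"
proof -
  define u w where "u = (x - y) / 2" and "w = (x + y) / 2"
  have xy: "x = w + u" "y = w - u" by (simp_all add: u_def w_def field_simps)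
  have "u * sinh u \<le> u\<^sup>2 * cosh u"
  proof (cases "u \<ge> 0")
    case True
    then show ?thesis using mult_left_mono[OF sinh_le_mult_cosh[OF True] True] by (simp add: power2_eq_square mult_ac)
  next
    case False
    then have "0 \<le> - u" by simp
    from mult_left_mono[OF sinh_le_mult_cosh[OF this] this] show ?thesis by (simp add: power2_eq_square mult_ac)
  qed
  then have "4 * cosh w * (u * sinh u) \<le> 4 * cosh w * (u\<^sup>2 * cosh u)"
    by (intro mult_left_mono) simp_all
  then show ?thesis unfolding xy
    by (simp add: sinh_add cosh_add sinh_diff cosh_diff power2_eq_square algebra_simps)
qed

lemma sinh_trapezoid_scaled:
  fixes x y \<theta> :: real
  assumes "\<theta> > 0"
  shows "(x - y) * (sinh (\<theta> * x) - sinh (\<theta> * y)) \<le> \<theta>/2 * ((x - y)\<^sup>2 * (cosh (\<theta> * x) + cosh (\<theta> * y)))"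
proof -
  have "\<theta> * ((x - y) * (sinh (\<theta> * x) - sinh (\<theta> * y))) \<le>
      \<theta> * (\<theta>/2 * ((x - y)\<^sup>2 * (cosh (\<theta> * x) + cosh (\<theta> * y))))"
    using sinh_trapezoid[of "\<theta> * x" "\<theta> * y"] by (simp add: power2_eq_square algebra_simps)
  then show ?thesis using assms by (simp only: mult_le_cancel_left_pos)
qed

section \<open>Continuity of the functional calculus in the Frobenius norm\<close>

lemma inner_matrix_trace: "A \<bullet> B = trace (transpose A ** (B :: real ^ 'm ^ 'n))"
  by (simp add: inner_vec_def trace_def matrix_matrix_mult_def transpose_def) (rule sum.swap)

text \<open>\<open>norm\<close> on matrices is the Frobenius norm; it dominates the operator norm,
  which suffices for a priori bounds on eigenvalues.\<close>

lemma norm_matrix_vector_le: "norm (A *v x) \<le> norm A * norm (x :: real ^ 'm)"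
proof -
  have "norm (A *v x) \<le> L2_set (\<lambda>i. norm (A $ i) * norm x) UNIV"
    unfolding norm_vec_def[of "A *v x"]
    by (intro L2_set_mono) (simp_all add: matrix_mult_dot Cauchy_Schwarz_ineq2)
  also have "\<dots> = norm A * norm x" by (simp add: norm_vec_def[of A] L2_set_left_distrib)
  finally show ?thesis .
qed

lemma quadratic_form_le_norm:
  assumes "norm b = 1" shows "\<bar>b \<bullet> (A *v b)\<bar> \<le> norm (A :: real ^ 'm ^ 'm)"
  using Cauchy_Schwarz_ineq2[of b "A *v b"] norm_matrix_vector_le[of A b] assms by simp

text \<open>The squared Frobenius distance of h(A) and h(B) is a weighted sum of (h(x) - h(y))^2
  over eigenvalue pairs, so the Lipschitz constant of h on the spectra carries over with no
  dimensional factor.\<close>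

lemma matrix_fun_lipschitz:
  assumes A: "transpose A = A" and B: "transpose B = B"
    and C: "C \<ge> 0" "norm A \<le> R" "norm B \<le> R"
    and h: "\<And>x y. \<bar>x\<bar> \<le> R \<Longrightarrow> \<bar>y\<bar> \<le> R \<Longrightarrow> \<bar>h x - h y\<bar> \<le> C * \<bar>x - y\<bar>"
  shows "norm (matrix_fun h A - matrix_fun h B) \<le> C * norm (A - B)"
proof -
  have nrm: "(norm (matrix_fun g A - matrix_fun g B))\<^sup>2 =
    (\<Sum>a\<in>eigenvectors A. \<Sum>b\<in>eigenvectors B. (g (a \<bullet> (A *v a)) - g (b \<bullet> (B *v b)))\<^sup>2 * (a \<bullet> b)\<^sup>2)" for g
  proof -
    let ?D = "matrix_fun g A - matrix_fun g B"
    have "(norm ?D)\<^sup>2 = trace (transpose ?D ** ?D)"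
      by (simp only: power2_norm_eq_inner inner_matrix_trace)
    also have "transpose ?D = ?D" by (simp only: transpose_diff transpose_matrix_fun)
    finally show ?thesis
      by (simp only: trace_diff_mult_matrix_fun_diff[OF A B] power2_eq_square[of "g _ - g _"])
  qed
  \<comment> \<open>For the identity function the same formula computes the distance of A and B
    themselves.\<close>
  have "(norm (matrix_fun h A - matrix_fun h B))\<^sup>2 \<le> C\<^sup>2 * (norm (matrix_fun (\<lambda>x. x) A - matrix_fun (\<lambda>x. x) B))\<^sup>2"
    unfolding nrm sum_distrib_left
  proof (intro sum_mono)
    fix a b assume ab: "a \<in> eigenvectors A" "b \<in> eigenvectors B"
    let ?x = "a \<bullet> (A *v a)" and ?y = "b \<bullet> (B *v b)"
    have "\<bar>?x\<bar> \<le> R" "\<bar>?y\<bar> \<le> R"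
      using ab quadratic_form_le_norm[of a A] quadratic_form_le_norm[of b B] C
        eigenbasis_norm[OF eigenbasis_eigenvectors] A B by force+
    then have "\<bar>h ?x - h ?y\<bar>\<^sup>2 \<le> (C * \<bar>?x - ?y\<bar>)\<^sup>2" by (intro power_mono h) auto
    then have "(h ?x - h ?y)\<^sup>2 * (a \<bullet> b)\<^sup>2 \<le> (C\<^sup>2 * (?x - ?y)\<^sup>2) * (a \<bullet> b)\<^sup>2"
      by (intro mult_right_mono) (auto simp: power_mult_distrib)
    then show "(h ?x - h ?y)\<^sup>2 * (a \<bullet> b)\<^sup>2 \<le> C\<^sup>2 * ((?x - ?y)\<^sup>2 * (a \<bullet> b)\<^sup>2)" by (simp add: mult.assoc)
  qed
  then have "(norm (matrix_fun h A - matrix_fun h B))\<^sup>2 \<le> (C * norm (A - B))\<^sup>2"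
    by (simp add: matrix_fun_id[OF A] matrix_fun_id[OF B] power_mult_distrib)
  then show ?thesis using C(1) by (simp add: power2_le_iff_abs_le)
qed

text \<open>Measurability of matrix functions of a random matrix will come from here, since the
  basis behind \<open>matrix_fun\<close> is an arbitrary choice. A convergent sequence is bounded,
  so h is Lipschitz on one interval containing all spectra involved.\<close>

lemma matrix_fun_continuous:
  assumes h: "\<And>x. (h has_real_derivative h' x) (at x)" and h': "continuous_on UNIV h'"
  shows "continuous_on {A. transpose A = A} (matrix_fun h)"
  unfolding continuous_on_sequentially
proof (intro ballI allI impI, elim conjE)
  fix A :: "real ^ 'm ^ 'm" and X
  assume A: "A \<in> {A. transpose A = A}" and X: "\<forall>n. X n \<in> {A. transpose A = A}" and lim: "X \<longlonglongrightarrow> A"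
  obtain R where R: "\<And>n. norm (X n) \<le> R"
    using convergent_imp_bounded[OF lim] by (auto simp: bounded_iff)
  have RA: "norm A \<le> R" by (rule LIMSEQ_le_const2[OF tendsto_norm[OF lim]]) (use R in auto)
  have "compact {-R..R}" by simp
  then have "bounded (h' ` {-R..R})"
    by (intro compact_imp_bounded compact_continuous_image continuous_on_subset[OF h']) auto
  then obtain C where C: "C > 0" "\<And>x. x \<in> {-R..R} \<Longrightarrow> norm (h' x) \<le> C"
    unfolding bounded_pos by blast
  have lip: "\<bar>h x - h y\<bar> \<le> C * \<bar>x - y\<bar>" if "\<bar>x\<bar> \<le> R" "\<bar>y\<bar> \<le> R" for x y
  proof -
    have xy: "x \<in> {-R..R}" "y \<in> {-R..R}" using that by (simp_all add: abs_le_iff)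
    have d: "(h has_real_derivative h' z) (at z within {-R..R})" for z
      using h[of z] by (rule has_field_derivative_at_within)
    show ?thesis
      using field_differentiable_bound[of "{-R..R}" h h' C x y, OF _ d C(2) xy] by simp
  qed
  have "norm (matrix_fun h (X n) - matrix_fun h A) \<le> C * norm (X n - A)" for n
    using matrix_fun_lipschitz[of "X n" A C R h, OF _ _ _ R RA lip] A X C(1) by simp
  moreover have "(\<lambda>n. C * norm (X n - A)) \<longlonglongrightarrow> 0"
    using lim by (intro tendsto_mult_right_zero tendsto_norm_zero LIM_zero)
  ultimately have "(\<lambda>n. matrix_fun h (X n) - matrix_fun h A) \<longlonglongrightarrow> 0"
    by (rule Lim_null_comparison[OF always_eventually[OF allI]])
  then show "(matrix_fun h \<circ> X) \<longlonglongrightarrow> matrix_fun h A"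
    by (simp add: LIM_zero_cancel o_def)
qed

section \<open>Perturbation of eigenvalues and eigenspaces\<close>

text \<open>Otherwise the simplifier turns the index range \<open>{1..n}\<close> into \<open>{Suc 0..n}\<close>.\<close>
declare One_nat_def [simp del]

text \<open>For an orthonormal family this is the orthogonal projector onto the span of the selected
  vectors; the explicit sum is linear whatever v is.\<close>

definition eigen_proj :: "(nat \<Rightarrow> real ^ 'm) \<Rightarrow> nat set \<Rightarrow> real ^ 'm \<Rightarrow> real ^ 'm" where
  "eigen_proj v I x = (\<Sum>i\<in>I. (x \<bullet> v i) *\<^sub>R v i)"

lemma linear_eigen_proj: "linear (eigen_proj v I)"
  unfolding eigen_proj_def
  by (intro linearI) (simp_all add: inner_simps scaleR_left_distrib sum.distrib scaleR_sum_right)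

lemmas bounded_linear_eigen_proj = linear_eigen_proj[unfolded linear_conv_bounded_linear]

section \<open>Coordinates and projectors for an ordered eigensystem\<close>

context
  fixes A :: "real ^ 'm ^ 'm" and l :: "nat \<Rightarrow> real" and v :: "nat \<Rightarrow> real ^ 'm"
  assumes es: "sorted_eigensystem A l v"
begin

lemma eigensystem_inner:
  "i \<in> {1..CARD('m)} \<Longrightarrow> j \<in> {1..CARD('m)} \<Longrightarrow> v i \<bullet> v j = (if i = j then 1 else 0)"
  using es by (simp add: sorted_eigensystem_def)

lemma eigensystem_apply: "i \<in> {1..CARD('m)} \<Longrightarrow> A *v v i = l i *\<^sub>R v i"
  using es by (simp add: sorted_eigensystem_def)

lemma eigensystem_mono: "1 \<le> i \<Longrightarrow> i \<le> j \<Longrightarrow> j \<le> CARD('m) \<Longrightarrow> l j \<le> l i"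
  using es by (simp add: sorted_eigensystem_def)

lemma eigensystem_inj: "inj_on v {1..CARD('m)}"
  by (rule inj_onI) (metis eigensystem_inner zero_neq_one)

lemma eigensystem_span: "span (v ` {1..CARD('m)}) = UNIV"
proof -
  let ?B = "v ` {1..CARD('m)}"
  have "pairwise orthogonal ?B"
    unfolding pairwise_def orthogonal_def
    by (auto simp: eigensystem_inner) 
  moreover have "0 \<notin> ?B" using eigensystem_inner by fastforce
  ultimately have "independent ?B" by (rule pairwise_orthogonal_independent)
  moreover have "card ?B = DIM(real ^ 'm)" by (simp add: card_image[OF eigensystem_inj])
  ultimately show ?thesis
    by (metis card_eq_dim dim_eq_full dim_UNIV dim_span finite_imageI finite_atLeastAtMost
        indep_card_eq_dim_span order_refl)
qed

lemma eigensystem_expand: "eigen_proj v {1..CARD('m)} x = x"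
proof -
  have "(\<Sum>b\<in>v ` {1..CARD('m)}. (x \<bullet> b) *\<^sub>R b) = x"
    by (rule orthonormal_basis_expand)
      (auto simp: pairwise_def orthogonal_def eigensystem_inner norm_eq_1 eigensystem_span)
  then show ?thesis by (simp add: eigen_proj_def sum.reindex[OF eigensystem_inj])
qed

lemma eigen_proj_inner:
  assumes "I \<subseteq> {1..CARD('m)}" "j \<in> {1..CARD('m)}"
  shows "eigen_proj v I x \<bullet> v j = (if j \<in> I then x \<bullet> v j else 0)"
proof -
  have "eigen_proj v I x \<bullet> v j = (\<Sum>i\<in>I. if i = j then x \<bullet> v j else 0)"
    unfolding eigen_proj_def inner_sum_left
    by (intro sum.cong refl) (use assms in \<open>auto simp: eigensystem_inner\<close>)
  then show ?thesis using assms finite_subset[OF assms(1)] by simp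
qed

lemma eigensystem_eqI:
  assumes "\<And>i. i \<in> {1..CARD('m)} \<Longrightarrow> x \<bullet> v i = y \<bullet> v i"
  shows "x = y"
proof -
  have "eigen_proj v {1..CARD('m)} x = eigen_proj v {1..CARD('m)} y"
    unfolding eigen_proj_def by (intro sum.cong refl) (simp add: assms)
  then show ?thesis by (simp add: eigensystem_expand)
qed

lemma eigensystem_parseval: "x \<bullet> y = (\<Sum>i=1..CARD('m). (x \<bullet> v i) * (y \<bullet> v i))"
  by (subst eigensystem_expand[of y, symmetric])
    (simp add: eigen_proj_def inner_sum_right mult.commute)

lemma eigensystem_norm: "(norm x)\<^sup>2 = (\<Sum>i=1..CARD('m). (x \<bullet> v i)\<^sup>2)"
  by (simp add: power2_norm_eq_inner eigensystem_parseval[of x x] power2_eq_square[of "_ \<bullet> _"])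

lemma eigen_proj_proj:
  assumes "I \<subseteq> {1..CARD('m)}" "J \<subseteq> {1..CARD('m)}"
  shows "eigen_proj v I (eigen_proj v J x) = eigen_proj v (I \<inter> J) x"
  by (rule eigensystem_eqI) (use assms in \<open>simp add: eigen_proj_inner le_infI1\<close>)

lemma eigen_proj_symmetric: "eigen_proj v I x \<bullet> y = x \<bullet> eigen_proj v I y"
  by (simp add: eigen_proj_def inner_sum_left inner_sum_right inner_commute mult.commute)

lemma eigen_proj_pythagoras:
  assumes "I \<subseteq> {1..CARD('m)}"
  shows "(norm x)\<^sup>2 = (norm (eigen_proj v I x))\<^sup>2 + (norm (x - eigen_proj v I x))\<^sup>2"
  unfolding eigensystem_norm sum.distrib[symmetric]
  by (intro sum.cong refl) (use assms in \<open>simp add: inner_diff_left eigen_proj_inner\<close>)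

lemma eigen_proj_norm_le:
  assumes "I \<subseteq> {1..CARD('m)}"
  shows "norm (eigen_proj v I x) \<le> norm x"
  by (rule power2_le_imp_le) (simp_all add: eigen_proj_pythagoras[OF assms, of x])

lemma eigen_proj_compl:
  assumes "I \<subseteq> {1..CARD('m)}"
  shows "x - eigen_proj v I x = eigen_proj v ({1..CARD('m)} - I) x"
  by (rule eigensystem_eqI) (use assms in \<open>simp add: eigen_proj_inner inner_diff_left\<close>)

lemma eigensystem_apply_inner: "(A *v x) \<bullet> v i = l i * (x \<bullet> v i)" if "i \<in> {1..CARD('m)}"
proof -
  have "A *v x = (\<Sum>j=1..CARD('m). (x \<bullet> v j) *\<^sub>R l j *\<^sub>R v j)"
    by (subst eigensystem_expand[of x, symmetric])
      (simp add: eigen_proj_def linear_sum[OF matrix_vector_mul_linear] matrix_vector_mult_scaleR eigensystem_apply)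
  also have "\<dots> \<bullet> v i = (\<Sum>j=1..CARD('m). if j = i then l i * (x \<bullet> v i) else 0)"
    unfolding inner_sum_left by (intro sum.cong refl) (use that in \<open>auto simp: eigensystem_inner\<close>)
  also have "\<dots> = l i * (x \<bullet> v i)" using that by simp
  finally show ?thesis .
qed

lemma eigensystem_quadratic: "x \<bullet> (A *v x) = (\<Sum>i=1..CARD('m). l i * (x \<bullet> v i)\<^sup>2)"
  by (simp add: eigensystem_parseval[of x "A *v x"] eigensystem_apply_inner power2_eq_square mult_ac)

lemma span_eigenvectors:
  assumes "I \<subseteq> {1..CARD('m)}"
  shows "x \<in> span (v ` I) \<longleftrightarrow> eigen_proj v I x = x"
proof
  assume "x \<in> span (v ` I)"
  then show "eigen_proj v I x = x"
  proof (induction rule: span_induct)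
    case base
    show ?case using linear_eigen_proj[of v I]
      by (auto simp: subspace_def linear_add linear_cmul linear_0)
  next
    case (step x)
    then obtain i where i: "i \<in> I" "x = v i" by blast
    show ?case
      by (rule eigensystem_eqI) (use i assms in \<open>auto simp: eigen_proj_inner eigensystem_inner subset_iff\<close>)
  qed
next
  assume "eigen_proj v I x = x"
  moreover have "eigen_proj v I x \<in> span (v ` I)"
    unfolding eigen_proj_def by (intro span_sum span_scale span_base imageI)
  ultimately show "x \<in> span (v ` I)" by simp
qed

text \<open>Links the definite description to the coordinate formula: a candidate y in the span is
  fixed by the projection, and x - y is annihilated by it.\<close>

lemma orth_projector_span_eigenvectors:
  assumes I: "I \<subseteq> {1..CARD('m)}"
  shows "orth_projector (span (v ` I)) x = eigen_proj v I x"
  unfolding orth_projector_def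
proof (rule the_equality)
  have "orthogonal (x - eigen_proj v I x) z" if "z \<in> span (v ` I)" for z
  proof -
    have "(x - eigen_proj v I x) \<bullet> eigen_proj v I z = 0"
      unfolding eigen_proj_symmetric[symmetric]
      by (simp add: linear_diff[OF linear_eigen_proj] eigen_proj_proj[OF I I])
    then show ?thesis using that by (simp add: span_eigenvectors[OF I] orthogonal_def)
  qed
  then show "eigen_proj v I x \<in> span (v ` I) \<and> (\<forall>z\<in>span (v ` I). orthogonal (x - eigen_proj v I x) z)"
    by (simp add: span_eigenvectors[OF I] eigen_proj_proj[OF I I])
next
  fix y assume y: "y \<in> span (v ` I) \<and> (\<forall>z\<in>span (v ` I). orthogonal (x - y) z)"
  then have "(x - y) \<bullet> v i = 0" if "i \<in> I" for i
    using that by (auto simp: orthogonal_def intro: span_base)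
  then have "eigen_proj v I (x - y) = 0" by (simp add: eigen_proj_def)
  then show "y = eigen_proj v I x"
    using y by (simp add: linear_diff[OF linear_eigen_proj] span_eigenvectors[OF I])
qed

end

text \<open>(P - P') x splits into (I - P') P x and -P' (I - P) x, which are orthogonal because P'
  separates them. Pythagoras, used once for P' and once for P, bounds the difference by the larger
  of the two off-diagonal blocks instead of their sum.\<close>

lemma eigen_proj_diff_norm:
  fixes A A' :: "real ^ 'm ^ 'm"
  assumes es: "sorted_eigensystem A l v" and es': "sorted_eigensystem A' l' v'"
    and I: "I \<subseteq> {1..CARD('m)}"
    and 1: "\<And>x. norm (eigen_proj v I x - eigen_proj v' I (eigen_proj v I x)) \<le> s * norm (eigen_proj v I x)"
    and 2: "\<And>x. norm (eigen_proj v' I (x - eigen_proj v I x)) \<le> s * norm (x - eigen_proj v I x)"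
    and s: "s \<ge> 0"
  shows "norm (eigen_proj v I x - eigen_proj v' I x) \<le> s * norm x"
proof -
  let ?P = "eigen_proj v I" and ?P' = "eigen_proj v' I"
  have "(norm (?P x - ?P' x))\<^sup>2 = (norm (?P' (x - ?P x)))\<^sup>2 + (norm (?P x - ?P' (?P x)))\<^sup>2"
    by (subst eigen_proj_pythagoras[OF es' I])
      (simp add: linear_diff[OF linear_eigen_proj] eigen_proj_proj[OF es' I I] norm_minus_commute)
  also have "\<dots> \<le> (s * norm (x - ?P x))\<^sup>2 + (s * norm (?P x))\<^sup>2"
    by (intro add_mono power_mono 1 2) simp_all
  also have "\<dots> = (s * norm x)\<^sup>2"
    unfolding power_mult_distrib eigen_proj_pythagoras[OF es I, of x] by (simp add: distrib_left)
  finally show ?thesis using s by (simp add: power2_le_iff_abs_le)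
qed

section \<open>The largest principal angle in terms of projectors\<close>

lemma the_angle_eq_arcsin:
  fixes s :: real
  assumes "0 \<le> s" "s \<le> 1"
  shows "(THE \<theta>. 0 \<le> \<theta> \<and> \<theta> \<le> pi / 2 \<and> sin \<theta> = s) = arcsin s"
proof (rule the_equality)
  have "arcsin 0 \<le> arcsin s" by (rule arcsin_le_arcsin) (use assms in auto)
  then show "0 \<le> arcsin s \<and> arcsin s \<le> pi / 2 \<and> sin (arcsin s) = s"
    using arcsin[of s] assms by simp
next
  fix \<theta> assume "0 \<le> \<theta> \<and> \<theta> \<le> pi / 2 \<and> sin \<theta> = s"
  then show "\<theta> = arcsin s" using arcsin_unique[of \<theta> s] pi_gt_zero by linarith
qed

text \<open>The difference of two orthogonal projectors has norm at most 1, so the definite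
  description of the angle denotes an arcsine and its sine is that norm.\<close>

lemma sin_largest_principal_angle_eigenspaces:
  fixes A A' :: "real ^ 'm ^ 'm"
  assumes es: "sorted_eigensystem A l v" and es': "sorted_eigensystem A' l' v'"
    and I: "I \<subseteq> {1..CARD('m)}"
  shows "sin (largest_principal_angle (span (v' ` I)) (span (v ` I))) =
    onorm (\<lambda>x. eigen_proj v I x - eigen_proj v' I x)"
proof -
  let ?s = "onorm (\<lambda>x. eigen_proj v I x - eigen_proj v' I x)"
  have "norm (eigen_proj v I x - eigen_proj v' I x) \<le> 1 * norm x" for x
  proof (rule eigen_proj_diff_norm[OF es es' I])
    show "norm (eigen_proj v I x - eigen_proj v' I (eigen_proj v I x)) \<le> 1 * norm (eigen_proj v I x)" for x
      using eigen_proj_norm_le[OF es', of "{1..CARD('m)} - I" "eigen_proj v I x"]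
      by (simp add: eigen_proj_compl[OF es' I])
    show "norm (eigen_proj v' I (x - eigen_proj v I x)) \<le> 1 * norm (x - eigen_proj v I x)" for x
      using eigen_proj_norm_le[OF es' I] by simp
  qed simp
  then have s1: "?s \<le> 1" by (rule onorm_le)
  have s0: "0 \<le> ?s"
    by (intro onorm_pos_le bounded_linear_sub bounded_linear_eigen_proj)
  have "(THE \<theta>. 0 \<le> \<theta> \<and> \<theta> \<le> pi / 2 \<and> sin \<theta> = ?s) = arcsin ?s"
    by (rule the_angle_eq_arcsin[OF s0 s1])
  then show ?thesis
    using s0 s1
    by (simp add: largest_principal_angle_def orth_projector_span_eigenvectors[OF es I]
        orth_projector_span_eigenvectors[OF es' I])
qed

text \<open>Dimension count in place of the minimax principle: the test vector x has no
  A-coordinates with index beyond k and no A'-coordinates with index before k, so its two quadratic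
  forms are at least \<open>l k\<close> and at most \<open>l' k\<close> times its squared
  norm.\<close>

lemma weyl_upper:
  fixes A A' :: "real ^ 'm ^ 'm"
  assumes es: "sorted_eigensystem A l v" and es': "sorted_eigensystem A' l' v'"
    and \<eta>: "\<And>x. norm (A *v x - A' *v x) \<le> \<eta> * norm x" and k: "1 \<le> k" "k \<le> CARD('m)"
  shows "l k \<le> l' k + \<eta>"
proof -
  let ?C = "v ` {k+1..CARD('m)} \<union> v' ` {1..<k}"
  \<comment> \<open>There are at most (m - k) + (k - 1) = m - 1 constraints on x.\<close>
  have "card ?C \<le> card {k+1..CARD('m)} + card {1..<k}"
    by (meson card_Un_le card_image_le add_mono le_trans finite_atLeastAtMost finite_atLeastLessThan)
  also have "\<dots> < CARD('m)" using k by simp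
  finally have "dim ?C < DIM(real ^ 'm)"
    using dim_le_card'[of ?C] by simp
  then obtain x where x: "x \<noteq> 0" "\<And>y. y \<in> span ?C \<Longrightarrow> orthogonal x y"
    using orthogonal_to_subspace_exists by blast
  have x1: "x \<bullet> v i = 0" if "k < i" "i \<le> CARD('m)" for i
    using x(2)[OF span_base, of "v i"] that by (simp add: orthogonal_def)
  have x2: "x \<bullet> v' i = 0" if "1 \<le> i" "i < k" for i
    using x(2)[OF span_base, of "v' i"] that by (simp add: orthogonal_def)
  have "l k * (norm x)\<^sup>2 \<le> x \<bullet> (A *v x)"
    unfolding eigensystem_norm[OF es] eigensystem_quadratic[OF es] sum_distrib_left
  proof (intro sum_mono)
    fix i assume "i \<in> {1..CARD('m)}"
    then show "l k * (x \<bullet> v i)\<^sup>2 \<le> l i * (x \<bullet> v i)\<^sup>2"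
      using x1[of i] eigensystem_mono[OF es, of i k] k by (cases "i \<le> k") (auto intro: mult_right_mono)
  qed
  also have "\<dots> = x \<bullet> (A' *v x) + x \<bullet> (A *v x - A' *v x)" by (simp add: inner_diff_right)
  also have "x \<bullet> (A *v x - A' *v x) \<le> norm x * (\<eta> * norm x)"
    using norm_cauchy_schwarz[of x "A *v x - A' *v x"] mult_left_mono[OF \<eta>[of x] norm_ge_zero[of x]] by linarith
  also have "x \<bullet> (A' *v x) \<le> l' k * (norm x)\<^sup>2"
    unfolding eigensystem_norm[OF es'] eigensystem_quadratic[OF es'] sum_distrib_left
  proof (intro sum_mono)
    fix i assume "i \<in> {1..CARD('m)}"
    then show "l' i * (x \<bullet> v' i)\<^sup>2 \<le> l' k * (x \<bullet> v' i)\<^sup>2"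
      using x2[of i] eigensystem_mono[OF es', of k i] k by (cases "i \<ge> k") (auto intro: mult_right_mono)
  qed
  finally have "l k * (norm x)\<^sup>2 \<le> (l' k + \<eta>) * (norm x)\<^sup>2" by (simp add: power2_eq_square algebra_simps)
  then show ?thesis using x(1) by simp
qed

text \<open>Half of the Davis--Kahan theorem. With \<open>J\<close>-eigenvalues of \<open>A'\<close> in \<open>[c - r, c + r]\<close> and
  \<open>I\<close>-eigenvalues of \<open>A\<close> at least \<open>c + r + \<delta>\<close>, the norm \<open>s\<close> of the product of the two projections
  satisfies \<open>s \<le> (\<eta> + r s) / (r + \<delta>)\<close>, because \<open>A - c\<close> is invertible on its invariant subspace.\<close>

lemma davis_kahan_half:
  fixes A A' :: "real ^ 'm ^ 'm"
  assumes es: "sorted_eigensystem A l v" and es': "sorted_eigensystem A' l' v'"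
    and \<eta>: "\<And>x. norm (A *v x - A' *v x) \<le> \<eta> * norm x" "\<eta> \<ge> 0"
    and I: "I \<subseteq> {1..CARD('m)}" and J: "J \<subseteq> {1..CARD('m)}"
    and p: "\<And>i. i \<in> I \<Longrightarrow> p \<le> l i" and q: "\<And>j. j \<in> J \<Longrightarrow> l' j \<le> q" and pq: "q < p"
  shows "norm (eigen_proj v' J (eigen_proj v I x)) \<le> \<eta> / (p - q) * norm x"
proof -
  \<comment> \<open>Inserting 0 keeps the maximum defined and nonnegative when J is empty.\<close>
  define r where "r = Max (insert 0 ((\<lambda>j. q - l' j) ` J))"
  have fJ: "finite J" and fI: "finite I" using I J finite_subset by blast+
  have r: "q - l' j \<le> r" if "j \<in> J" for j
    using fJ that by (auto simp: r_def)
  have r0: "r \<ge> 0" using fJ by (auto simp: r_def)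
  define c where "c = q - r"
  define \<delta> where "\<delta> = p - q"
  have \<delta>: "\<delta> > 0" using pq by (simp add: \<delta>_def)
  have lc: "r + \<delta> \<le> l i - c" if "i \<in> I" for i using p[OF that] by (simp add: \<delta>_def c_def)
  have l'c: "\<bar>l' j - c\<bar> \<le> r" if "j \<in> J" for j using q[OF that] r[OF that] r0 by (simp add: c_def)
  let ?T = "\<lambda>x. eigen_proj v' J (eigen_proj v I x)"
  define s where "s = onorm ?T"
  have bl: "bounded_linear ?T"
    by (rule bounded_linear_compose[OF bounded_linear_eigen_proj bounded_linear_eigen_proj])
  have s: "norm (?T x) \<le> s * norm x" for x unfolding s_def by (rule onorm[OF bl])
  have "norm (?T x) \<le> (\<eta> + r * s) / (r + \<delta>) * norm x" for x
  proof -
    \<comment> \<open>w solves (A - c) w = P x inside the invariant subspace of the indices I, where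
      the eigenvalues of A - c are at least r + \<delta>.\<close>
    define w where "w = (\<Sum>i\<in>I. ((x \<bullet> v i) / (l i - c)) *\<^sub>R v i)"
    have wv: "w \<bullet> v j = (if j \<in> I then (x \<bullet> v j) / (l j - c) else 0)" if "j \<in> {1..CARD('m)}" for j
    proof -
      have "w \<bullet> v j = (\<Sum>i\<in>I. if i = j then (x \<bullet> v j) / (l j - c) else 0)"
        unfolding w_def inner_sum_left
        by (intro sum.cong refl) (use that I in \<open>auto simp: eigensystem_inner[OF es]\<close>)
      then show ?thesis using fI by simp
    qed
    have Aw: "A *v w - c *\<^sub>R w = eigen_proj v I x"
    proof (rule eigensystem_eqI[OF es])
      fix i assume i: "i \<in> {1..CARD('m)}"
      show "(A *v w - c *\<^sub>R w) \<bullet> v i = eigen_proj v I x \<bullet> v i"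
        using lc[of i] r0 \<delta>
        by (auto simp: inner_diff_left eigensystem_apply_inner[OF es i] wv[OF i] eigen_proj_inner[OF es I i]
            left_diff_distrib[symmetric])
    qed
    have Iw: "eigen_proj v I w = w"
      by (rule eigensystem_eqI[OF es]) (simp add: eigen_proj_inner[OF es I] wv)
    have nw: "norm w \<le> norm x / (r + \<delta>)"
    proof (rule power2_le_imp_le)
      have "(norm w)\<^sup>2 \<le> (\<Sum>i=1..CARD('m). (x \<bullet> v i)\<^sup>2 / (r + \<delta>)\<^sup>2)"
        unfolding eigensystem_norm[OF es, of w]
      proof (intro sum_mono)
        fix i assume i: "i \<in> {1..CARD('m)}"
        show "(w \<bullet> v i)\<^sup>2 \<le> (x \<bullet> v i)\<^sup>2 / (r + \<delta>)\<^sup>2"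
        proof (cases "i \<in> I")
          case True
          have "(r + \<delta>)\<^sup>2 \<le> (l i - c)\<^sup>2" using lc[OF True] r0 \<delta> by (intro power_mono) auto
          moreover have "0 < (r + \<delta>)\<^sup>2" using r0 \<delta> by simp
          ultimately show ?thesis by (simp add: wv[OF i] True power_divide frac_le)
        qed (simp add: wv[OF i])
      qed
      then show "(norm w)\<^sup>2 \<le> (norm x / (r + \<delta>))\<^sup>2"
        by (simp add: eigensystem_norm[OF es, of x] power_divide sum_divide_distrib)
    qed (use r0 \<delta> in simp)
    \<comment> \<open>The projection of (A - c) w is split through A': the perturbation costs
      \<eta>, and A' - c has norm at most r on the range of the projection for J.\<close>
    have "?T x = eigen_proj v' J (A *v w - A' *v w) + eigen_proj v' J (A' *v w - c *\<^sub>R w)"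
      by (simp add: Aw[symmetric] linear_add[OF linear_eigen_proj, symmetric])
    then have "norm (?T x) \<le> norm (eigen_proj v' J (A *v w - A' *v w)) + norm (eigen_proj v' J (A' *v w - c *\<^sub>R w))"
      by (simp add: norm_triangle_ineq)
    moreover have "norm (eigen_proj v' J (A *v w - A' *v w)) \<le> \<eta> * norm w"
      using eigen_proj_norm_le[OF es' J] \<eta>(1) order_trans by blast
    moreover have "norm (eigen_proj v' J (A' *v w - c *\<^sub>R w)) \<le> r * norm (eigen_proj v' J w)"
    proof (rule power2_le_imp_le)
      show "(norm (eigen_proj v' J (A' *v w - c *\<^sub>R w)))\<^sup>2 \<le> (r * norm (eigen_proj v' J w))\<^sup>2"
        unfolding power_mult_distrib eigensystem_norm[OF es'] sum_distrib_left
      proof (intro sum_mono)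
        fix j assume j: "j \<in> {1..CARD('m)}"
        show "(eigen_proj v' J (A' *v w - c *\<^sub>R w) \<bullet> v' j)\<^sup>2 \<le> r\<^sup>2 * (eigen_proj v' J w \<bullet> v' j)\<^sup>2"
        proof (cases "j \<in> J")
          case True
          have "(l' j - c)\<^sup>2 \<le> r\<^sup>2" using l'c[OF True] r0 by (simp add: power2_le_iff_abs_le)
          then have "(l' j - c)\<^sup>2 * (w \<bullet> v' j)\<^sup>2 \<le> r\<^sup>2 * (w \<bullet> v' j)\<^sup>2" by (rule mult_right_mono) simp
          then show ?thesis
            by (simp add: eigen_proj_inner[OF es' J j] True inner_diff_left
                eigensystem_apply_inner[OF es' j] flip: left_diff_distrib power_mult_distrib)
        qed (simp add: eigen_proj_inner[OF es' J j])
      qed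
    qed (use r0 in simp)
    \<comment> \<open>Since w is fixed by the projection for I, its projection for J is
      \<open>?T w\<close>, which brings s back on the right-hand side.\<close>
    moreover have "r * norm (eigen_proj v' J w) \<le> r * (s * norm w)" using s[of w] r0 by (intro mult_left_mono) (simp_all add: Iw)
    ultimately have "norm (?T x) \<le> (\<eta> + r * s) * norm w" by (simp add: distrib_right mult.assoc)
    also have "\<dots> \<le> (\<eta> + r * s) * (norm x / (r + \<delta>))"
      using nw r0 \<eta>(2) onorm_pos_le[OF bl] by (intro mult_left_mono) (auto simp: s_def)
    finally show ?thesis by simp
  qed
  then have "s \<le> (\<eta> + r * s) / (r + \<delta>)" unfolding s_def by (rule onorm_le)
  \<comment> \<open>From s (r + \<delta>) \<le> \<eta> + r s the radius drops out.\<close>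
  then have "s * \<delta> \<le> \<eta>" using r0 \<delta> by (simp add: field_simps)
  then have "s \<le> \<eta> / \<delta>" using \<delta> by (simp add: field_simps)
  then show ?thesis using s[of x] mult_right_mono[of s "\<eta> / \<delta>" "norm x"] unfolding \<delta>_def[symmetric] by simp
qed

text \<open>Weyl's inequality moves each of the two eigenvalues at the cut by at most \<eta>, so the
  mixed gaps \<open>l k - l' (k + 1)\<close> and \<open>l' k - l (k + 1)\<close> are still at least
  the gap minus \<eta>. The half theorem then handles both off-diagonal blocks of the projector
  difference.\<close>

lemma eigenspace_perturbation:
  fixes A A' :: "real ^ 'm ^ 'm"
  assumes es: "sorted_eigensystem A l v" and es': "sorted_eigensystem A' l' v'"
    and \<eta>: "\<And>x. norm (A *v x - A' *v x) \<le> \<eta> * norm x" "\<eta> \<ge> 0"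
    and k: "1 \<le> k" "k < CARD('m)" and gap: "\<eta> < l k - l (k + 1)"
  shows "onorm (\<lambda>x. eigen_proj v {1..k} x - eigen_proj v' {1..k} x) \<le> \<eta> / (l k - l (k + 1) - \<eta>)"
    and "l k - l (k + 1) - 2 * \<eta> \<le> l' k - l' (k + 1)"
proof -
  have \<eta>': "norm (A' *v x - A *v x) \<le> \<eta> * norm x" for x using \<eta>(1)[of x] by (simp add: norm_minus_commute)
  have w1: "l' (k + 1) \<le> l (k + 1) + \<eta>" and w2: "l k \<le> l' k + \<eta>"
    using weyl_upper[OF es' es \<eta>', of "k + 1"] weyl_upper[OF es es' \<eta>(1), of k] k by simp_all
  then show "l k - l (k + 1) - 2 * \<eta> \<le> l' k - l' (k + 1)" by simp
  let ?I = "{1..k}" and ?J = "{1..CARD('m)} - {1..k}" and ?g = "l k - l (k + 1) - \<eta>"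
  have I: "?I \<subseteq> {1..CARD('m)}" and J: "?J \<subseteq> {1..CARD('m)}" using k by auto
  have mono: "\<eta> / (p - q) * y \<le> \<eta> / ?g * y" if "p - q \<ge> ?g" "y \<ge> 0" for p q y
    using that gap \<eta>(2) by (intro mult_right_mono frac_le) auto
  have "norm (eigen_proj v ?I x - eigen_proj v' ?I x) \<le> \<eta> / ?g * norm x" for x
  proof (rule eigen_proj_diff_norm[OF es es' I])
    fix x
    have "norm (eigen_proj v' ?J (eigen_proj v ?I (eigen_proj v ?I x))) \<le>
        \<eta> / (l k - l' (k + 1)) * norm (eigen_proj v ?I x)"
      by (rule davis_kahan_half[OF es es' \<eta> I J])
        (use k w1 gap in \<open>auto intro: eigensystem_mono[OF es] eigensystem_mono[OF es']\<close>)
    also have "\<dots> \<le> \<eta> / ?g * norm (eigen_proj v ?I x)" using w1 by (intro mono) auto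
    finally show "norm (eigen_proj v ?I x - eigen_proj v' ?I (eigen_proj v ?I x)) \<le> \<eta> / ?g * norm (eigen_proj v ?I x)"
      by (simp add: eigen_proj_compl[OF es' I] eigen_proj_proj[OF es I I])
  next
    fix x
    \<comment> \<open>The half theorem needs the upper eigenvalues on the matrix whose projector
      acts first. With A and A' interchanged it bounds (I - P) P', the adjoint of the block P' (I -
      P) wanted here.\<close>
    define y z where "y = x - eigen_proj v ?I x" and "z = eigen_proj v' ?I y"
    have yJ: "eigen_proj v ?J y = y"
      by (simp add: y_def eigen_proj_compl[OF es I] eigen_proj_proj[OF es J J])
    have zI: "eigen_proj v' ?I z = z"
      by (simp add: z_def eigen_proj_proj[OF es' I I])
    have "norm (eigen_proj v ?J (eigen_proj v' ?I z)) \<le> \<eta> / (l' k - l (k + 1)) * norm z"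
      by (rule davis_kahan_half[OF es' es \<eta>' \<eta>(2) I J])
        (use k w2 gap in \<open>auto intro: eigensystem_mono[OF es] eigensystem_mono[OF es']\<close>)
    also have "\<dots> \<le> \<eta> / ?g * norm z" using w2 by (intro mono) auto
    finally have z: "norm (eigen_proj v ?J z) \<le> \<eta> / ?g * norm z" by (simp add: zI)
    \<comment> \<open>The adjoint has the same norm: test z = P' y against itself and move the
      projectors across the inner product.\<close>
    have "norm z * norm z = z \<bullet> y"
    proof -
      have "z \<bullet> z = eigen_proj v' ?I z \<bullet> y" by (subst (2) z_def) (simp add: eigen_proj_symmetric[OF es'])
      then show ?thesis by (simp add: zI flip: power2_eq_square power2_norm_eq_inner)
    qed
    also have "\<dots> = eigen_proj v ?J z \<bullet> y" by (simp add: eigen_proj_symmetric[OF es] yJ)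
    also have "\<dots> \<le> norm (eigen_proj v ?J z) * norm y" by (rule norm_cauchy_schwarz)
    also have "\<dots> \<le> \<eta> / ?g * norm z * norm y" using z by (intro mult_right_mono) auto
    finally have "norm z * norm z \<le> norm z * (\<eta> / ?g * norm y)" by (simp add: mult_ac)
    then show "norm (eigen_proj v' ?I (x - eigen_proj v ?I x)) \<le> \<eta> / ?g * norm (x - eigen_proj v ?I x)"
      unfolding y_def[symmetric] z_def[symmetric]
    proof (cases "norm z = 0")
      case True
      have "0 \<le> \<eta> / ?g * norm y" using gap \<eta>(2) by simp
      then show "norm z \<le> \<eta> / ?g * norm y" using True by linarith
    next
      case False
      then show "norm z \<le> \<eta> / ?g * norm y" if "norm z * norm z \<le> norm z * (\<eta> / ?g * norm y)"
        using that by (simp only: mult_le_cancel_left) auto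
    qed
  qed (use gap \<eta>(2) in simp)
  then show "onorm (\<lambda>x. eigen_proj v {1..k} x - eigen_proj v' {1..k} x) \<le> \<eta> / ?g" by (rule onorm_le)
qed

section \<open>Product space of samples\<close>

text \<open>The integrands over the samples are bounded everywhere because the samples are. The
  class is closed under the algebra used below and gives integrability over a probability
  measure.\<close>

definition bounded_measurable :: "'a measure \<Rightarrow> ('a \<Rightarrow> 'b::euclidean_space) \<Rightarrow> bool" where
  "bounded_measurable M F \<longleftrightarrow> F \<in> borel_measurable M \<and> bounded (range F)"

named_theorems bounded_measurable_intros

lemma bounded_measurable_const [bounded_measurable_intros]: "bounded_measurable M (\<lambda>x. c)"
  by (simp add: bounded_measurable_def)

lemma bounded_measurable_linear:
  assumes "bounded_linear T" "bounded_measurable M F"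
  shows "bounded_measurable M (\<lambda>x. T (F x))"
  using assms bounded_linear_image[of "range F" T]
  by (simp add: bounded_measurable_def image_image borel_measurable_continuous_onI[THEN measurable_compose[rotated]]
      linear_continuous_on)

lemma bounded_measurable_bilinear:
  fixes H :: "'b::euclidean_space \<Rightarrow> 'c::euclidean_space \<Rightarrow> 'd::euclidean_space"
  assumes H: "bounded_bilinear H" and F: "bounded_measurable M F" and G: "bounded_measurable M G"
  shows "bounded_measurable M (\<lambda>x. H (F x) (G x))"
proof -
  interpret bounded_bilinear H by fact
  obtain K where K: "\<And>a b. norm (H a b) \<le> norm a * norm b * K" using bounded by blast
  obtain B C where B: "\<And>x. norm (F x) \<le> B" "B > 0" and C: "\<And>x. norm (G x) \<le> C" "C > 0"
    using F G unfolding bounded_measurable_def bounded_pos by blast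
  have "norm (H (F x) (G x)) \<le> B * C * \<bar>K\<bar>" for x
  proof -
    have "norm (H (F x) (G x)) \<le> norm (F x) * norm (G x) * \<bar>K\<bar>"
      by (rule order_trans[OF K mult_left_mono]) auto
    also have "\<dots> \<le> B * C * \<bar>K\<bar>"
      by (intro mult_right_mono mult_mono B C) (use B C in \<open>auto intro: less_imp_le\<close>)
    finally show ?thesis .
  qed
  moreover have "(\<lambda>x. H (F x) (G x)) \<in> borel_measurable M"
    using F G unfolding bounded_measurable_def
    by (intro borel_measurable_continuous_Pair[where H = H]
        continuous_on[OF continuous_on_fst[OF continuous_on_id] continuous_on_snd[OF continuous_on_id]]) simp_all
  ultimately show ?thesis by (auto simp: bounded_measurable_def bounded_iff)
qed

lemma bounded_measurable_add [bounded_measurable_intros]: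
  assumes "bounded_measurable M F" "bounded_measurable M G"
  shows "bounded_measurable M (\<lambda>x. F x + G x)"
  using assms bounded_plus_comp[of F UNIV G] by (auto simp: bounded_measurable_def)

lemma bounded_measurable_diff [bounded_measurable_intros]:
  assumes "bounded_measurable M F" "bounded_measurable M G"
  shows "bounded_measurable M (\<lambda>x. F x - G x)"
  using assms bounded_minus_comp[of F UNIV G] by (auto simp: bounded_measurable_def)

lemma bounded_measurable_scaleR [bounded_measurable_intros]:
  "bounded_measurable M F \<Longrightarrow> bounded_measurable M (\<lambda>x. c *\<^sub>R F x)"
  by (rule bounded_measurable_linear[OF bounded_linear_scaleR_right])

lemma bounded_measurable_cmult [bounded_measurable_intros]:
  "bounded_measurable M F \<Longrightarrow> bounded_measurable M (\<lambda>x. c * F x :: real)"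
  by (rule bounded_measurable_linear[OF bounded_linear_mult_right])

lemma bounded_measurable_sum [bounded_measurable_intros]:
  "(\<And>i. i \<in> I \<Longrightarrow> bounded_measurable M (F i)) \<Longrightarrow> bounded_measurable M (\<lambda>x. \<Sum>i\<in>I. F i x)"
  by (induction I rule: infinite_finite_induct) (auto intro: bounded_measurable_intros)

lemma bounded_linear_trace: "bounded_linear (trace :: real ^ 'm ^ 'm \<Rightarrow> real)"
  unfolding linear_conv_bounded_linear[symmetric] by (intro linearI) (simp_all add: trace_add trace_scaleR)

lemmas bounded_measurable_trace [bounded_measurable_intros] = bounded_measurable_linear[OF bounded_linear_trace]

lemmas bounded_measurable_matrix_mul [bounded_measurable_intros] =
  bounded_measurable_bilinear[OF bounded_bilinear_matrix_mul]

lemma bounded_measurable_compose: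
  "bounded_measurable N F \<Longrightarrow> T \<in> measurable M N \<Longrightarrow> bounded_measurable M (\<lambda>x. F (T x))"
  unfolding bounded_measurable_def
  by (auto intro: bounded_subset[of "range F"] simp: measurable_compose[of T M N F])

text \<open>Continuity is available on the symmetric matrices, hence the restricted Borel space.
  Boundedness follows because a bounded map with symmetric values stays in a compact set of such
  matrices.\<close>

lemma bounded_measurable_matrix_fun:
  assumes h: "\<And>x. (h has_real_derivative h' x) (at x)" and h': "continuous_on UNIV h'"
    and F: "bounded_measurable M F" "\<And>x. transpose (F x) = F x"
  shows "bounded_measurable M (\<lambda>x. matrix_fun h (F x))"
proof -
  let ?K = "{A :: real ^ 'm ^ 'm. transpose A = A}"
  have cont: "continuous_on ?K (matrix_fun h)" by (rule matrix_fun_continuous[OF h h'])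
  have "F \<in> measurable M (restrict_space borel ?K)"
    using F by (intro measurable_restrict_space2) (auto simp: bounded_measurable_def)
  from measurable_compose[OF this borel_measurable_continuous_on_restrict[OF cont]]
  have m: "(\<lambda>x. matrix_fun h (F x)) \<in> borel_measurable M" .
  obtain R where R: "\<And>x. norm (F x) \<le> R" using F(1) by (auto simp: bounded_measurable_def bounded_iff)
  have "linear (\<lambda>A :: real ^ 'm ^ 'm. transpose A - A)"
    by (intro linearI) (simp_all add: transpose_add transpose_scalar scaleR_diff_right)
  then have "closed {A :: real ^ 'm ^ 'm. transpose A - A = 0}"
    by (intro closed_Collect_eq linear_continuous_on continuous_on_const) (simp add: linear_conv_bounded_linear)
  then have "closed ?K" by simp
  then have "compact (?K \<inter> cball 0 R)" by (rule closed_Int_compact) (rule compact_cball)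
  then have "bounded (matrix_fun h ` (?K \<inter> cball 0 R))"
    by (intro compact_imp_bounded compact_continuous_image continuous_on_subset[OF cont]) auto
  then have "bounded (range (\<lambda>x. matrix_fun h (F x)))"
    by (rule bounded_subset) (use F R in auto)
  with m show ?thesis by (simp add: bounded_measurable_def)
qed

lemma (in prob_space) integrable_bounded_measurable:
  "bounded_measurable M F \<Longrightarrow> integrable M F"
  by (auto simp: bounded_measurable_def bounded_iff intro: integrable_const_bound)

section \<open>Independent rank-one samples\<close>

lemma norm_outer_square: "norm (outer_square x) = (norm x)\<^sup>2"
proof -
  have "(norm (outer_square x))\<^sup>2 = x \<bullet> (outer_square x *v x)"
    by (simp only: power2_norm_eq_inner inner_matrix_trace transpose_outer_square trace_mult_outer_square)
  also have "\<dots> = ((norm x)\<^sup>2)\<^sup>2" by (simp add: outer_square_apply power2_norm_eq_inner power2_eq_square[of "_ \<bullet> _"])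
  finally show ?thesis by (rule power2_eq_imp_eq) simp_all
qed

lemma outer_square_mult_self: "outer_square x ** outer_square x = (norm x)\<^sup>2 *\<^sub>R outer_square x"
  by (simp add: matrix_eq matrix_vector_mul_assoc[symmetric] outer_square_apply
      scaleR_matrix_vector_assoc[symmetric] power2_norm_eq_inner matrix_vector_mult_scaleR mult.commute)

text \<open>The gradient enters only through a bounded measurable g under the law \<mu>. As n is a
  parameter, facts on the mean alone can be taken from the instance n = 1.\<close>

locale rank_one_samples =
  fixes \<mu> :: "'a measure" and g :: "'a \<Rightarrow> real ^ 'm" and L :: real and n :: nat
  assumes prob_mu: "prob_space \<mu>" and g_measurable [measurable]: "g \<in> borel_measurable \<mu>"
    and g_bound: "norm (g x) \<le> L" and n_pos: "0 < n"
begin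

sublocale mu: prob_space \<mu> by (rule prob_mu)

sublocale prod: product_prob_space "\<lambda>i::nat. \<mu>" "{0..n}" ..

definition second_moment :: "real ^ 'm ^ 'm" where
  "second_moment = (LINT x|\<mu>. outer_square (g x))"

text \<open>Coordinate \<open>0\<close> is an independent copy; the sample consists of the coordinates \<open>1, \<dots>, n\<close>.\<close>

abbreviation samples :: "(nat \<Rightarrow> 'a) measure" where
  "samples \<equiv> PiM {0..n} (\<lambda>_. \<mu>)"

definition deviation :: "(nat \<Rightarrow> 'a) \<Rightarrow> real ^ 'm ^ 'm" where
  "deviation \<omega> = (1 / real n) *\<^sub>R (\<Sum>j=1..n. outer_square (g (\<omega> j))) - second_moment"

lemma bounded_measurable_outer_square_g: "bounded_measurable \<mu> (\<lambda>x. outer_square (g x))"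
proof -
  have "norm (outer_square (g x)) \<le> L\<^sup>2" for x
    using power_mono[OF g_bound norm_ge_zero] by (simp add: norm_outer_square)
  moreover have "(\<lambda>x. outer_square (g x)) \<in> borel_measurable \<mu>"
    using borel_measurable_continuous_onI[OF outer_square_continuous] by measurable
  ultimately show ?thesis by (auto simp: bounded_measurable_def bounded_iff)
qed

lemma integral_linear_outer_square:
  assumes "bounded_linear T"
  shows "(LINT x|\<mu>. T (outer_square (g x))) = T second_moment"
  unfolding second_moment_def
  by (rule integral_bounded_linear[OF assms mu.integrable_bounded_measurable[OF bounded_measurable_outer_square_g]])

lemma bounded_linear_trace_mult: "bounded_linear (\<lambda>A :: real ^ 'm ^ 'm. trace (A ** C))"
  by (rule bounded_linear_compose[OF bounded_linear_trace
        bounded_bilinear.bounded_linear_left[OF bounded_bilinear_matrix_mul]])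

lemma second_moment_symmetric: "transpose second_moment = second_moment"
proof -
  have "bounded_linear (\<lambda>A :: real ^ 'm ^ 'm. transpose A)"
    unfolding linear_conv_bounded_linear[symmetric]
    by (intro linearI) (simp_all add: transpose_add transpose_scalar)
  from integral_linear_outer_square[OF this] show ?thesis
    by (simp add: transpose_outer_square second_moment_def)
qed

lemma second_moment_quadratic: "x \<bullet> (second_moment *v x) = (LINT z|\<mu>. (g z \<bullet> x)\<^sup>2)"
proof -
  have "(LINT z|\<mu>. (g z \<bullet> x)\<^sup>2) = (LINT z|\<mu>. trace (outer_square (g z) ** outer_square x))"
    by (simp add: trace_mult_outer_square outer_square_apply power2_eq_square inner_commute)
  also have "\<dots> = x \<bullet> (second_moment *v x)"
    using integral_linear_outer_square[OF bounded_linear_trace_mult, of "outer_square x"]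
    by (simp add: trace_mult_outer_square)
  finally show ?thesis ..
qed

text \<open>The Loewner bounds 0 \<le> E \<le> L^2 I, by Cauchy-Schwarz under the integral; later
  they confine the quadratic form of L^2 I - 2 E.\<close>

lemma second_moment_bounds:
  shows "0 \<le> x \<bullet> (second_moment *v x)" "x \<bullet> (second_moment *v x) \<le> L\<^sup>2 * (norm x)\<^sup>2"
proof -
  show "0 \<le> x \<bullet> (second_moment *v x)" by (simp add: second_moment_quadratic)
  have le: "(g z \<bullet> x)\<^sup>2 \<le> L\<^sup>2 * (norm x)\<^sup>2" for z
  proof -
    have "\<bar>g z \<bullet> x\<bar> \<le> L * norm x"
      using Cauchy_Schwarz_ineq2[of "g z" x] mult_right_mono[OF g_bound norm_ge_zero, of z x] by linarith
    then have "\<bar>g z \<bullet> x\<bar>\<^sup>2 \<le> (L * norm x)\<^sup>2" by (intro power_mono) auto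
    then show ?thesis by (simp add: power_mult_distrib)
  qed
  have "bounded_measurable \<mu> (\<lambda>z. (g z \<bullet> x)\<^sup>2)"
    unfolding bounded_measurable_def bounded_iff using le by (auto intro!: exI[of _ "L\<^sup>2 * (norm x)\<^sup>2"])
  from mu.integrable_bounded_measurable[OF this]
  have "(LINT z|\<mu>. (g z \<bullet> x)\<^sup>2) \<le> (LINT z|\<mu>. L\<^sup>2 * (norm x)\<^sup>2)"
    by (intro integral_mono le) auto
  then show "x \<bullet> (second_moment *v x) \<le> L\<^sup>2 * (norm x)\<^sup>2"
    by (simp add: second_moment_quadratic mu.prob_space)
qed

lemma bounded_measurable_sample [bounded_measurable_intros]:
  "j \<in> {0..n} \<Longrightarrow> bounded_measurable samples (\<lambda>\<omega>. outer_square (g (\<omega> j)))"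
  by (rule bounded_measurable_compose[OF bounded_measurable_outer_square_g])
    (simp add: measurable_component_singleton)

lemma bounded_measurable_deviation [bounded_measurable_intros]:
  "bounded_measurable samples deviation"
  unfolding deviation_def by (intro bounded_measurable_intros) auto

lemma deviation_symmetric: "transpose (deviation \<omega>) = deviation \<omega>"
  by (simp add: deviation_def transpose_diff transpose_scalar transpose_sum transpose_outer_square
      second_moment_symmetric)

lemmas bounded_measurable_matrix_fun_deviation =
  bounded_measurable_matrix_fun[OF _ _ bounded_measurable_deviation deviation_symmetric]

lemma bounded_measurable_cosh [bounded_measurable_intros]:
  "bounded_measurable samples (\<lambda>\<omega>. matrix_fun (\<lambda>s. cosh (\<theta> * s)) (deviation \<omega>))"
  by (rule bounded_measurable_matrix_fun_deviation[where h' = "\<lambda>s. \<theta> * sinh (\<theta> * s)"])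
    (auto intro!: derivative_eq_intros continuous_intros)

lemma bounded_measurable_sinh [bounded_measurable_intros]:
  "bounded_measurable samples (\<lambda>\<omega>. matrix_fun (\<lambda>s. sinh (\<theta> * s)) (deviation \<omega>))"
  by (rule bounded_measurable_matrix_fun_deviation[where h' = "\<lambda>s. \<theta> * cosh (\<theta> * s)"])
    (auto intro!: derivative_eq_intros continuous_intros)

lemma integrable_samples: "bounded_measurable samples F \<Longrightarrow> integrable samples F"
  by (rule prod.P.integrable_bounded_measurable)

text \<open>The transposition of coordinates 0 and j. The restriction makes the value an extensional
  function, as points of the product space are.\<close>

definition exchange :: "nat \<Rightarrow> (nat \<Rightarrow> 'a) \<Rightarrow> nat \<Rightarrow> 'a" where
  "exchange j \<omega> = (\<lambda>i\<in>{0..n}. \<omega> (if i = 0 then j else if i = j then 0 else i))"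

lemma distr_exchange:
  assumes "j \<in> {0..n}"
  shows "distr samples samples (exchange j) = samples"
  unfolding exchange_def
  by (rule distr_PiM_reindex[where M = "\<lambda>_. \<mu>" and f = "\<lambda>i. if i = 0 then j else if i = j then 0 else i"])
    (use assms in \<open>auto simp: prob_mu inj_on_def split: if_splits\<close>)

lemma measurable_exchange: "j \<in> {0..n} \<Longrightarrow> exchange j \<in> measurable samples samples"
  unfolding exchange_def by (rule measurable_restrict) (auto intro!: measurable_component_singleton)

lemma integral_exchange:
  fixes F :: "_ \<Rightarrow> real"
  assumes "j \<in> {0..n}" "bounded_measurable samples F"
  shows "(LINT \<omega>|samples. F (exchange j \<omega>)) = (LINT \<omega>|samples. F \<omega>)"
  using integral_distr[OF measurable_exchange[OF assms(1)], of F] assms(2)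
  by (simp add: distr_exchange[OF assms(1)] bounded_measurable_def)

text \<open>Fubini with coordinate 0 integrated first: C does not see it, so the fresh sample may be
  replaced by its mean. Used in both directions, to insert an independent copy and to remove
  it.\<close>

lemma integral_fresh_sample:
  assumes C: "bounded_measurable samples C" and fresh: "\<And>\<omega> y. C (fun_upd \<omega> 0 y) = C \<omega>"
  shows "(LINT \<omega>|samples. trace (outer_square (g (\<omega> 0)) ** C \<omega>)) =
    (LINT \<omega>|samples. trace (second_moment ** C \<omega>))"
proof -
  have ins: "{0..n} = insert 0 {1..n}" by auto
  have int: "(LINT \<omega>|samples. F \<omega>) = (LINT x|PiM {1..n} (\<lambda>_. \<mu>). LINT y|\<mu>. F (fun_upd x 0 y))"
    if "bounded_measurable samples F" for F :: "_ \<Rightarrow> real"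
    using prod.product_integral_insert[of "{1..n}" 0 F] integrable_samples[OF that] by (simp flip: ins)
  have "(LINT \<omega>|samples. trace (outer_square (g (\<omega> 0)) ** C \<omega>)) =
    (LINT x|PiM {1..n} (\<lambda>_. \<mu>). LINT y|\<mu>. trace (outer_square (g y) ** C x))"
    by (subst int) (auto intro!: bounded_measurable_intros C simp: fresh)
  also have "\<dots> = (LINT \<omega>|samples. trace (second_moment ** C \<omega>))"
    by (subst int) (auto intro!: bounded_measurable_intros C
        simp: fresh integral_linear_outer_square[OF bounded_linear_trace_mult] mu.prob_space)
  finally show ?thesis .
qed

lemma deviation_fresh: "deviation (fun_upd \<omega> 0 y) = deviation \<omega>"
  by (simp add: deviation_def)

lemma deviation_exchange:
  assumes "j \<in> {1..n}"
  shows "deviation \<omega> - deviation (exchange j \<omega>) = (1 / real n) *\<^sub>R (outer_square (g (\<omega> j)) - outer_square (g (\<omega> 0)))"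
proof -
  have "(\<Sum>i=1..n. outer_square (g (exchange j \<omega> i))) =
      (\<Sum>i\<in>{1..n}. outer_square (g (\<omega> i)) + (if i = j then outer_square (g (\<omega> 0)) - outer_square (g (\<omega> j)) else 0))"
  proof (rule sum.cong[OF refl])
    fix i assume i: "i \<in> {1..n}"
    then have "exchange j \<omega> i = \<omega> (if i = j then 0 else i)" by (simp add: exchange_def)
    then show "outer_square (g (exchange j \<omega> i)) =
      outer_square (g (\<omega> i)) + (if i = j then outer_square (g (\<omega> 0)) - outer_square (g (\<omega> j)) else 0)"
      by (cases "i = j") simp_all
  qed
  also have "\<dots> = (\<Sum>i=1..n. outer_square (g (\<omega> i))) + (outer_square (g (\<omega> 0)) - outer_square (g (\<omega> j)))"
    using assms by (simp add: sum.distrib)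
  finally have "(\<Sum>i=1..n. outer_square (g (\<omega> i))) - (\<Sum>i=1..n. outer_square (g (exchange j \<omega> i))) =
      outer_square (g (\<omega> j)) - outer_square (g (\<omega> 0))" by (simp add: algebra_simps)
  then show ?thesis by (simp add: deviation_def flip: scaleR_diff_right)
qed

text \<open>Each sample has mean E, since exchanging coordinate j with 0 turns it into the fresh
  one. This makes the term linear in S of the variance bound disappear.\<close>

lemma integral_trace_deviation: "(LINT \<omega>|samples. trace (D ** deviation \<omega>)) = 0"
proof -
  have j: "(LINT \<omega>|samples. trace (D ** outer_square (g (\<omega> j)))) = trace (D ** second_moment)" if "j \<in> {1..n}" for j
  proof -
    have "(LINT \<omega>|samples. trace (D ** outer_square (g (\<omega> j)))) = (LINT \<omega>|samples. trace (D ** outer_square (g (exchange j \<omega> 0))))"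
      using that by (simp add: exchange_def)
    also have "\<dots> = (LINT \<omega>|samples. trace (D ** outer_square (g (\<omega> 0))))"
      by (rule integral_exchange[where F = "\<lambda>\<omega>. trace (D ** outer_square (g (\<omega> 0)))"])
        (use that in \<open>auto intro!: bounded_measurable_intros\<close>)
    also have "\<dots> = (LINT \<omega>|samples. trace (outer_square (g (\<omega> 0)) ** D))"
      by (simp only: trace_mul_sym[of D])
    also have "\<dots> = trace (D ** second_moment)"
      by (subst integral_fresh_sample) (auto intro: bounded_measurable_intros simp: prod.P.prob_space trace_mul_sym[of D])
    finally show ?thesis .
  qed
  have int: "integrable samples (\<lambda>\<omega>. trace (D ** outer_square (g (\<omega> j))))" if "j \<in> {1..n}" for j
    using that by (intro integrable_samples bounded_measurable_intros) auto
  have isum: "(LINT \<omega>|samples. (\<Sum>j=1..n. trace (D ** outer_square (g (\<omega> j))))) =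
      (\<Sum>j=1..n. LINT \<omega>|samples. trace (D ** outer_square (g (\<omega> j))))"
    by (rule Bochner_Integration.integral_sum) (rule int)
  have i1: "integrable samples (\<lambda>\<omega>. (1 / real n) * (\<Sum>j=1..n. trace (D ** outer_square (g (\<omega> j)))))"
    by (intro integrable_mult_right Bochner_Integration.integrable_sum int)
  have "(LINT \<omega>|samples. trace (D ** deviation \<omega>)) =
    (LINT \<omega>|samples. (1 / real n) * (\<Sum>j=1..n. trace (D ** outer_square (g (\<omega> j)))) - trace (D ** second_moment))"
    by (simp add: deviation_def matrix_sub_ldistrib trace_sub matrix_mul_scaleR_right trace_scaleR matrix_mul_sum_right trace_sum)
  also have "\<dots> = (1 / real n) * (\<Sum>j=1..n. LINT \<omega>|samples. trace (D ** outer_square (g (\<omega> j)))) - trace (D ** second_moment)"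
    by (subst Bochner_Integration.integral_diff[OF i1])
      (simp_all add: prod.P.prob_space isum)
  also have "\<dots> = 0" using n_pos by (simp add: j)
  finally show ?thesis .
qed

end

section \<open>Symmetrization\<close>

text \<open>For u \<ge> 0 the inequality cosh u - 1 \<le> sinh u amounts to exp(-u) \<le> 1;
  negative s reduces to this by parity. It allows S (cosh(\<theta> S) - I) to be absorbed by S
  sinh(\<theta> S).\<close>

lemma abs_mult_cosh_minus_1_le:
  fixes \<theta> s :: real
  assumes "\<theta> \<ge> 0"
  shows "\<bar>s * (cosh (\<theta> * s) - 1)\<bar> \<le> s * sinh (\<theta> * s)"
proof -
  have *: "s * (cosh (\<theta> * s) - 1) \<le> s * sinh (\<theta> * s)" if "s \<ge> 0" for s
  proof (intro mult_left_mono that)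
    have "exp (- (\<theta> * s)) \<le> 1" using assms that by simp
    then show "cosh (\<theta> * s) - 1 \<le> sinh (\<theta> * s)"
      by (simp add: cosh_def sinh_def field_simps)
  qed
  show ?thesis
    using *[of s] *[of "- s"] cosh_real_ge_1[of "\<theta> * s"]
    by (cases "s \<ge> 0") (simp_all add: abs_mult)
qed

context rank_one_samples
begin

abbreviation coshS :: "real \<Rightarrow> (nat \<Rightarrow> 'a) \<Rightarrow> real ^ 'm ^ 'm" where
  "coshS \<theta> \<omega> \<equiv> matrix_fun (\<lambda>s. cosh (\<theta> * s)) (deviation \<omega>)"

abbreviation sinhS :: "real \<Rightarrow> (nat \<Rightarrow> 'a) \<Rightarrow> real ^ 'm ^ 'm" where
  "sinhS \<theta> \<omega> \<equiv> matrix_fun (\<lambda>s. sinh (\<theta> * s)) (deviation \<omega>)"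

abbreviation sample :: "nat \<Rightarrow> (nat \<Rightarrow> 'a) \<Rightarrow> real ^ 'm ^ 'm" where
  "sample j \<omega> \<equiv> outer_square (g (\<omega> j))"

definition cosh_trace :: "real \<Rightarrow> real" where
  "cosh_trace \<theta> = (LINT \<omega>|samples. trace (matrix_fun (\<lambda>s. cosh (\<theta> * s) - 1) (deviation \<omega>)))"

definition sinh_trace :: "real \<Rightarrow> real" where
  "sinh_trace \<theta> = (LINT \<omega>|samples. trace (matrix_fun (\<lambda>s. s * sinh (\<theta> * s)) (deviation \<omega>)))"

lemma bounded_measurable_cosh_minus_1 [bounded_measurable_intros]:
  "bounded_measurable samples (\<lambda>\<omega>. matrix_fun (\<lambda>s. cosh (\<theta> * s) - 1) (deviation \<omega>))"
  by (rule bounded_measurable_matrix_fun_deviation[where h' = "\<lambda>s. \<theta> * sinh (\<theta> * s)"])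
    (auto intro!: derivative_eq_intros continuous_intros)

lemma bounded_measurable_mult_sinh [bounded_measurable_intros]:
  "bounded_measurable samples (\<lambda>\<omega>. matrix_fun (\<lambda>s. s * sinh (\<theta> * s)) (deviation \<omega>))"
  by (rule bounded_measurable_matrix_fun_deviation[where h' = "\<lambda>s. sinh (\<theta> * s) + s * (\<theta> * cosh (\<theta> * s))"])
    (auto intro!: derivative_eq_intros continuous_intros)

text \<open>The exchange preserves the measure and reverses the sign of A_j - A_0. Averaging the
  integral with its exchanged form replaces sinh(\<theta> S) by half of sinh(\<theta> S) -
  sinh(\<theta> S'), and A_j - A_0 is n (S - S'), so the trace inequality applies.\<close>

lemma symmetrization:
  assumes j: "j \<in> {1..n}" and \<theta>: "\<theta> > 0"
  shows "(LINT \<omega>|samples. trace ((sample j \<omega> - sample 0 \<omega>) ** sinhS \<theta> \<omega>)) \<le>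
    \<theta> / (2 * n) * (LINT \<omega>|samples. trace ((sample j \<omega> - sample 0 \<omega>) ** (sample j \<omega> - sample 0 \<omega>) ** coshS \<theta> \<omega>))"
    (is "?l \<le> _ * ?r")
proof -
  have j0: "j \<in> {0..n}" using j by simp
  let ?D = "\<lambda>\<omega>. sample j \<omega> - sample 0 \<omega>"
  let ?e = "exchange j"
  have D: "?D (?e \<omega>) = - ?D \<omega>" for \<omega> using j by (simp add: exchange_def)
  have neg: "trace ((- X) ** Y) = - trace (X ** Y)" for X Y :: "real ^ 'm ^ 'm"
    by (metis trace_scaleR matrix_mul_scaleR_left scaleR_minus1_left mult_minus1)
  have bm1: "bounded_measurable samples (\<lambda>\<omega>. trace (?D \<omega> ** sinhS \<theta> \<omega>))"
    and bm2: "bounded_measurable samples (\<lambda>\<omega>. trace (?D \<omega> ** ?D \<omega> ** coshS \<theta> \<omega>))"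
    and bm3: "bounded_measurable samples (\<lambda>\<omega>. trace (?D \<omega> ** sinhS \<theta> (?e \<omega>)))"
    and bm4: "bounded_measurable samples (\<lambda>\<omega>. trace (?D \<omega> ** ?D \<omega> ** coshS \<theta> (?e \<omega>)))"
    using j0
    by (auto intro!: bounded_measurable_trace bounded_measurable_matrix_mul bounded_measurable_diff
        bounded_measurable_sample bounded_measurable_sinh bounded_measurable_cosh
        bounded_measurable_compose[OF bounded_measurable_sinh measurable_exchange]
        bounded_measurable_compose[OF bounded_measurable_cosh measurable_exchange])
  have l: "?l = - (LINT \<omega>|samples. trace (?D \<omega> ** sinhS \<theta> (?e \<omega>)))"
    by (subst integral_exchange[OF j0 bm1, symmetric]) (simp only: D neg Bochner_Integration.integral_minus)
  \<comment> \<open>(A_j - A_0)^2 is invariant under the exchange, so the cosh term at S' has the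
    same mean as that at S.\<close>
  have r: "(LINT \<omega>|samples. trace (?D \<omega> ** ?D \<omega> ** coshS \<theta> (?e \<omega>))) = ?r"
  proof -
    have "?D (?e \<omega>) ** ?D (?e \<omega>) = ?D \<omega> ** ?D \<omega>" for \<omega>
      unfolding D by (simp add: vec_eq_iff matrix_matrix_mult_def algebra_simps)
    then show ?thesis by (subst integral_exchange[OF j0 bm2, symmetric]) simp
  qed
  have "2 * ?l = ?l - (LINT \<omega>|samples. trace (?D \<omega> ** sinhS \<theta> (?e \<omega>)))" using l by simp
  also have "\<dots> = (LINT \<omega>|samples. trace (?D \<omega> ** (sinhS \<theta> \<omega> - sinhS \<theta> (?e \<omega>))))"
    by (simp add: matrix_sub_ldistrib trace_sub integrable_samples[OF bm1] integrable_samples[OF bm3])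
  also have "\<dots> \<le> (LINT \<omega>|samples. \<theta> / (2 * n) * (trace (?D \<omega> ** ?D \<omega> ** coshS \<theta> \<omega>) + trace (?D \<omega> ** ?D \<omega> ** coshS \<theta> (?e \<omega>))))"
  proof (rule integral_mono)
    show "integrable samples (\<lambda>\<omega>. trace (?D \<omega> ** (sinhS \<theta> \<omega> - sinhS \<theta> (?e \<omega>))))"
      by (simp add: matrix_sub_ldistrib trace_sub integrable_samples[OF bm1] integrable_samples[OF bm3])
    show "integrable samples (\<lambda>\<omega>. \<theta> / (2 * n) * (trace (?D \<omega> ** ?D \<omega> ** coshS \<theta> \<omega>) + trace (?D \<omega> ** ?D \<omega> ** coshS \<theta> (?e \<omega>))))"
      by (intro integrable_mult_right Bochner_Integration.integrable_add integrable_samples bm2 bm4)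
    fix \<omega>
    let ?S = "deviation \<omega>" and ?S' = "deviation (?e \<omega>)"
    have SD: "?D \<omega> = real n *\<^sub>R (?S - ?S')" using n_pos by (simp add: deviation_exchange[OF j])
    have "trace (?D \<omega> ** (sinhS \<theta> \<omega> - sinhS \<theta> (?e \<omega>))) =
        real n * trace ((?S - ?S') ** (sinhS \<theta> \<omega> - sinhS \<theta> (?e \<omega>)))"
      by (simp only: SD matrix_mul_scaleR_left trace_scaleR)
    also have "\<dots> \<le> real n * (\<theta> / 2 * (trace ((?S - ?S') ** (?S - ?S') ** coshS \<theta> \<omega>) + trace ((?S - ?S') ** (?S - ?S') ** coshS \<theta> (?e \<omega>))))"
      by (intro mult_left_mono trace_matrix_fun_mean_value deviation_symmetric sinh_trapezoid_scaled \<theta>) simp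
    also have "\<dots> = \<theta> / (2 * n) * (trace (?D \<omega> ** ?D \<omega> ** coshS \<theta> \<omega>) + trace (?D \<omega> ** ?D \<omega> ** coshS \<theta> (?e \<omega>)))"
      using n_pos by (simp only: SD matrix_mul_scaleR_left matrix_mul_scaleR_right trace_scaleR) (simp add: field_simps)
    finally show "trace (?D \<omega> ** (sinhS \<theta> \<omega> - sinhS \<theta> (?e \<omega>))) \<le> \<dots>" .
  qed
  also have "\<dots> = \<theta> / (2 * n) * (?r + ?r)"
    by (simp add: integrable_samples[OF bm2] integrable_samples[OF bm4] r)
  finally show ?thesis by simp
qed

lemma trace_mult_psd_mono:
  assumes "\<And>s. 0 \<le> h s" "\<And>b. norm b = 1 \<Longrightarrow> b \<bullet> (C *v b) \<le> e"
  shows "trace (C ** matrix_fun h (deviation \<omega>)) \<le> e * trace (matrix_fun h (deviation \<omega>))"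
  unfolding trace_mult_matrix_fun trace_matrix_fun[OF deviation_symmetric] sum_distrib_left
proof (intro sum_mono)
  fix b assume "b \<in> eigenvectors (deviation \<omega>)"
  then have "norm b = 1" by (rule eigenbasis_norm[OF eigenbasis_eigenvectors[OF deviation_symmetric]])
  then have "h (b \<bullet> (deviation \<omega> *v b)) * (b \<bullet> (C *v b)) \<le> h (b \<bullet> (deviation \<omega> *v b)) * e"
    using assms by (intro mult_left_mono) auto
  then show "h (b \<bullet> (deviation \<omega> *v b)) * (b \<bullet> (C *v b)) \<le> e * h (b \<bullet> (deviation \<omega> *v b))"
    by (simp add: mult.commute)
qed

lemma trace_outer_square_coshS_nonneg: "0 \<le> trace (outer_square x ** coshS \<theta> \<omega>)"
  unfolding trace_mult_matrix_fun
  by (intro sum_nonneg mult_nonneg_nonneg) (simp_all add: outer_square_apply inner_commute cosh_real_nonneg)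

text \<open>A rank-one sample satisfies A^2 \<le> L^2 A, which trades second moments for first ones;
  the fresh sample is then averaged to E. The cross terms are kept, since they supply the -2 E in
  the coefficient of S.\<close>

lemma conditional_variance:
  assumes j: "j \<in> {1..n}"
  shows "(LINT \<omega>|samples. trace ((sample j \<omega> - sample 0 \<omega>) ** (sample j \<omega> - sample 0 \<omega>) ** coshS \<theta> \<omega>)) \<le>
    (LINT \<omega>|samples. L\<^sup>2 * trace (sample j \<omega> ** coshS \<theta> \<omega>) + L\<^sup>2 * trace (second_moment ** coshS \<theta> \<omega>)
      - trace (second_moment ** (coshS \<theta> \<omega> ** sample j \<omega>)) - trace (second_moment ** (sample j \<omega> ** coshS \<theta> \<omega>)))"
proof -
  let ?p = "coshS \<theta>" and ?a = "sample j" and ?b = "sample 0"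
  have bm: "bounded_measurable samples ?a" "bounded_measurable samples ?b" "bounded_measurable samples ?p"
    using j by (auto intro!: bounded_measurable_intros)
  have sq: "trace (outer_square (g x) ** outer_square (g x) ** ?p \<omega>) \<le> L\<^sup>2 * trace (outer_square (g x) ** ?p \<omega>)" for x \<omega>
    using mult_right_mono[OF power_mono[OF g_bound norm_ge_zero, of x 2] trace_outer_square_coshS_nonneg]
    by (simp add: outer_square_mult_self matrix_mul_scaleR_left trace_scaleR)
  have "(LINT \<omega>|samples. trace ((?a \<omega> - ?b \<omega>) ** (?a \<omega> - ?b \<omega>) ** ?p \<omega>)) \<le>
    (LINT \<omega>|samples. L\<^sup>2 * trace (?a \<omega> ** ?p \<omega>) + L\<^sup>2 * trace (?b \<omega> ** ?p \<omega>)
      - trace (?b \<omega> ** (?p \<omega> ** ?a \<omega>)) - trace (?b \<omega> ** (?a \<omega> ** ?p \<omega>)))"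
  proof (rule integral_mono)
    fix \<omega>
    have "trace ((?a \<omega> - ?b \<omega>) ** (?a \<omega> - ?b \<omega>) ** ?p \<omega>) =
      trace (?a \<omega> ** ?a \<omega> ** ?p \<omega>) - trace (?a \<omega> ** (?b \<omega> ** ?p \<omega>)) - trace (?b \<omega> ** (?a \<omega> ** ?p \<omega>))
      + trace (?b \<omega> ** ?b \<omega> ** ?p \<omega>)"
      by (simp add: matrix_sub_rdistrib matrix_sub_ldistrib trace_sub matrix_mul_assoc)
    \<comment> \<open>Cyclicity brings sample 0 to the front, where it can be integrated out; the
      other factors do not involve coordinate 0.\<close>
    also have "trace (?a \<omega> ** (?b \<omega> ** ?p \<omega>)) = trace (?b \<omega> ** (?p \<omega> ** ?a \<omega>))"
      by (simp only: trace_mul_sym[of "?a \<omega>"] matrix_mul_assoc[symmetric])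
    finally show "trace ((?a \<omega> - ?b \<omega>) ** (?a \<omega> - ?b \<omega>) ** ?p \<omega>) \<le>
      L\<^sup>2 * trace (?a \<omega> ** ?p \<omega>) + L\<^sup>2 * trace (?b \<omega> ** ?p \<omega>)
      - trace (?b \<omega> ** (?p \<omega> ** ?a \<omega>)) - trace (?b \<omega> ** (?a \<omega> ** ?p \<omega>))"
      using sq[of "\<omega> j" \<omega>] sq[of "\<omega> 0" \<omega>] by linarith
  qed (intro integrable_samples bounded_measurable_intros bm)+
  also have "\<dots> = L\<^sup>2 * (LINT \<omega>|samples. trace (?a \<omega> ** ?p \<omega>)) + L\<^sup>2 * (LINT \<omega>|samples. trace (?b \<omega> ** ?p \<omega>))
      - (LINT \<omega>|samples. trace (?b \<omega> ** (?p \<omega> ** ?a \<omega>))) - (LINT \<omega>|samples. trace (?b \<omega> ** (?a \<omega> ** ?p \<omega>)))"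
    by (simp add: integrable_samples bounded_measurable_trace bounded_measurable_matrix_mul bm)
  also have "\<dots> = L\<^sup>2 * (LINT \<omega>|samples. trace (?a \<omega> ** ?p \<omega>)) + L\<^sup>2 * (LINT \<omega>|samples. trace (second_moment ** ?p \<omega>))
      - (LINT \<omega>|samples. trace (second_moment ** (?p \<omega> ** ?a \<omega>))) - (LINT \<omega>|samples. trace (second_moment ** (?a \<omega> ** ?p \<omega>)))"
    using j by (simp add: integral_fresh_sample bounded_measurable_matrix_mul bm deviation_fresh)
  also have "\<dots> = (LINT \<omega>|samples. L\<^sup>2 * trace (?a \<omega> ** ?p \<omega>) + L\<^sup>2 * trace (second_moment ** ?p \<omega>)
      - trace (second_moment ** (?p \<omega> ** ?a \<omega>)) - trace (second_moment ** (?a \<omega> ** ?p \<omega>)))"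
    by (simp add: integrable_samples bounded_measurable_trace bounded_measurable_matrix_mul bm bounded_measurable_const)
  finally show ?thesis .
qed

end

section \<open>Differential inequality and tail bound\<close>

text \<open>The mean value inequality used twice: for sinh on the segment, then for cosh minus a
  linear function of slope sinh a. The constant depends only on a bound for the arguments, so the
  remainder is uniform over the samples.\<close>

lemma cosh_taylor_bound:
  fixes a b M :: real
  assumes "\<bar>a\<bar> \<le> M" "\<bar>b\<bar> \<le> M"
  shows "\<bar>cosh b - cosh a - (b - a) * sinh a\<bar> \<le> cosh M * (b - a)\<^sup>2"
proof -
  let ?S = "closed_segment a b"
  have M: "\<bar>z\<bar> \<le> M" if "z \<in> ?S" for z
    using that assms by (auto simp: closed_segment_eq_real_ivl split: if_splits)
  have sinh_lip: "\<bar>sinh z - sinh a\<bar> \<le> cosh M * \<bar>z - a\<bar>" if "z \<in> ?S" for z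
  proof -
    have "norm (sinh z - sinh a) \<le> cosh M * norm (z - a)"
    proof (rule field_differentiable_bound[where f' = cosh and S = ?S])
      show "(sinh has_real_derivative cosh x) (at x within ?S)" for x
        by (auto intro!: derivative_eq_intros)
      show "norm (cosh x) \<le> cosh M" if "x \<in> ?S" for x
      proof -
        have "cosh x = cosh \<bar>x\<bar>" by (cases "x \<ge> 0") simp_all
        also have "\<dots> \<le> cosh M" using M[OF that] by (subst cosh_real_nonneg_le_iff) auto
        finally show ?thesis by (simp add: cosh_real_nonneg)
      qed
    qed (use that in auto)
    then show ?thesis by simp
  qed
  have "norm ((cosh b - b * sinh a) - (cosh a - a * sinh a)) \<le> (cosh M * \<bar>b - a\<bar>) * norm (b - a)"
  proof (rule field_differentiable_bound[where f' = "\<lambda>z. sinh z - sinh a" and S = ?S and f = "\<lambda>z. cosh z - z * sinh a"])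
    show "((\<lambda>z. cosh z - z * sinh a) has_real_derivative (sinh x - sinh a)) (at x within ?S)" for x
      by (auto intro!: derivative_eq_intros)
    show "norm (sinh z - sinh a) \<le> cosh M * \<bar>b - a\<bar>" if "z \<in> ?S" for z
    proof -
      have "\<bar>z - a\<bar> \<le> \<bar>b - a\<bar>" using that by (auto simp: closed_segment_eq_real_ivl split: if_splits)
      then have "cosh M * \<bar>z - a\<bar> \<le> cosh M * \<bar>b - a\<bar>" by (rule mult_left_mono) (rule cosh_real_nonneg)
      with sinh_lip[OF that] show ?thesis unfolding real_norm_def by (rule order_trans)
    qed
  qed auto
  moreover have "(cosh b - b * sinh a) - (cosh a - a * sinh a) = cosh b - cosh a - (b - a) * sinh a"
    by (simp add: algebra_simps)
  moreover have "cosh M * \<bar>b - a\<bar> * norm (b - a) = cosh M * (b - a)\<^sup>2"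
    by (simp add: power2_eq_square mult.assoc)
  ultimately show ?thesis by (simp only: real_norm_def)
qed

context rank_one_samples
begin

section \<open>From the conditional variance to the differential inequality\<close>

lemma deviation_mult_matrix_fun:
  "deviation \<omega> ** matrix_fun h (deviation \<omega>) = matrix_fun (\<lambda>s. s * h s) (deviation \<omega>)"
  "matrix_fun h (deviation \<omega>) ** deviation \<omega> = matrix_fun (\<lambda>s. s * h s) (deviation \<omega>)"
  using matrix_fun_mult[OF deviation_symmetric, of "\<lambda>s. s" \<omega> h] matrix_fun_mult[OF deviation_symmetric, of h \<omega> "\<lambda>s. s"]
  by (simp_all add: matrix_fun_id[OF deviation_symmetric] mult.commute)

lemma sample_mean: "(1 / real n) *\<^sub>R (\<Sum>j=1..n. sample j \<omega>) = deviation \<omega> + second_moment"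
  by (simp add: deviation_def)

text \<open>S is the average of A_j - E, and E may be replaced by the fresh copy A_0 under the
  integral because sinh(\<theta> S) ignores coordinate 0. This puts the derivative in the form
  required by \<open>symmetrization\<close>.\<close>

lemma sinh_trace_eq:
  "sinh_trace \<theta> = (1 / real n) * (\<Sum>j=1..n. LINT \<omega>|samples. trace ((sample j \<omega> - sample 0 \<omega>) ** sinhS \<theta> \<omega>))"
proof -
  have bm: "bounded_measurable samples (\<lambda>\<omega>. trace ((sample j \<omega> - second_moment) ** sinhS \<theta> \<omega>))" if "j \<in> {1..n}" for j
    using that by (intro bounded_measurable_intros) auto
  have dev: "deviation \<omega> = (1 / real n) *\<^sub>R (\<Sum>j=1..n. sample j \<omega> - second_moment)" for \<omega>
    using n_pos by (simp add: deviation_def sum_subtractf scaleR_diff_right sum_constant_scaleR del: sum_constant)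
  have "sinh_trace \<theta> = (LINT \<omega>|samples. (1 / real n) * (\<Sum>j=1..n. trace ((sample j \<omega> - second_moment) ** sinhS \<theta> \<omega>)))"
    unfolding sinh_trace_def
  proof (rule Bochner_Integration.integral_cong[OF refl])
    fix \<omega>
    have "trace (matrix_fun (\<lambda>s. s * sinh (\<theta> * s)) (deviation \<omega>)) = trace (deviation \<omega> ** sinhS \<theta> \<omega>)"
      by (simp only: deviation_mult_matrix_fun)
    also have "\<dots> = trace (((1 / real n) *\<^sub>R (\<Sum>j=1..n. sample j \<omega> - second_moment)) ** sinhS \<theta> \<omega>)"
      by (subst (1) dev) (rule refl)
    also have "\<dots> = (1 / real n) * (\<Sum>j=1..n. trace ((sample j \<omega> - second_moment) ** sinhS \<theta> \<omega>))"
      by (simp only: matrix_mul_scaleR_left trace_scaleR matrix_mul_sum_left trace_sum)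
    finally show "trace (matrix_fun (\<lambda>s. s * sinh (\<theta> * s)) (deviation \<omega>)) = \<dots>" .
  qed
  also have "\<dots> = (1 / real n) * (\<Sum>j=1..n. LINT \<omega>|samples. trace ((sample j \<omega> - second_moment) ** sinhS \<theta> \<omega>))"
    by (simp only: integral_mult_right_zero Bochner_Integration.integral_sum[OF integrable_samples[OF bm]])
  also have "(\<Sum>j=1..n. LINT \<omega>|samples. trace ((sample j \<omega> - second_moment) ** sinhS \<theta> \<omega>)) =
    (\<Sum>j=1..n. LINT \<omega>|samples. trace ((sample j \<omega> - sample 0 \<omega>) ** sinhS \<theta> \<omega>))"
  proof (rule sum.cong[OF refl])
    fix j assume j: "j \<in> {1..n}"
    have a: "bounded_measurable samples (\<lambda>\<omega>. trace (sample j \<omega> ** sinhS \<theta> \<omega>))"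
      and b: "bounded_measurable samples (\<lambda>\<omega>. trace (sample 0 \<omega> ** sinhS \<theta> \<omega>))"
      and c: "bounded_measurable samples (\<lambda>\<omega>. trace (second_moment ** sinhS \<theta> \<omega>))"
      using j by (auto intro!: bounded_measurable_intros)
    show "(LINT \<omega>|samples. trace ((sample j \<omega> - second_moment) ** sinhS \<theta> \<omega>)) =
        (LINT \<omega>|samples. trace ((sample j \<omega> - sample 0 \<omega>) ** sinhS \<theta> \<omega>))"
      by (simp add: matrix_sub_rdistrib trace_sub integrable_samples[OF a] integrable_samples[OF b]
          integrable_samples[OF c] integral_fresh_sample bounded_measurable_sinh deviation_fresh)
  qed
  finally show ?thesis .
qed

lemma conditional_variance_mean:
  "(1 / real n) * (\<Sum>j=1..n. L\<^sup>2 * trace (sample j \<omega> ** P) + L\<^sup>2 * trace (second_moment ** P)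
      - trace (second_moment ** (P ** sample j \<omega>)) - trace (second_moment ** (sample j \<omega> ** P))) =
   L\<^sup>2 * trace ((deviation \<omega> + second_moment) ** P) + L\<^sup>2 * trace (second_moment ** P)
      - trace (second_moment ** (P ** (deviation \<omega> + second_moment)))
      - trace (second_moment ** ((deviation \<omega> + second_moment) ** P))"
proof -
  have "(1 / real n) * (\<Sum>j=1..n. L\<^sup>2 * trace (second_moment ** P)) = L\<^sup>2 * trace (second_moment ** P)"
    using n_pos by simp
  then show ?thesis
    unfolding sample_mean[symmetric] matrix_mul_scaleR_left matrix_mul_scaleR_right trace_scaleR
      matrix_mul_sum_left matrix_mul_sum_right trace_sum sum.distrib sum_subtractf
    by (simp add: sum_distrib_left[symmetric] algebra_simps)
qed

text \<open>S commutes with its cosh, so S cosh(\<theta> S) = S + r with r = S (cosh(\<theta> S) -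
  I). The coefficient of these terms is D = L^2 I - 2 E; the trace of D S is left for the
  integration to remove, and that of D r is bounded through S sinh(\<theta> S).\<close>

lemma conditional_variance_bound:
  assumes \<theta>: "\<theta> \<ge> 0" and e: "\<And>b. norm b = 1 \<Longrightarrow> b \<bullet> (second_moment *v b) \<le> e"
  shows "L\<^sup>2 * trace ((deviation \<omega> + second_moment) ** coshS \<theta> \<omega>) + L\<^sup>2 * trace (second_moment ** coshS \<theta> \<omega>)
      - trace (second_moment ** (coshS \<theta> \<omega> ** (deviation \<omega> + second_moment)))
      - trace (second_moment ** ((deviation \<omega> + second_moment) ** coshS \<theta> \<omega>)) \<le>
    2 * L\<^sup>2 * (trace second_moment + e * trace (matrix_fun (\<lambda>s. cosh (\<theta> * s) - 1) (deviation \<omega>)))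
    + L\<^sup>2 * trace (matrix_fun (\<lambda>s. s * sinh (\<theta> * s)) (deviation \<omega>))
    + trace ((L\<^sup>2 *\<^sub>R mat 1 - 2 *\<^sub>R second_moment) ** deviation \<omega>)"
proof -
  let ?E = second_moment and ?p = "coshS \<theta> \<omega>" and ?S = "deviation \<omega>"
  let ?r = "matrix_fun (\<lambda>s. s * (cosh (\<theta> * s) - 1)) ?S" and ?q = "matrix_fun (\<lambda>s. cosh (\<theta> * s) - 1) ?S"
  let ?D = "L\<^sup>2 *\<^sub>R mat 1 - 2 *\<^sub>R ?E"
  have Sp: "?S ** ?p = ?S + ?r" "?p ** ?S = ?S + ?r"
    by (simp_all add: deviation_mult_matrix_fun right_diff_distrib matrix_fun_diff matrix_fun_id[OF deviation_symmetric])
  have p: "?p = mat 1 + ?q"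
    by (simp add: matrix_fun_diff matrix_fun_one[OF deviation_symmetric])
  \<comment> \<open>The terms quadratic in E enter with a minus sign, so nonnegativity is enough to
    drop them.\<close>
  have EpE: "0 \<le> trace (?E ** (?E ** ?p))"
    unfolding matrix_mul_assoc trace_mult_matrix_fun
  proof (intro sum_nonneg mult_nonneg_nonneg)
    fix b
    have "b \<bullet> ((?E ** ?E) *v b) = (?E *v b) \<bullet> (?E *v b)"
      by (simp add: symmetric_inner[OF second_moment_symmetric] flip: matrix_vector_mul_assoc)
    then show "0 \<le> b \<bullet> ((?E ** ?E) *v b)" by simp
  qed (simp add: cosh_real_nonneg)
  have "trace (?E ** (?p ** ?E)) = trace (?E ** (?E ** ?p))"
    by (simp only: trace_mul_sym[of ?E "?p ** ?E"] matrix_mul_assoc[symmetric] trace_mul_sym[of ?p "?E ** ?E"])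
  then have EpE': "0 \<le> trace (?E ** (?p ** ?E))" using EpE by simp
  have "trace (?D ** ?r) \<le> L\<^sup>2 * trace (matrix_fun (\<lambda>s. s * sinh (\<theta> * s)) ?S)"
    unfolding trace_mult_matrix_fun trace_matrix_fun[OF deviation_symmetric] sum_distrib_left
  proof (intro sum_mono)
    fix b assume "b \<in> eigenvectors ?S"
    then have b: "norm b = 1" by (rule eigenbasis_norm[OF eigenbasis_eigenvectors[OF deviation_symmetric]])
    let ?s = "b \<bullet> (?S *v b)"
    have "b \<bullet> (?D *v b) = L\<^sup>2 - 2 * (b \<bullet> (?E *v b))"
      using b by (simp add: matrix_vector_mult_diff_rdistrib scaleR_matrix_vector_assoc[symmetric] inner_diff_right norm_eq_1)
    \<comment> \<open>The value L^2 - 2 (b \<bullet> E b) lies in [-L^2, L^2] because b \<bullet> E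
      b lies in [0, L^2].\<close>
    then have D: "\<bar>b \<bullet> (?D *v b)\<bar> \<le> L\<^sup>2" using second_moment_bounds[of b] b by (simp add: abs_le_iff)
    have "?s * (cosh (\<theta> * ?s) - 1) * (b \<bullet> (?D *v b)) \<le> \<bar>?s * (cosh (\<theta> * ?s) - 1)\<bar> * \<bar>b \<bullet> (?D *v b)\<bar>"
      by (simp only: abs_mult[symmetric] abs_ge_self)
    also have "\<dots> \<le> (?s * sinh (\<theta> * ?s)) * L\<^sup>2"
      by (intro mult_mono D abs_mult_cosh_minus_1_le \<theta> order_trans[OF abs_ge_zero abs_mult_cosh_minus_1_le[OF \<theta>]]) simp
    finally show "?s * (cosh (\<theta> * ?s) - 1) * (b \<bullet> (?D *v b)) \<le> L\<^sup>2 * (?s * sinh (\<theta> * ?s))" by (simp add: mult.commute)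
  qed
  then have Dr: "L\<^sup>2 * trace ?r - 2 * trace (?E ** ?r) \<le> L\<^sup>2 * trace (matrix_fun (\<lambda>s. s * sinh (\<theta> * s)) ?S)"
    by (simp add: matrix_sub_rdistrib trace_sub matrix_mul_scaleR_left trace_scaleR)
  have "trace (?E ** ?q) \<le> e * trace ?q"
    by (rule trace_mult_psd_mono) (use e cosh_real_ge_1 in auto)
  then have "trace (?E ** ?p) \<le> trace ?E + e * trace ?q"
    by (simp add: p matrix_add_ldistrib trace_add)
  then have Ep: "2 * L\<^sup>2 * trace (?E ** ?p) \<le> 2 * L\<^sup>2 * (trace ?E + e * trace ?q)"
    by (rule mult_left_mono) simp
  \<comment> \<open>P and R stay generic so that the expansion sees them as atoms, with the two
    product rules as the only relations.\<close>
  have "L\<^sup>2 * trace ((?S + ?E) ** P) + L\<^sup>2 * trace (?E ** P)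
      - trace (?E ** (P ** (?S + ?E))) - trace (?E ** ((?S + ?E) ** P)) =
     2 * L\<^sup>2 * trace (?E ** P) + L\<^sup>2 * (trace ?S + trace R) - 2 * (trace (?E ** ?S) + trace (?E ** R))
      - trace (?E ** (P ** ?E)) - trace (?E ** (?E ** P))"
    if "?S ** P = ?S + R" "P ** ?S = ?S + R" for P R
    by (simp add: matrix_add_rdistrib matrix_add_ldistrib trace_add that algebra_simps)
  note this[OF Sp]
  moreover have "trace (?D ** ?S) = L\<^sup>2 * trace ?S - 2 * trace (?E ** ?S)"
    by (simp add: matrix_sub_rdistrib trace_sub matrix_mul_scaleR_left trace_scaleR)
  ultimately show ?thesis using Ep Dr EpE EpE' by (simp add: algebra_simps)
qed

text \<open>The occurrence of \<open>sinh_trace\<close> on the right is absorbed later, which is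
  possible while \<theta> L^2/(2n) < 1.\<close>

lemma sinh_trace_le:
  assumes \<theta>: "\<theta> > 0" and e: "\<And>b. norm b = 1 \<Longrightarrow> b \<bullet> (second_moment *v b) \<le> e"
  shows "sinh_trace \<theta> \<le> \<theta> / (2 * n) * (2 * L\<^sup>2 * (trace second_moment + e * cosh_trace \<theta>) + L\<^sup>2 * sinh_trace \<theta>)"
proof -
  let ?p = "coshS \<theta>"
  let ?V = "\<lambda>j \<omega>. L\<^sup>2 * trace (sample j \<omega> ** ?p \<omega>) + L\<^sup>2 * trace (second_moment ** ?p \<omega>)
      - trace (second_moment ** (?p \<omega> ** sample j \<omega>)) - trace (second_moment ** (sample j \<omega> ** ?p \<omega>))"
  have bm: "bounded_measurable samples (?V j)" if "j \<in> {1..n}" for j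
    using that by (intro bounded_measurable_intros) auto
  let ?D = "L\<^sup>2 *\<^sub>R mat 1 - 2 *\<^sub>R second_moment"
  let ?q = "\<lambda>\<omega>. matrix_fun (\<lambda>s. cosh (\<theta> * s) - 1) (deviation \<omega>)"
  let ?w = "\<lambda>\<omega>. matrix_fun (\<lambda>s. s * sinh (\<theta> * s)) (deviation \<omega>)"
  have bm1: "bounded_measurable samples (\<lambda>\<omega>. trace (?q \<omega>))"
    and bm2: "bounded_measurable samples (\<lambda>\<omega>. trace (?w \<omega>))"
    and bm3: "bounded_measurable samples (\<lambda>\<omega>. trace (?D ** deviation \<omega>))"
    by (intro bounded_measurable_intros)+
  have "sinh_trace \<theta> \<le> (1 / real n) * (\<Sum>j=1..n. \<theta> / (2 * n) * (LINT \<omega>|samples. ?V j \<omega>))"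
    unfolding sinh_trace_eq
  proof (intro mult_left_mono sum_mono)
    fix j assume j: "j \<in> {1..n}"
    show "(LINT \<omega>|samples. trace ((sample j \<omega> - sample 0 \<omega>) ** sinhS \<theta> \<omega>)) \<le> \<theta> / (2 * n) * (LINT \<omega>|samples. ?V j \<omega>)"
      by (rule order_trans[OF symmetrization[OF j \<theta>] mult_left_mono[OF conditional_variance[OF j]]]) (use \<theta> in simp)
  qed simp
  also have "\<dots> = \<theta> / (2 * n) * ((1 / real n) * (\<Sum>j=1..n. LINT \<omega>|samples. ?V j \<omega>))"
    by (simp only: sum_distrib_left[symmetric] mult.left_commute)
  also have "(1 / real n) * (\<Sum>j=1..n. LINT \<omega>|samples. ?V j \<omega>) = (LINT \<omega>|samples. (1 / real n) * (\<Sum>j=1..n. ?V j \<omega>))"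
    by (simp only: integral_mult_right_zero Bochner_Integration.integral_sum[OF integrable_samples[OF bm]])
  also have "\<theta> / (2 * n) * (LINT \<omega>|samples. (1 / real n) * (\<Sum>j=1..n. ?V j \<omega>)) \<le>
    \<theta> / (2 * n) * (LINT \<omega>|samples. 2 * L\<^sup>2 * (trace second_moment + e * trace (?q \<omega>)) + L\<^sup>2 * trace (?w \<omega>) + trace (?D ** deviation \<omega>))"
  proof (intro mult_left_mono integral_mono)
    show "integrable samples (\<lambda>\<omega>. (1 / real n) * (\<Sum>j=1..n. ?V j \<omega>))"
      by (intro integrable_samples bounded_measurable_cmult bounded_measurable_sum bm)
    show "integrable samples (\<lambda>\<omega>. 2 * L\<^sup>2 * (trace second_moment + e * trace (?q \<omega>)) + L\<^sup>2 * trace (?w \<omega>) + trace (?D ** deviation \<omega>))"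
      by (intro integrable_samples bounded_measurable_add bounded_measurable_cmult bounded_measurable_const bm1 bm2 bm3)
    show "(1 / real n) * (\<Sum>j=1..n. ?V j \<omega>) \<le>
      2 * L\<^sup>2 * (trace second_moment + e * trace (?q \<omega>)) + L\<^sup>2 * trace (?w \<omega>) + trace (?D ** deviation \<omega>)" for \<omega>
      unfolding conditional_variance_mean using \<theta> by (intro conditional_variance_bound e) auto
  qed (use \<theta> in simp)
  \<comment> \<open>The last summand integrates to zero because S is centred; the written 0 is that
    integral.\<close>
  also have "(LINT \<omega>|samples. 2 * L\<^sup>2 * (trace second_moment + e * trace (?q \<omega>)) + L\<^sup>2 * trace (?w \<omega>) + trace (?D ** deviation \<omega>)) =
      2 * L\<^sup>2 * (trace second_moment + e * cosh_trace \<theta>) + L\<^sup>2 * sinh_trace \<theta> + 0"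
    unfolding cosh_trace_def sinh_trace_def integral_trace_deviation[of ?D, symmetric]
    by (simp add: integrable_samples[OF bm1] integrable_samples[OF bm2] integrable_samples[OF bm3] prod.P.prob_space)
  finally show ?thesis by simp
qed

text \<open>Differentiation under the integral by a quadratic remainder bound uniform in the sample,
  since all deviations share a norm bound R. The ambient dimension enters only this remainder, not
  the derivative.\<close>

lemma cosh_trace_has_derivative: "(cosh_trace has_real_derivative sinh_trace \<theta>) (at \<theta>)"
proof -
  obtain R where R: "\<And>\<omega>. norm (deviation \<omega>) \<le> R"
    using bounded_measurable_deviation by (auto simp: bounded_measurable_def bounded_iff)
  have R0: "R \<ge> 0" using R norm_ge_zero order_trans by blast
  let ?q = "\<lambda>\<theta> \<omega>. trace (matrix_fun (\<lambda>s. cosh (\<theta> * s) - 1) (deviation \<omega>))"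
  let ?w = "\<lambda>\<omega>. trace (matrix_fun (\<lambda>s. s * sinh (\<theta> * s)) (deviation \<omega>))"
  define K where "K = real CARD('m) * (cosh ((\<bar>\<theta>\<bar> + 1) * R) * R\<^sup>2)"
  have K0: "K \<ge> 0" by (simp add: K_def cosh_real_nonneg)
  have bound: "\<bar>?q (\<theta> + h) \<omega> - ?q \<theta> \<omega> - h * ?w \<omega>\<bar> \<le> K * h\<^sup>2" if h: "\<bar>h\<bar> \<le> 1" for h \<omega>
  proof -
    note sym = deviation_symmetric[of \<omega>]
    \<comment> \<open>The trace of the identity counts the basis.\<close>
    have card: "real (card (eigenvectors (deviation \<omega>))) = real CARD('m)"
      using trace_matrix_fun[OF sym, of "\<lambda>s. 1"] by (simp add: matrix_fun_one[OF sym] trace_I)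
    have "\<bar>?q (\<theta> + h) \<omega> - ?q \<theta> \<omega> - h * ?w \<omega>\<bar> =
      \<bar>\<Sum>b\<in>eigenvectors (deviation \<omega>). (let s = b \<bullet> (deviation \<omega> *v b) in
         cosh ((\<theta> + h) * s) - cosh (\<theta> * s) - ((\<theta> + h) * s - \<theta> * s) * sinh (\<theta> * s))\<bar>"
      unfolding trace_matrix_fun[OF sym] sum_distrib_left sum_subtractf[symmetric] Let_def
      by (intro arg_cong[where f = abs] sum.cong refl) (simp add: algebra_simps)
    also have "\<dots> \<le> (\<Sum>b\<in>eigenvectors (deviation \<omega>). cosh ((\<bar>\<theta>\<bar> + 1) * R) * R\<^sup>2 * h\<^sup>2)"
    proof (rule order_trans[OF sum_abs], rule sum_mono)
      fix b assume "b \<in> eigenvectors (deviation \<omega>)"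
      then have b: "norm b = 1" by (rule eigenbasis_norm[OF eigenbasis_eigenvectors[OF sym]])
      define s where "s = b \<bullet> (deviation \<omega> *v b)"
      have s: "\<bar>s\<bar> \<le> R" unfolding s_def by (rule order_trans[OF quadratic_form_le_norm[OF b] R])
      \<comment> \<open>One bound covers both arguments because |h| \<le> 1.\<close>
      have "\<bar>\<theta> * s\<bar> \<le> (\<bar>\<theta>\<bar> + 1) * R" "\<bar>(\<theta> + h) * s\<bar> \<le> (\<bar>\<theta>\<bar> + 1) * R"
        unfolding abs_mult using s h R0 by (intro mult_mono; linarith)+
      from cosh_taylor_bound[OF this]
      have "\<bar>cosh ((\<theta> + h) * s) - cosh (\<theta> * s) - ((\<theta> + h) * s - \<theta> * s) * sinh (\<theta> * s)\<bar> \<le>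
        cosh ((\<bar>\<theta>\<bar> + 1) * R) * ((\<theta> + h) * s - \<theta> * s)\<^sup>2" .
      also have "((\<theta> + h) * s - \<theta> * s)\<^sup>2 = s\<^sup>2 * h\<^sup>2" by (simp add: power2_eq_square algebra_simps)
      also have "cosh ((\<bar>\<theta>\<bar> + 1) * R) * (s\<^sup>2 * h\<^sup>2) \<le> cosh ((\<bar>\<theta>\<bar> + 1) * R) * (R\<^sup>2 * h\<^sup>2)"
        using s R0 by (intro mult_left_mono mult_right_mono cosh_real_nonneg) (simp_all add: power2_le_iff_abs_le)
      finally show "\<bar>let s = b \<bullet> (deviation \<omega> *v b) in
         cosh ((\<theta> + h) * s) - cosh (\<theta> * s) - ((\<theta> + h) * s - \<theta> * s) * sinh (\<theta> * s)\<bar> \<le>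
         cosh ((\<bar>\<theta>\<bar> + 1) * R) * R\<^sup>2 * h\<^sup>2" by (simp add: Let_def s_def mult.assoc)
    qed
    also have "\<dots> = K * h\<^sup>2" by (simp add: K_def card)
    finally show ?thesis .
  qed
  have int: "\<bar>cosh_trace (\<theta> + h) - cosh_trace \<theta> - h * sinh_trace \<theta>\<bar> \<le> K * h\<^sup>2" if h: "\<bar>h\<bar> \<le> 1" for h
  proof -
    have bq: "integrable samples (?q \<theta>')" for \<theta>' by (intro integrable_samples bounded_measurable_intros)
    have bw: "integrable samples ?w" by (intro integrable_samples bounded_measurable_intros)
    have i: "integrable samples (\<lambda>\<omega>. ?q (\<theta> + h) \<omega> - ?q \<theta> \<omega> - h * ?w \<omega>)" by (intro Bochner_Integration.integrable_diff bq integrable_mult_right bw)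
    have eq: "cosh_trace (\<theta> + h) - cosh_trace \<theta> - h * sinh_trace \<theta> = (LINT \<omega>|samples. ?q (\<theta> + h) \<omega> - ?q \<theta> \<omega> - h * ?w \<omega>)"
      unfolding cosh_trace_def sinh_trace_def by (simp add: bq bw)
    have "\<bar>cosh_trace (\<theta> + h) - cosh_trace \<theta> - h * sinh_trace \<theta>\<bar> \<le> (LINT \<omega>|samples. \<bar>?q (\<theta> + h) \<omega> - ?q \<theta> \<omega> - h * ?w \<omega>\<bar>)"
      unfolding eq by (rule integral_abs_bound)
    also have "\<dots> \<le> (LINT \<omega>|samples. K * h\<^sup>2)"
    proof (rule integral_mono)
      show "integrable samples (\<lambda>\<omega>. \<bar>?q (\<theta> + h) \<omega> - ?q \<theta> \<omega> - h * ?w \<omega>\<bar>)"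
        by (rule integrable_abs) (rule i)
      show "\<bar>?q (\<theta> + h) \<omega> - ?q \<theta> \<omega> - h * ?w \<omega>\<bar> \<le> K * h\<^sup>2" for \<omega>
        by (rule bound) (rule h)
    qed simp
    finally show ?thesis by (simp add: prod.P.prob_space)
  qed
  show ?thesis
    unfolding DERIV_def
  proof (rule LIM_zero_cancel, rule Lim_null_comparison)
    show "((\<lambda>h. K * \<bar>h\<bar>) \<longlongrightarrow> 0) (at 0)"
      by (intro tendsto_mult_right_zero tendsto_rabs_zero tendsto_ident_at)
    have "\<forall>\<^sub>F h in at (0::real). \<bar>h\<bar> < 1 \<and> h \<noteq> 0"
      unfolding eventually_at by (intro exI[of _ 1]) auto
    then show "\<forall>\<^sub>F h in at 0. norm ((cosh_trace (\<theta> + h) - cosh_trace \<theta>) / h - sinh_trace \<theta>) \<le> K * \<bar>h\<bar>"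
    proof eventually_elim
      case (elim h)
      have "(cosh_trace (\<theta> + h) - cosh_trace \<theta>) / h - sinh_trace \<theta> =
        (cosh_trace (\<theta> + h) - cosh_trace \<theta> - h * sinh_trace \<theta>) / h" using elim by (simp add: field_simps)
      then have "norm ((cosh_trace (\<theta> + h) - cosh_trace \<theta>) / h - sinh_trace \<theta>) =
        \<bar>cosh_trace (\<theta> + h) - cosh_trace \<theta> - h * sinh_trace \<theta>\<bar> / \<bar>h\<bar>" by (simp add: abs_divide)
      also have "\<dots> \<le> K * h\<^sup>2 / \<bar>h\<bar>" using int[of h] elim by (intro divide_right_mono) auto
      also have "\<dots> = K * \<bar>h\<bar>" using elim by (simp add: power2_eq_square abs_if)
      finally show ?case .
    qed
  qed
qed

section \<open>Gronwall's lemma and Markov's inequality\<close>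

lemma cosh_trace_nonneg: "0 \<le> cosh_trace \<theta>"
  unfolding cosh_trace_def trace_matrix_fun[OF deviation_symmetric]
  by (intro Bochner_Integration.integral_nonneg sum_nonneg) (simp add: cosh_real_ge_1)

lemma trace_second_moment_nonneg: "0 \<le> trace second_moment"
proof -
  have "trace second_moment = (LINT x|\<mu>. trace (outer_square (g x)))"
    by (rule integral_linear_outer_square[OF bounded_linear_trace, symmetric])
  also have "0 \<le> \<dots>"
  proof (rule Bochner_Integration.integral_nonneg)
    show "0 \<le> trace (outer_square (g x))" for x
      using trace_mult_outer_square[of "mat 1" "g x"] by simp
  qed
  finally show ?thesis .
qed

text \<open>With y = tr E + e c the inequality reads y' \<le> \<kappa> \<theta> y, so y
  exp(-\<kappa> \<theta>^2/2) is nonincreasing. Since c(0) = 0, the start value is tr E, and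
  division by e leaves tr E / e as the only dimensional factor.\<close>

lemma cosh_trace_bound:
  assumes e: "e > 0" "\<And>b. norm b = 1 \<Longrightarrow> b \<bullet> (second_moment *v b) \<le> e"
    and T: "T > 0" "T * L\<^sup>2 / (2 * n) < 1"
  shows "cosh_trace T \<le> trace second_moment / e *
    (exp (L\<^sup>2 / n * e / (1 - T * L\<^sup>2 / (2 * n)) * T\<^sup>2 / 2) - 1)"
proof -
  define \<beta> q \<kappa> tE where "\<beta> = L\<^sup>2 / n" and "q = 1 - T * L\<^sup>2 / (2 * n)" and "\<kappa> = \<beta> * e / q" and "tE = trace second_moment"
  have q: "q > 0" "q = 1 - T * \<beta> / 2" using T by (simp_all add: q_def \<beta>_def)
  have \<beta>: "\<beta> \<ge> 0" by (simp add: \<beta>_def)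
  let ?y = "\<lambda>\<theta>. tE + e * cosh_trace \<theta>"
  have y0: "?y \<theta> \<ge> 0" for \<theta> using trace_second_moment_nonneg cosh_trace_nonneg[of \<theta>] e(1) by (simp add: tE_def)
  have ode: "e * sinh_trace \<theta> \<le> \<kappa> * \<theta> * ?y \<theta>" if \<theta>: "0 \<le> \<theta>" "\<theta> \<le> T" for \<theta>
  proof (cases "\<theta> = 0")
    case True
    then show ?thesis by (simp add: sinh_trace_def trace_matrix_fun[OF deviation_symmetric])
  next
    case False
    then have "\<theta> > 0" using \<theta> by simp
    have "sinh_trace \<theta> \<le> \<theta> / (2 * n) * (2 * L\<^sup>2 * (trace second_moment + e * cosh_trace \<theta>) + L\<^sup>2 * sinh_trace \<theta>)"
      by (rule sinh_trace_le[OF \<open>\<theta> > 0\<close> e(2)])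
    also have "\<dots> = \<theta> * \<beta> * ?y \<theta> + \<theta> * \<beta> / 2 * sinh_trace \<theta>"
      using n_pos by (simp add: \<beta>_def tE_def field_simps)
    finally have *: "(1 - \<theta> * \<beta> / 2) * sinh_trace \<theta> \<le> \<theta> * \<beta> * ?y \<theta>" by (simp add: algebra_simps)
    \<comment> \<open>The absorbing coefficient is smallest at \<theta> = T; its value q there makes
      \<kappa> constant on the whole interval.\<close>
    have q': "q \<le> 1 - \<theta> * \<beta> / 2" unfolding q(2) using \<theta> \<beta> by (simp add: mult_right_mono)
    have "sinh_trace \<theta> \<le> \<theta> * \<beta> * ?y \<theta> / (1 - \<theta> * \<beta> / 2)"
      using * q' q(1) by (simp add: pos_le_divide_eq mult.commute)
    also have "\<dots> \<le> \<theta> * \<beta> * ?y \<theta> / q"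
      using q' q(1) \<theta> \<beta> y0[of \<theta>] by (intro divide_left_mono mult_nonneg_nonneg mult_pos_pos) auto
    finally have "e * sinh_trace \<theta> \<le> e * (\<theta> * \<beta> * ?y \<theta> / q)" using e(1) by (intro mult_left_mono) auto
    then show ?thesis by (simp add: \<kappa>_def mult_ac)
  qed
  have "?y T * exp (- (\<kappa> * T\<^sup>2 / 2)) \<le> ?y 0 * exp (- (\<kappa> * 0\<^sup>2 / 2))"
  proof (rule DERIV_nonpos_imp_nonincreasing[of 0 T "\<lambda>\<theta>. ?y \<theta> * exp (- (\<kappa> * \<theta>\<^sup>2 / 2))"])
    fix \<theta> assume \<theta>: "0 \<le> \<theta>" "\<theta> \<le> T"
    have "((\<lambda>\<theta>. ?y \<theta> * exp (- (\<kappa> * \<theta>\<^sup>2 / 2))) has_real_derivative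
        (e * sinh_trace \<theta> - \<kappa> * \<theta> * ?y \<theta>) * exp (- (\<kappa> * \<theta>\<^sup>2 / 2))) (at \<theta>)"
      by (auto intro!: derivative_eq_intros cosh_trace_has_derivative simp: algebra_simps)
    moreover have "(e * sinh_trace \<theta> - \<kappa> * \<theta> * ?y \<theta>) * exp (- (\<kappa> * \<theta>\<^sup>2 / 2)) \<le> 0"
      using ode[OF \<theta>] by (intro mult_nonpos_nonneg) auto
    ultimately show "\<exists>y. ((\<lambda>\<theta>. ?y \<theta> * exp (- (\<kappa> * \<theta>\<^sup>2 / 2))) has_real_derivative y) (at \<theta>) \<and> y \<le> 0" by blast
  qed (use T in simp)
  moreover have "cosh_trace 0 = 0" by (simp add: cosh_trace_def trace_matrix_fun[OF deviation_symmetric])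
  ultimately have "?y T * exp (- (\<kappa> * T\<^sup>2 / 2)) \<le> tE" by simp
  then have "?y T * exp (- (\<kappa> * T\<^sup>2 / 2)) * exp (\<kappa> * T\<^sup>2 / 2) \<le> tE * exp (\<kappa> * T\<^sup>2 / 2)"
    by (rule mult_right_mono) simp
  then have "?y T \<le> tE * exp (\<kappa> * T\<^sup>2 / 2)" by (simp add: mult.assoc flip: exp_add)
  then have "cosh_trace T \<le> tE / e * (exp (\<kappa> * T\<^sup>2 / 2) - 1)" using e(1) by (simp add: field_simps)
  then show ?thesis by (simp add: \<kappa>_def \<beta>_def q_def tE_def)
qed

lemma deviation_tail:
  assumes e: "e > 0" "\<And>b. norm b = 1 \<Longrightarrow> b \<bullet> (second_moment *v b) \<le> e"
    and T: "T > 0" "T * L\<^sup>2 / (2 * n) < 1" and t: "t > 0"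
  shows "measure samples {\<omega> \<in> space samples. cosh (T * t) - 1 \<le> trace (matrix_fun (\<lambda>s. cosh (T * s) - 1) (deviation \<omega>))} \<le>
    trace second_moment / e * (exp (L\<^sup>2 / n * e / (1 - T * L\<^sup>2 / (2 * n)) * T\<^sup>2 / 2) - 1) / (cosh (T * t) - 1)"
proof -
  have c: "cosh (T * t) - 1 > 0" using T(1) t cosh_real_strict_mono[of 0 "T * t"] by simp
  have "measure samples {\<omega> \<in> space samples. trace (matrix_fun (\<lambda>s. cosh (T * s) - 1) (deviation \<omega>)) \<ge> cosh (T * t) - 1} \<le>
      (LINT \<omega>|samples. trace (matrix_fun (\<lambda>s. cosh (T * s) - 1) (deviation \<omega>))) / (cosh (T * t) - 1)"
  proof (rule integral_Markov_inequality_measure[where A = "{}"])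
    show "integrable samples (\<lambda>\<omega>. trace (matrix_fun (\<lambda>s. cosh (T * s) - 1) (deviation \<omega>)))"
      by (intro integrable_samples bounded_measurable_intros)
    show "AE \<omega> in samples. 0 \<le> trace (matrix_fun (\<lambda>s. cosh (T * s) - 1) (deviation \<omega>))"
      by (intro AE_I2) (simp add: trace_matrix_fun[OF deviation_symmetric] sum_nonneg cosh_real_ge_1)
  qed (use c in auto)
  also have "\<dots> \<le> trace second_moment / e * (exp (L\<^sup>2 / n * e / (1 - T * L\<^sup>2 / (2 * n)) * T\<^sup>2 / 2) - 1) / (cosh (T * t) - 1)"
    using cosh_trace_bound[OF e T] c unfolding cosh_trace_def by (intro divide_right_mono) auto
  finally show ?thesis .
qed

text \<open>All summands of the trace of cosh(T S) - I are nonnegative, so an eigenvalue beyond t in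
  modulus would alone reach cosh(T t) - 1. This is the reason for that threshold in the Markov
  step.\<close>

lemma deviation_norm_le:
  assumes T: "T > 0" and t: "t > 0"
    and small: "trace (matrix_fun (\<lambda>s. cosh (T * s) - 1) (deviation \<omega>)) < cosh (T * t) - 1"
  shows "norm (deviation \<omega> *v x) \<le> t * norm x"
proof -
  let ?B = "eigenvectors (deviation \<omega>)"
  note B = eigenbasis_eigenvectors[OF deviation_symmetric, of \<omega>]
  have s: "\<bar>b \<bullet> (deviation \<omega> *v b)\<bar> \<le> t" if "b \<in> ?B" for b
  proof (rule ccontr)
    let ?s = "b \<bullet> (deviation \<omega> *v b)"
    assume "\<not> \<bar>?s\<bar> \<le> t"
    then have "T * t \<le> T * \<bar>?s\<bar>" using T by simp
    then have "cosh (T * t) \<le> cosh (T * \<bar>?s\<bar>)" using T t by (subst cosh_real_nonneg_le_iff) auto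
    also have "\<dots> = cosh (T * ?s)" by (cases "?s \<ge> 0") simp_all
    finally have "cosh (T * t) - 1 \<le> cosh (T * ?s) - 1" by simp
    also have "\<dots> \<le> (\<Sum>b\<in>?B. cosh (T * (b \<bullet> (deviation \<omega> *v b))) - 1)"
      using that eigenbasis_finite[OF B] by (intro member_le_sum[of b ?B "\<lambda>b. cosh (T * (b \<bullet> (deviation \<omega> *v b))) - 1"]) (auto simp: cosh_real_ge_1)
    finally show False using small by (simp add: trace_matrix_fun[OF deviation_symmetric])
  qed
  have nrm: "(norm y)\<^sup>2 = (\<Sum>b\<in>?B. (y \<bullet> b)\<^sup>2)" for y
    using eigenbasis_parseval[OF B, of y y] by (simp add: power2_norm_eq_inner power2_eq_square[of "_ \<bullet> _"])
  have "(norm (deviation \<omega> *v x))\<^sup>2 \<le> (t * norm x)\<^sup>2"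
    unfolding power_mult_distrib nrm sum_distrib_left
  proof (rule sum_mono)
    fix b assume b: "b \<in> ?B"
    have "(deviation \<omega> *v x) \<bullet> b = (b \<bullet> (deviation \<omega> *v b)) * (x \<bullet> b)"
      unfolding symmetric_inner[OF deviation_symmetric] by (subst eigenbasis_apply[OF B b]) simp
    moreover have "(b \<bullet> (deviation \<omega> *v b))\<^sup>2 \<le> t\<^sup>2" using s[OF b] t by (simp add: power2_le_iff_abs_le)
    ultimately show "((deviation \<omega> *v x) \<bullet> b)\<^sup>2 \<le> t\<^sup>2 * (x \<bullet> b)\<^sup>2"
      by (simp add: power_mult_distrib mult_right_mono)
  qed
  then show ?thesis using t by (simp add: power2_le_iff_abs_le)
qed

end

text \<open>With K = ln(4 d/\<delta>) and Q \<ge> 4K/3, the net exponent is 8Q/7 - 2Q = -6Q/7 \<le>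
  -8K/7 \<le> -K. The 8/7 is the value of 1/(1 - \<epsilon>/2) at \<epsilon> = 1/4.\<close>

lemma tail_constant_bound:
  fixes d \<delta> Q :: real
  assumes d: "d \<ge> 1" and \<delta>: "0 < \<delta>" "\<delta> < 1" and Q: "Q \<ge> 4 / 3 * ln (4 / \<delta> * d)"
  shows "d * (exp (8 / 7 * Q) - 1) / (cosh (2 * Q) - 1) \<le> \<delta>"
proof -
  define K where "K = ln (4 / \<delta> * d)"
  have expK: "exp K = 4 / \<delta> * d" using d \<delta> by (simp add: K_def)
  have "4 * 1 \<le> 4 / \<delta> * d" using d \<delta> by (intro mult_mono) (auto simp: field_simps)
  then have K4: "exp K \<ge> 4" by (simp add: expK)
  then have K0: "K > 0" using exp_le_one_iff[of K] by linarith
  have Q: "Q \<ge> 4 / 3 * K" using Q by (simp add: K_def)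
  have "exp K * exp K \<ge> 4 * 4" using K4 by (intro mult_mono) auto
  moreover have "exp (K + K) \<le> exp (2 * Q)" using Q K0 by simp
  \<comment> \<open>Since exp(2Q) \<ge> 16, subtracting 1 costs at most exp(2Q)/16, and 1/2 - 1/16 =
    7/16.\<close>
  ultimately have e16: "16 \<le> exp (2 * Q)" unfolding exp_add by linarith
  have c: "cosh (2 * Q) - 1 \<ge> 7 / 16 * exp (2 * Q)"
  proof -
    have cosh: "cosh (2 * Q) = (exp (2 * Q) + exp (- (2 * Q))) / 2" by (simp add: cosh_def)
    have *: "7 / 16 * a \<le> (a + b) / 2 - 1" if "16 \<le> a" "0 < b" for a b :: real
      using that unfolding add_divide_distrib by linarith
    show ?thesis unfolding cosh by (rule *[OF e16]) simp
  qed
  have "d * (exp (8 / 7 * Q) - 1) / (cosh (2 * Q) - 1) \<le> d * exp (8 / 7 * Q) / (7 / 16 * exp (2 * Q))"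
    using c d K0 Q by (intro frac_le) auto
  also have "\<dots> = 16 / 7 * d * exp (8 / 7 * Q - 2 * Q)" by (subst exp_diff) simp
  also have "\<dots> \<le> 16 / 7 * d * exp (- K)" using d Q K0 by (intro mult_left_mono) auto
  also have "\<dots> = 4 / 7 * \<delta>" using d \<delta> by (simp add: exp_minus expK field_simps)
  also have "\<dots> \<le> \<delta>" using \<delta> by simp
  finally show ?thesis .
qed

section \<open>Probability of the perturbation event\<close>

text \<open>A condition stable under small changes of Y is the preimage of a union of balls. The
  predicate itself may involve nonmeasurable choices.\<close>

lemma locally_open_preimage_measurable:
  fixes Y :: "'w \<Rightarrow> 'b::metric_space"
  assumes Y: "Y \<in> borel_measurable M" and Q: "Q \<subseteq> space M"
    and loc: "\<And>\<omega>. \<omega> \<in> Q \<Longrightarrow> \<exists>r>0. \<forall>\<omega>'\<in>space M. dist (Y \<omega>) (Y \<omega>') < r \<longrightarrow> \<omega>' \<in> Q"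
  shows "Q \<in> sets M"
proof -
  obtain r where r: "\<And>\<omega>. \<omega> \<in> Q \<Longrightarrow> r \<omega> > 0"
      "\<And>\<omega> \<omega>'. \<omega> \<in> Q \<Longrightarrow> \<omega>' \<in> space M \<Longrightarrow> dist (Y \<omega>) (Y \<omega>') < r \<omega> \<Longrightarrow> \<omega>' \<in> Q"
    using loc by metis
  define U where "U = (\<Union>\<omega>\<in>Q. ball (Y \<omega>) (r \<omega>))"
  have "Q = Y -` U \<inter> space M"
  proof (intro equalityI subsetI)
    fix \<omega> assume "\<omega> \<in> Q"
    then show "\<omega> \<in> Y -` U \<inter> space M" using r(1) Q unfolding U_def by (auto intro!: bexI[of _ \<omega>])
  next
    fix \<omega>' assume "\<omega>' \<in> Y -` U \<inter> space M"
    then show "\<omega>' \<in> Q" using r(2) by (auto simp: U_def)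
  qed
  moreover have "open U" unfolding U_def by auto
  ultimately show ?thesis using measurable_sets[OF Y borel_open] by metis
qed

context rank_one_samples
begin

text \<open>On a rank-one square the Frobenius norm equals the trace, and the norm of an integral is
  at most the integral of the norm. As the spectral norm is below the Frobenius norm, the intrinsic
  dimension is at least 1.\<close>

lemma norm_second_moment_le_trace: "norm second_moment \<le> trace second_moment"
proof -
  have "norm second_moment \<le> (LINT x|\<mu>. norm (outer_square (g x)))"
    unfolding second_moment_def by (rule integral_norm_bound)
  also have "\<dots> = (LINT x|\<mu>. trace (outer_square (g x)))"
  proof (rule Bochner_Integration.integral_cong[OF refl])
    show "norm (outer_square (g x)) = trace (outer_square (g x))" for x
      using trace_mult_outer_square[of "mat 1" "g x"] by (simp add: norm_outer_square power2_norm_eq_inner)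
  qed
  also have "\<dots> = trace second_moment" by (rule integral_linear_outer_square[OF bounded_linear_trace])
  finally show ?thesis .
qed

text \<open>The given sample has coordinates 1 to n only, while \<open>samples\<close> has the
  auxiliary coordinate 0. Restriction pushes the larger product onto the smaller one, and an event
  that ignores coordinate 0 keeps its probability.\<close>

lemma measure_samples_transfer:
  assumes N: "prob_space N" and Y: "Y \<in> measurable N (PiM {1..n} (\<lambda>_. \<mu>))"
    and distr_Y: "distr N (PiM {1..n} (\<lambda>_. \<mu>)) Y = PiM {1..n} (\<lambda>_. \<mu>)"
    and F: "{x \<in> space samples. F x} \<in> sets samples"
    and dep: "\<And>x y. (\<And>j. j \<in> {1..n} \<Longrightarrow> x j = y j) \<Longrightarrow> F x = F y"
  shows "measure N {\<omega> \<in> space N. F (Y \<omega>)} = measure samples {x \<in> space samples. F x}"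
    and "{\<omega> \<in> space N. F (Y \<omega>)} \<in> sets N"
proof -
  let ?P = "PiM {1..n} (\<lambda>_. \<mu>)"
  \<comment> \<open>Any point serves as a dummy coordinate 0; it turns the event on n + 1
    coordinates into a measurable one on n.\<close>
  obtain c where c: "c \<in> space \<mu>" using mu.not_empty by blast
  have F_upd: "F (fun_upd x 0 c) = F x" for x by (rule dep) simp
  have F_res: "F (restrict x {1..n}) = F x" for x by (rule dep) simp
  have upd: "(\<lambda>x. fun_upd x 0 c) \<in> measurable ?P samples"
    by (rule measurable_fun_upd[where J = "{1..n}"]) (use c in auto)
  have "(\<lambda>x. fun_upd x 0 c) -` {x \<in> space samples. F x} \<inter> space ?P = {x \<in> space ?P. F x}"
    using measurable_space[OF upd] by (auto simp: F_upd)
  then have FP: "{x \<in> space ?P. F x} \<in> sets ?P" using measurable_sets[OF upd F] by simp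
  have Y_eq: "Y -` {x \<in> space ?P. F x} \<inter> space N = {\<omega> \<in> space N. F (Y \<omega>)}"
    using measurable_space[OF Y] by auto
  show "{\<omega> \<in> space N. F (Y \<omega>)} \<in> sets N" using measurable_sets[OF Y FP] unfolding Y_eq .
  have res: "(\<lambda>x. restrict x {1..n}) \<in> measurable samples ?P"
    by (rule measurable_restrict_subset) auto
  have "measure N {\<omega> \<in> space N. F (Y \<omega>)} = measure ?P {x \<in> space ?P. F x}"
    using measure_distr[OF Y FP] unfolding distr_Y Y_eq by (rule sym)
  also have "\<dots> = measure (distr samples ?P (\<lambda>x. restrict x {1..n})) {x \<in> space ?P. F x}"
    by (subst prod.distr_PiM_restrict_finite) auto
  also have "\<dots> = measure samples ((\<lambda>x. restrict x {1..n}) -` {x \<in> space ?P. F x} \<inter> space samples)"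
    by (rule measure_distr[OF res FP])
  also have "(\<lambda>x. restrict x {1..n}) -` {x \<in> space ?P. F x} \<inter> space samples = {x \<in> space samples. F x}"
    using measurable_space[OF res] F_res by (auto simp del: space_PiM)
  finally show "measure N {\<omega> \<in> space N. F (Y \<omega>)} = measure samples {x \<in> space samples. F x}" .
qed

lemma sample_deviation_probability:
  assumes N: "prob_space N" and Y: "Y \<in> measurable N (PiM {1..n} (\<lambda>_. \<mu>))"
    and distr_Y: "distr N (PiM {1..n} (\<lambda>_. \<mu>)) Y = PiM {1..n} (\<lambda>_. \<mu>)"
    and e: "e > 0" "\<And>b. norm b = 1 \<Longrightarrow> b \<bullet> (second_moment *v b) \<le> e" and d: "1 \<le> trace second_moment / e"
    and L: "L > 0" and \<epsilon>: "0 < \<epsilon>" "\<epsilon> \<le> 1 / 4" and \<delta>: "0 < \<delta>" "\<delta> < 1"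
    and n_large: "n \<ge> 8 / (3 * \<epsilon>\<^sup>2) * (L\<^sup>2 / e) * ln (4 / \<delta> * (trace second_moment / e))"
  shows "\<exists>G\<in>sets N. measure N G \<ge> 1 - \<delta> \<and>
    (\<forall>\<omega>\<in>G. \<forall>x. norm (deviation (Y \<omega>) *v x) \<le> \<epsilon> * e * norm x)"
proof -
  interpret N: prob_space N by fact
  \<comment> \<open>T minimises \<open>L\<^sup>2 / n * e * T\<^sup>2 / 2 - T * t\<close>, the
    exponent without the correction factor; the two parts are then Q and 2 Q.\<close>
  define T t Q where "T = \<epsilon> * n / L\<^sup>2" and "t = \<epsilon> * e" and "Q = \<epsilon>\<^sup>2 * n * e / (2 * L\<^sup>2)"
  let ?d = "trace second_moment / e"
  let ?F = "\<lambda>x. cosh (T * t) - 1 \<le> trace (matrix_fun (\<lambda>s. cosh (T * s) - 1) (deviation x))"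
  have T: "T > 0" and t: "t > 0" using \<epsilon> e n_pos L by (simp_all add: T_def t_def)
  have Tt: "T * t = 2 * Q" by (simp add: T_def t_def Q_def power2_eq_square)
  have TL: "T * L\<^sup>2 / (2 * n) = \<epsilon> / 2" using L n_pos by (simp add: T_def)
  have TL1: "T * L\<^sup>2 / (2 * n) < 1" unfolding TL using \<epsilon> by simp
  have Q0: "Q \<ge> 0" using e by (simp add: Q_def)
  have expo: "L\<^sup>2 / n * e / (1 - T * L\<^sup>2 / (2 * n)) * T\<^sup>2 / 2 \<le> 8 / 7 * Q"
  proof -
    have "L\<^sup>2 / n * e * T\<^sup>2 / 2 = Q" using L n_pos by (simp add: T_def Q_def power2_eq_square field_simps)
    then have "L\<^sup>2 / n * e / (1 - T * L\<^sup>2 / (2 * n)) * T\<^sup>2 / 2 = Q * (1 / (1 - \<epsilon> / 2))"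
      unfolding TL by (metis (no_types, opaque_lifting) divide_divide_eq_left mult.commute times_divide_eq_right mult.right_neutral)
    also have "\<dots> \<le> Q * (8 / 7)" using \<epsilon> Q0 by (intro mult_left_mono) (auto simp: field_simps)
    finally show ?thesis by simp
  qed
  have Q: "Q \<ge> 4 / 3 * ln (4 / \<delta> * ?d)"
  proof -
    have "\<epsilon>\<^sup>2 * e / (2 * L\<^sup>2) * n \<ge> \<epsilon>\<^sup>2 * e / (2 * L\<^sup>2) * (8 / (3 * \<epsilon>\<^sup>2) * (L\<^sup>2 / e) * ln (4 / \<delta> * ?d))"
      using n_large e(1) by (intro mult_left_mono) auto
    moreover have "\<epsilon>\<^sup>2 * e / (2 * L\<^sup>2) * (8 / (3 * \<epsilon>\<^sup>2) * (L\<^sup>2 / e) * ln (4 / \<delta> * ?d)) = 4 / 3 * ln (4 / \<delta> * ?d)"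
      using e(1) L \<epsilon>(1) by simp
    moreover have "\<epsilon>\<^sup>2 * e / (2 * L\<^sup>2) * n = Q" by (simp add: Q_def)
    ultimately show ?thesis by linarith
  qed
  have c: "cosh (T * t) - 1 > 0" using T t cosh_real_strict_mono[of 0 "T * t"] by simp
  have meas: "{x \<in> space samples. ?F x} \<in> sets samples"
  proof -
    have "(\<lambda>x. trace (matrix_fun (\<lambda>s. cosh (T * s) - 1) (deviation x))) \<in> borel_measurable samples"
      by (rule borel_measurable_integrable[OF integrable_samples]) (intro bounded_measurable_intros)
    then show ?thesis by measurable
  qed
  have dep: "?F x = ?F y" if "\<And>j. j \<in> {1..n} \<Longrightarrow> x j = y j" for x y
  proof -
    have "deviation x = deviation y" using that by (simp add: deviation_def)
    then show ?thesis by simp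
  qed
  note tr = measure_samples_transfer[OF N Y distr_Y meas dep]
  have "measure N {\<omega> \<in> space N. ?F (Y \<omega>)} = measure samples {x \<in> space samples. ?F x}" by (rule tr(1))
  also have "\<dots> \<le> ?d * (exp (L\<^sup>2 / n * e / (1 - T * L\<^sup>2 / (2 * n)) * T\<^sup>2 / 2) - 1) / (cosh (T * t) - 1)"
    by (rule deviation_tail[OF e T TL1 t])
  also have "\<dots> \<le> ?d * (exp (8 / 7 * Q) - 1) / (cosh (2 * Q) - 1)"
    using expo c d unfolding Tt by (intro divide_right_mono mult_left_mono) auto
  also have "\<dots> \<le> \<delta>" by (rule tail_constant_bound[OF d \<delta> Q])
  finally have bad: "measure N {\<omega> \<in> space N. ?F (Y \<omega>)} \<le> \<delta>" .
  let ?G = "space N - {\<omega> \<in> space N. ?F (Y \<omega>)}"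
  have "measure N ?G \<ge> 1 - \<delta>" using N.prob_compl[OF tr(2)] bad by simp
  moreover have "norm (deviation (Y \<omega>) *v x) \<le> \<epsilon> * e * norm x" if "\<omega> \<in> ?G" for \<omega> x
    using deviation_norm_le[OF T t, of "Y \<omega>" x] that by (auto simp: t_def not_le)
  moreover have "?G \<in> sets N" using tr(2) by auto
  ultimately show ?thesis by blast
qed

end

text \<open>The eigenvalues and eigenvectors are arbitrary, possibly non-measurable choices; but the event
  depends only on \<open>Y\<close>, and both the gap condition and its conjunction with the reversed strict
  inequality are open conditions on \<open>Y\<close>.\<close>

lemma eigengap_event_measurable:
  fixes Y :: "'w \<Rightarrow> real ^ 'm ^ 'm"
  assumes Y: "Y \<in> borel_measurable M"
    and es: "\<And>\<omega>. \<omega> \<in> space M \<Longrightarrow> sorted_eigensystem (Y \<omega>) (l \<omega>) (w \<omega>)"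
    and k: "1 \<le> k" "k < CARD('m)"
  shows "{\<omega> \<in> space M. l \<omega> (k + 1) < l \<omega> k \<and>
     onorm (\<lambda>x. eigen_proj v {1..k} x - eigen_proj (w \<omega>) {1..k} x) \<le> c} \<in> sets M"
proof -
  let ?gap = "\<lambda>\<omega>. l \<omega> k - l \<omega> (k + 1)"
  let ?D = "\<lambda>\<omega>. onorm (\<lambda>x. eigen_proj v {1..k} x - eigen_proj (w \<omega>) {1..k} x)"
  \<comment> \<open>Within a quarter of the gap, the perturbation theorem at worst halves the gap,
    and the triangle inequality between projectors controls the drop of \<open>?D\<close>.\<close>
  have near: "?gap \<omega> / 2 \<le> ?gap \<omega>'"
      "?D \<omega> \<le> ?D \<omega>' + dist (Y \<omega>) (Y \<omega>') / (?gap \<omega> - dist (Y \<omega>) (Y \<omega>'))"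
    if \<omega>: "\<omega> \<in> space M" "\<omega>' \<in> space M" and gap: "4 * dist (Y \<omega>) (Y \<omega>') < ?gap \<omega>" for \<omega> \<omega>'
  proof -
    let ?\<eta> = "dist (Y \<omega>) (Y \<omega>')"
    have \<eta>: "norm (Y \<omega> *v x - Y \<omega>' *v x) \<le> ?\<eta> * norm x" for x
      using norm_matrix_vector_le[of "Y \<omega> - Y \<omega>'" x] by (simp add: dist_norm matrix_vector_mult_diff_rdistrib)
    have g: "?\<eta> < ?gap \<omega>" using gap zero_le_dist[of "Y \<omega>" "Y \<omega>'"] by linarith
    note pert = eigenspace_perturbation[OF es[OF \<omega>(1)] es[OF \<omega>(2)] \<eta> zero_le_dist k g]
    show "?gap \<omega> / 2 \<le> ?gap \<omega>'" using pert(2) gap by (simp add: field_simps)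
    let ?P = "eigen_proj v {1..k}" and ?P1 = "eigen_proj (w \<omega>) {1..k}" and ?P2 = "eigen_proj (w \<omega>') {1..k}"
    have "norm (?P x - ?P1 x) \<le> (?D \<omega>' + onorm (\<lambda>x. ?P1 x - ?P2 x)) * norm x" for x
    proof -
      have "norm (?P x - ?P1 x) \<le> norm (?P x - ?P2 x) + norm (?P1 x - ?P2 x)"
        using norm_triangle_ineq4[of "?P x - ?P2 x" "?P1 x - ?P2 x"] by simp
      also have "\<dots> \<le> ?D \<omega>' * norm x + onorm (\<lambda>x. ?P1 x - ?P2 x) * norm x"
        by (intro add_mono onorm[of "\<lambda>x. ?P x - ?P2 x"] onorm[of "\<lambda>x. ?P1 x - ?P2 x"] bounded_linear_sub bounded_linear_eigen_proj)
      finally show ?thesis by (simp add: distrib_right)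
    qed
    then have "?D \<omega> \<le> ?D \<omega>' + onorm (\<lambda>x. ?P1 x - ?P2 x)" by (rule onorm_le)
    then show "?D \<omega> \<le> ?D \<omega>' + ?\<eta> / (?gap \<omega> - ?\<eta>)" using pert(1) by linarith
  qed
  have Q1: "{\<omega> \<in> space M. l \<omega> (k + 1) < l \<omega> k} \<in> sets M"
  proof (rule locally_open_preimage_measurable[OF Y])
    fix \<omega> assume \<omega>: "\<omega> \<in> {\<omega> \<in> space M. l \<omega> (k + 1) < l \<omega> k}"
    show "\<exists>r>0. \<forall>\<omega>'\<in>space M. dist (Y \<omega>) (Y \<omega>') < r \<longrightarrow> \<omega>' \<in> {\<omega> \<in> space M. l \<omega> (k + 1) < l \<omega> k}"
    proof (intro exI[of _ "?gap \<omega> / 4"] conjI ballI impI)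
      fix \<omega>' assume "\<omega>' \<in> space M" "dist (Y \<omega>) (Y \<omega>') < ?gap \<omega> / 4"
      then show "\<omega>' \<in> {\<omega> \<in> space M. l \<omega> (k + 1) < l \<omega> k}"
        using near(1)[of \<omega> \<omega>'] \<omega> by (auto simp: field_simps)
    qed (use \<omega> in auto)
  qed auto
  have Q2: "{\<omega> \<in> space M. l \<omega> (k + 1) < l \<omega> k \<and> c < ?D \<omega>} \<in> sets M" (is "?Q \<in> _")
  proof (rule locally_open_preimage_measurable[OF Y])
    fix \<omega> assume \<omega>: "\<omega> \<in> ?Q"
    \<comment> \<open>The first entry keeps the denominator above a quarter of the gap; the second
      then makes the loss smaller than the margin \<open>?D \<omega> - c\<close>.\<close>
    define r where "r = min (?gap \<omega> / 4) ((?D \<omega> - c) * (?gap \<omega> / 4))"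
    have r: "r > 0" using \<omega> by (auto simp: r_def)
    show "\<exists>r>0. \<forall>\<omega>'\<in>space M. dist (Y \<omega>) (Y \<omega>') < r \<longrightarrow> \<omega>' \<in> ?Q"
    proof (intro exI[of _ r] conjI ballI impI r)
      fix \<omega>' assume \<omega>': "\<omega>' \<in> space M" and "dist (Y \<omega>) (Y \<omega>') < r"
      then have d: "4 * dist (Y \<omega>) (Y \<omega>') < ?gap \<omega>" "dist (Y \<omega>) (Y \<omega>') < (?D \<omega> - c) * (?gap \<omega> / 4)"
        by (simp_all add: r_def)
      have gap: "?gap \<omega> > 0" using \<omega> by simp
      have "dist (Y \<omega>) (Y \<omega>') / (?gap \<omega> - dist (Y \<omega>) (Y \<omega>')) \<le> dist (Y \<omega>) (Y \<omega>') / (?gap \<omega> / 4)"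
        using d(1) gap by (intro divide_left_mono) auto
      also have "\<dots> < ?D \<omega> - c" using d(2) gap by (subst pos_divide_less_eq) simp_all
      finally have "c < ?D \<omega>'" using near(2)[OF _ \<omega>' d(1)] \<omega> by simp
      moreover have "l \<omega>' (k + 1) < l \<omega>' k" using near(1)[OF _ \<omega>' d(1)] \<omega> gap by simp
      ultimately show "\<omega>' \<in> ?Q" using \<omega>' by simp
    qed
  qed auto
  have "{\<omega> \<in> space M. l \<omega> (k + 1) < l \<omega> k \<and> ?D \<omega> \<le> c} = {\<omega> \<in> space M. l \<omega> (k + 1) < l \<omega> k} - ?Q"
    by auto
  then show ?thesis using sets.Diff[OF Q1 Q2] by simp
qed

theorem theorem2p5:
  fixes f :: "real ^ 'm \<Rightarrow> real"
    and grad :: "real ^ 'm \<Rightarrow> real ^ 'm"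
    and L \<epsilon> \<delta> :: real
    and \<rho> :: "real ^ 'm \<Rightarrow> real"
    and E :: "real ^ 'm ^ 'm"
    and lam :: "nat \<Rightarrow> real" and v :: "nat \<Rightarrow> real ^ 'm"
    and k n :: nat
    and M :: "'w measure"
    and X :: "nat \<Rightarrow> 'w \<Rightarrow> real ^ 'm"
    and Ehat :: "'w \<Rightarrow> real ^ 'm ^ 'm"
    and lamhat :: "'w \<Rightarrow> nat \<Rightarrow> real" and vhat :: "'w \<Rightarrow> nat \<Rightarrow> real ^ 'm"
  assumes f_nonconst: "\<not> f constant_on UNIV"
    and f_grad: "\<And>x. GDERIV f x :> grad x"
    and grad_cont: "continuous_on UNIV grad"
    and L_pos: "L > 0"
    and grad_bound: "\<And>x. norm (grad x) \<le> L"
    and rho_pos: "\<And>x. \<rho> x > 0"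
    and rho_bounded: "bounded (range \<rho>)"
    and rho_density: "has_bochner_integral lborel \<rho> 1"
    and f_sq_integrable: "integrable lborel (\<lambda>x. (f x)\<^sup>2 * \<rho> x)"
    and grad_prod_integrable: "\<And>i j. integrable lborel (\<lambda>x. grad x $ i * grad x $ j * \<rho> x)"
    and E_eq: "E = (LINT x|lborel. \<rho> x *\<^sub>R outer_square (grad x))"
    and E_eigen: "sorted_eigensystem E lam v"
    and k_range: "1 \<le> k" "k < CARD('m)"
    and gap: "lam k > lam (k + 1)"
    and M_prob: "prob_space M"
    and X_indep: "prob_space.indep_vars M (\<lambda>_. borel) X {1..n}"
    and X_distr: "\<And>j. j \<in> {1..n} \<Longrightarrow> distributed M lborel (X j) (\<lambda>x. ennreal (\<rho> x))"
    and Ehat_eq: "\<And>\<omega>. Ehat \<omega> = (1 / real n) *\<^sub>R (\<Sum>j=1..n. outer_square (grad (X j \<omega>)))"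
    and Ehat_eigen: "\<And>\<omega>. \<omega> \<in> space M \<Longrightarrow> sorted_eigensystem (Ehat \<omega>) (lamhat \<omega>) (vhat \<omega>)"
    and eps: "0 < \<epsilon>" "\<epsilon> < (lam k - lam (k + 1)) / (4 * spectral_norm E)"
    and delta: "0 < \<delta>" "\<delta> < 1"
    and n_large: "real n \<ge> 8 / (3 * \<epsilon>\<^sup>2) * (L\<^sup>2 / spectral_norm E) * ln (4 / \<delta> * intdim E)"
  shows "measure M {\<omega> \<in> space M.
           lamhat \<omega> k > lamhat \<omega> (k + 1) \<and>
           sin (largest_principal_angle (span (vhat \<omega> ` {1..k})) (span (v ` {1..k})))
             \<le> 4 * spectral_norm E / (lam k - lam (k + 1)) * \<epsilon>}
         \<ge> 1 - \<delta>"
proof -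
  interpret M: prob_space M by (rule M_prob)
  define e where "e = spectral_norm E"
  have E_norm: "norm (E *v x) \<le> e * norm x" for x
    unfolding e_def spectral_norm_def by (rule onorm) (rule matrix_vector_mul_bounded_linear)
  have E_le: "b \<bullet> (E *v b) \<le> e" if "norm b = 1" for b
    using norm_cauchy_schwarz[of b "E *v b"] E_norm[of b] that by simp
  have lam_eq: "v i \<bullet> (E *v v i) = lam i" and v_norm: "norm (v i) = 1" if "i \<in> {1..CARD('m)}" for i
    using that eigensystem_apply[OF E_eigen that] eigensystem_inner[OF E_eigen that that] by (simp_all add: norm_eq_1)
  define \<mu> where "\<mu> = density lborel (\<lambda>x. ennreal (\<rho> x))"
  have rho_meas [measurable]: "\<rho> \<in> borel_measurable lborel"
    using rho_density by (rule borel_measurable_has_bochner_integral)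
  have sets_mu: "sets \<mu> = sets borel" by (simp add: \<mu>_def)
  have "emeasure \<mu> (space \<mu>) = 1"
  proof -
    have "emeasure \<mu> (space \<mu>) = (\<integral>\<^sup>+x. ennreal (\<rho> x) \<partial>lborel)" by (simp add: \<mu>_def emeasure_density)
    also have "\<dots> = ennreal (LINT x|lborel. \<rho> x)"
      using rho_density rho_pos by (intro nn_integral_eq_integral) (auto simp: has_bochner_integral_iff less_imp_le)
    also have "\<dots> = 1" using has_bochner_integral_integral_eq[OF rho_density] by simp
    finally show ?thesis .
  qed
  then have prob_mu: "prob_space \<mu>" by (rule prob_spaceI)
  have grad_meas: "grad \<in> borel_measurable borel" by (rule borel_measurable_continuous_onI[OF grad_cont])
  then have grad_mu: "grad \<in> borel_measurable \<mu>" using measurable_cong_sets[OF sets_mu refl] by blast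
  have E_mu: "E = (LINT x|\<mu>. outer_square (grad x))"
    unfolding E_eq \<mu>_def
    by (rule integral_density[symmetric])
      (use rho_pos borel_measurable_continuous_onI[OF outer_square_continuous, THEN measurable_compose[OF grad_meas]]
        in \<open>auto intro: less_imp_le\<close>)
  \<comment> \<open>Facts on E alone are needed to see that n is positive, which the instance for n
    presupposes; the instance with one sample supplies them.\<close>
  interpret one: rank_one_samples \<mu> grad L 1
    by (intro rank_one_samples.intro prob_mu grad_mu grad_bound) simp
  have E1: "one.second_moment = E" by (simp add: one.second_moment_def E_mu)
  have lam_nonneg: "0 \<le> lam i" if "i \<in> {1..CARD('m)}" for i
    using one.second_moment_bounds(1)[of "v i"] lam_eq[OF that] by (simp add: E1)
  have lam_le: "lam i \<le> e" if "i \<in> {1..CARD('m)}" for i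
    using E_le[OF v_norm[OF that]] lam_eq[OF that] by simp
  \<comment> \<open>Nonnegativity of \<open>lam (k + 1)\<close> bounds the gap by the spectral norm,
    so the hypothesis on \<epsilon> makes it at most 1/4.\<close>
  have gap_le: "lam k - lam (k + 1) \<le> e" and e: "e > 0"
    using lam_le[of k] lam_nonneg[of "k + 1"] gap k_range by auto
  have "e \<le> norm E"
    unfolding e_def spectral_norm_def by (rule onorm_le) (rule norm_matrix_vector_le)
  also have "\<dots> \<le> trace E" using one.norm_second_moment_le_trace by (simp add: E1)
  finally have d: "1 \<le> trace E / e" using e by simp
  have eps_gap: "4 * (\<epsilon> * e) < lam k - lam (k + 1)"
    using eps(2) e by (simp add: e_def[symmetric] pos_less_divide_eq mult_ac)
  then have "4 * \<epsilon> * e < 1 * e" using gap_le by simp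
  then have eps4: "\<epsilon> \<le> 1 / 4" using e by (simp only: mult_less_cancel_right_pos)
  have n_large': "real n \<ge> 8 / (3 * \<epsilon>\<^sup>2) * (L\<^sup>2 / e) * ln (4 / \<delta> * (trace E / e))"
    using n_large by (simp add: e_def intdim_def)
  \<comment> \<open>The argument of the logarithm exceeds 1, since the intrinsic dimension is at
    least 1 and \<delta> < 1, so the lower bound on n is positive.\<close>
  have n_pos: "0 < n"
  proof -
    have "1 * 1 < 4 / \<delta> * (trace E / e)"
      using d delta by (intro mult_less_le_imp_less) (auto simp: field_simps)
    then have "0 < ln (4 / \<delta> * (trace E / e))" by simp
    then have "0 < 8 / (3 * \<epsilon>\<^sup>2) * (L\<^sup>2 / e) * ln (4 / \<delta> * (trace E / e))"
      using eps(1) e L_pos by (intro mult_pos_pos) auto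
    then have "0 < real n" using n_large' by linarith
    then show ?thesis by simp
  qed
  interpret rank_one_samples \<mu> grad L n
    by (intro rank_one_samples.intro prob_mu grad_mu grad_bound n_pos)
  have E2: "second_moment = E" by (simp add: second_moment_def E_mu)
  define Y where "Y = (\<lambda>\<omega>. \<lambda>j\<in>{1..n}. X j \<omega>)"
  have X_meas: "X j \<in> borel_measurable M" if "j \<in> {1..n}" for j
    using X_indep that by (simp add: M.indep_vars_def)
  have Y_meas: "Y \<in> measurable M (PiM {1..n} (\<lambda>_. \<mu>))"
    unfolding Y_def
    by (rule measurable_restrict) (use X_meas measurable_cong_sets[OF refl sets_mu] in blast)
  have distr_Y: "distr M (PiM {1..n} (\<lambda>_. \<mu>)) Y = PiM {1..n} (\<lambda>_. \<mu>)"
  proof -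
    have "distr M (PiM {1..n} (\<lambda>_. \<mu>)) Y = distr M (PiM {1..n} (\<lambda>_. borel)) Y"
      by (intro distr_cong sets_PiM_cong refl) (simp add: sets_mu)
    also have "\<dots> = PiM {1..n} (\<lambda>i. distr M borel (X i))"
      unfolding Y_def
      by (rule M.indep_vars_iff_distr_eq_PiM'[THEN iffD1]) (use n_pos X_meas X_indep in auto)
    also have "\<dots> = PiM {1..n} (\<lambda>_. \<mu>)"
    proof (rule PiM_cong[OF refl])
      fix i assume i: "i \<in> {1..n}"
      have "distr M borel (X i) = distr M lborel (X i)" by (rule distr_cong) simp_all
      also have "\<dots> = \<mu>" unfolding \<mu>_def by (rule distributed_distr_eq_density[OF X_distr[OF i]])
      finally show "distr M borel (X i) = \<mu>" .
    qed
    finally show ?thesis .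
  qed
  have dev: "deviation (Y \<omega>) = Ehat \<omega> - E" for \<omega>
    by (simp add: deviation_def E2 Ehat_eq Y_def)
  obtain G where G: "G \<in> sets M" "measure M G \<ge> 1 - \<delta>"
      "\<And>\<omega> x. \<omega> \<in> G \<Longrightarrow> norm (Ehat \<omega> *v x - E *v x) \<le> \<epsilon> * e * norm x"
    using sample_deviation_probability[OF M_prob Y_meas distr_Y e, unfolded E2 dev,
        OF E_le d L_pos eps(1) eps4 delta n_large']
    unfolding matrix_vector_mult_diff_rdistrib by blast
  let ?c = "4 * spectral_norm E / (lam k - lam (k + 1)) * \<epsilon>"
  let ?ev = "{\<omega> \<in> space M. lamhat \<omega> (k + 1) < lamhat \<omega> k \<and>
     onorm (\<lambda>x. eigen_proj v {1..k} x - eigen_proj (vhat \<omega>) {1..k} x) \<le> ?c}"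
  have k_sub: "{1..k} \<subseteq> {1..CARD('m)}" using k_range by auto
  have event_eq: "{\<omega> \<in> space M.
           lamhat \<omega> k > lamhat \<omega> (k + 1) \<and>
           sin (largest_principal_angle (span (vhat \<omega> ` {1..k})) (span (v ` {1..k}))) \<le> ?c} = ?ev"
    using sin_largest_principal_angle_eigenspaces[OF E_eigen Ehat_eigen k_sub] by auto
  have Ehat_meas: "Ehat \<in> borel_measurable M"
  proof -
    have "(\<lambda>\<omega>. outer_square (grad (X j \<omega>))) \<in> borel_measurable M" if "j \<in> {1..n}" for j
      using measurable_compose[OF measurable_compose[OF X_meas[OF that] grad_meas]
          borel_measurable_continuous_onI[OF outer_square_continuous]] .
    then have "(\<lambda>\<omega>. (1 / real n) *\<^sub>R (\<Sum>j=1..n. outer_square (grad (X j \<omega>)))) \<in> borel_measurable M"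
      by (intro borel_measurable_scaleR borel_measurable_const borel_measurable_sum)
    moreover have "Ehat = (\<lambda>\<omega>. (1 / real n) *\<^sub>R (\<Sum>j=1..n. outer_square (grad (X j \<omega>))))"
      by (rule ext) (rule Ehat_eq)
    ultimately show ?thesis by simp
  qed
  \<comment> \<open>\<open>measure\<close> is 0 by default on sets outside \<open>sets M\<close>, so
    passing from G to the event requires its measurability.\<close>
  have ev_meas: "?ev \<in> sets M"
    by (rule eigengap_event_measurable[OF Ehat_meas Ehat_eigen k_range])
  have "G \<subseteq> ?ev"
  proof
    fix \<omega> assume \<omega>: "\<omega> \<in> G"
    then have sp: "\<omega> \<in> space M" using G(1) sets.sets_into_space by blast
    let ?\<eta> = "\<epsilon> * e" and ?g = "lam k - lam (k + 1)"
    have \<eta>: "norm (E *v x - Ehat \<omega> *v x) \<le> ?\<eta> * norm x" for x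
      using G(3)[OF \<omega>, of x] by (simp add: norm_minus_commute)
    have \<eta>0: "0 \<le> ?\<eta>" using eps(1) e by simp
    have \<eta>_gap: "?\<eta> < ?g" using eps_gap \<eta>0 by linarith
    note pert = eigenspace_perturbation[OF E_eigen Ehat_eigen[OF sp] \<eta> \<eta>0 k_range \<eta>_gap]
    have gap_hat: "lamhat \<omega> (k + 1) < lamhat \<omega> k" using pert(2) eps_gap \<eta>0 by linarith
    \<comment> \<open>From 4 \<eta> < g for the gap g it follows that g - \<eta> exceeds 3 g / 4,
      hence g / 4; this is where the factor 4 of the claim appears.\<close>
    have "?\<eta> / (?g - ?\<eta>) \<le> ?\<eta> / (?g / 4)"
    proof (rule divide_left_mono)
      show "?g / 4 \<le> ?g - ?\<eta>" using eps_gap \<eta>0 by simp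
      show "0 < (?g - ?\<eta>) * (?g / 4)" using \<eta>_gap gap by (intro mult_pos_pos) auto
    qed (rule \<eta>0)
    moreover have "?\<eta> / (?g / 4) = ?c" by (simp add: e_def[symmetric] mult_ac)
    ultimately have "onorm (\<lambda>x. eigen_proj v {1..k} x - eigen_proj (vhat \<omega>) {1..k} x) \<le> ?c"
      using pert(1) by linarith
    then show "\<omega> \<in> ?ev" using gap_hat sp by simp
  qed
  then have "measure M G \<le> measure M ?ev" using ev_meas by (rule M.finite_measure_mono)
  then show ?thesis using G(2) unfolding event_eq by linarith
qed

end
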